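(* Let $d\in\mathbb{N}$, $x\in\mathbb{R}^d$, $T>0$, $\varepsilon_0>0$, and let $\mu\colon\mathbb{R}^d\to\mathbb{R}^d$, $\sigma\colon\mathbb{R}^d\to\mathbb{R}^{d,d}$ satisfy: (a) $\sigma$ is Lipschitz; (b) $\mu$ is piecewise Lipschitz and its exceptional set $\Theta$ is a $C^4$-hypersurface with reach $r_\Theta>\varepsilon_0$ such that every unit normal vector $n$ of $\Theta$ has bounded second and third derivative; (c) $\sup_{y\in\Theta^{\varepsilon_0}}(\|\mu(y)\|+\|\sigma(y)\|)<\infty$; (d) there is a constant $c_0>0$ with $\|\sigma(\xi)^\top n(\xi)\|\ge c_0$ for all $\xi\in\Theta$; (e) the function $\alpha\colon\Theta\to\mathbb{R}^d$, $\alpha(\xi)=\lim_{h\to0+}\frac{\mu(\xi-hn(\xi))-\mu(\xi+hn(\xi))}{2\|\sigma(\xi)^\top n(\xi)\|^2}$, is well defined, bounded, and belongs to $C^3_b(\Theta;\mathbb{R}^d)$. Then there exists a constant $C_{\mathrm{cost}}>0$, not depending on $\delta$, such that for every $\delta\in(0,1)$ with $\varepsilon_1=\varepsilon_1(\delta)<\varepsilon_0/4$, the number of steps $N(h,\delta)=\inf\{k\in\mathbb{N}:\tau_k\ge T\}$ of the adaptive Euler-Maruyama scheme with parameter $\delta$ started in $x$ (defined in the context) satisfies $$\mathbb{E}[N(h,\delta)]\le C_{\mathrm{cost}}\cdot(1+\log(1/\delta))\,\delta^{-1}.$$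
   Context: All random variables live on a filtered probability space $(\Omega,\mathcal{F},(\mathcal{F}_t)_{t\ge0},\mathbb{P})$ with a normal filtration, and $W$ is a $d$-dimensional Brownian motion on it. $\|\cdot\|$ is the Euclidean norm for vectors and a compatible norm for matrices ($\|Av\|\le\|A\|\|v\|$). Piecewise Lipschitz: for $A\subseteq\mathbb{R}^d$ the intrinsic metric $\rho(x,y)$ on $A$ is the infimum of the lengths of continuous curves in $A$ from $x$ to $y$ ($\infty$ if there is none). A function $f\colon\mathbb{R}^d\to\mathbb{R}^m$ is piecewise Lipschitz if there is a hypersurface $\Theta$ with finitely many connected components (an exceptional set of $f$) and $L>0$ such that $\|f(x)-f(y)\|\le L\rho(x,y)$ for all $x,y\in\mathbb{R}^d\setminus\Theta$, with $\rho$ the intrinsic metric on $\mathbb{R}^d\setminus\Theta$. Geometry: $d(x,\Theta)=\inf\{\|x-y\|:y\in\Theta\}$, $\Theta^\varepsilon=\{x\in\mathbb{R}^d:d(x,\Theta)<\varepsilon\}$. $\Theta^\varepsilon$ has the unique closest point property if each $x\in\Theta^\varepsilon$ has a unique closest point in $\Theta$; the reach $r_\Theta$ is the supremum of all $\varepsilon>0$ for which this holds (0 if none). A unit normal vector $n$ of $\Theta$ is a (locally defined) $C^3$ function on an open part of $\Theta$ with $\|n(\zeta)\|=1$ and $n(\zeta)$ orthogonal to the tangent space of $\Theta$ at $\zeta$. Scheme: let $S:=\sup_{y\in\Theta^{\varepsilon_0}}\|\sigma(y)\|$ and, for $\delta\in(0,1)$, $\varepsilon_1=S\log(1/\delta)\sqrt{\delta}$,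 $\varepsilon_2=S\log(1/\delta)\,\delta$. The step size function is $$h(y,\delta)=\begin{cases}\delta^2,&y\in\Theta^{\varepsilon_2},\\ \frac{1}{S^2}\left(\frac{d(y,\Theta)}{\log(1/\delta)}\right)^2,&y\in\Theta^{\varepsilon_1}\setminus\Theta^{\varepsilon_2},\\ \delta,&y\notin\Theta^{\varepsilon_1}.\end{cases}$$ The adaptive Euler-Maruyama scheme is $\tau_0=0$, $X^h_0=x$, and for $k\in\mathbb{N}_0$: $\tau_{k+1}=\tau_k+h(X^h_{\tau_k},\delta)$ and $X^h_t=X^h_{\tau_k}+\mu(X^h_{\tau_k})(t-\tau_k)+\sigma(X^h_{\tau_k})(W_t-W_{\tau_k})$ for $t\in(\tau_k,\tau_{k+1}]$. *)

theory Defs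
  imports "HOL-Probability.Probability"
begin

subsection \<open>Filtered probability space and Brownian motion\<close>

definition normal_filtration :: "'w measure \<Rightarrow> (real \<Rightarrow> 'w measure) \<Rightarrow> bool" where
  "normal_filtration M F \<longleftrightarrow>
     (\<forall>t\<ge>0. subalgebra M (F t)) \<and>
     (\<forall>s t. 0 \<le> s \<and> s \<le> t \<longrightarrow> sets (F s) \<subseteq> sets (F t)) \<and>
     null_sets M \<subseteq> sets (F 0) \<and>
     (\<forall>t\<ge>0. sets (F t) = (\<Inter>s\<in>{t<..}. sets (F s)))"

text \<open>The density in the last clause is that of the centred normal law with
  covariance matrix \<open>(t - s) I\<close>.\<close>

definition brownian_motion ::
  "'w measure \<Rightarrow> (real \<Rightarrow> 'w measure) \<Rightarrow> (real \<Rightarrow> 'w \<Rightarrow> real ^ 'n) \<Rightarrow> bool" where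
  "brownian_motion M F W \<longleftrightarrow>
     (\<forall>t\<ge>0. W t \<in> borel_measurable (F t)) \<and>
     (AE \<omega> in M. W 0 \<omega> = 0) \<and>
     (AE \<omega> in M. continuous_on {0..} (\<lambda>t. W t \<omega>)) \<and>
     (\<forall>s t. 0 \<le> s \<and> s < t \<longrightarrow>
        prob_space.indep_set M (sets (F s))
          {(\<lambda>\<omega>. W t \<omega> - W s \<omega>) -` A \<inter> space M | A. A \<in> sets borel} \<and>
        distributed M lborel (\<lambda>\<omega>. W t \<omega> - W s \<omega>)
          (\<lambda>v. ennreal (\<Prod>i\<in>UNIV. normal_density 0 (sqrt (t - s)) (v $ i))))"

subsection \<open>Matrix norms\<close>

definition compatible_matrix_norm :: "(real ^ 'n ^ 'n \<Rightarrow> real) \<Rightarrow> bool" where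
  "compatible_matrix_norm nm \<longleftrightarrow>
     (\<forall>A. 0 \<le> nm A) \<and> (\<forall>A. nm A = 0 \<longleftrightarrow> A = 0) \<and>
     (\<forall>c A. nm (c *\<^sub>R A) = \<bar>c\<bar> * nm A) \<and>
     (\<forall>A B. nm (A + B) \<le> nm A + nm B) \<and>
     (\<forall>A v. norm (A *v v) \<le> nm A * norm v)"

subsection \<open>Hypersurfaces\<close>

text \<open>In finite dimension a map is of class \<open>C\<^sup>k\<^sup>+\<^sup>1\<close> iff it is differentiable and all its
  directional derivatives are of class \<open>C\<^sup>k\<close>; this keeps the type fixed in the recursion.\<close>

primrec C_diff_on ::
  "nat \<Rightarrow> ('a::euclidean_space \<Rightarrow> 'b::real_normed_vector) \<Rightarrow> 'a set \<Rightarrow> bool" where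
  "C_diff_on 0 f U \<longleftrightarrow> continuous_on U f"
| "C_diff_on (Suc k) f U \<longleftrightarrow>
     (\<exists>f'. (\<forall>x\<in>U. (f has_derivative f' x) (at x)) \<and> (\<forall>v. C_diff_on k (\<lambda>x. f' x v) U))"

text \<open>A hypersurface of class \<open>C\<^sup>k\<close> is a subset that is locally mapped onto an open part of a
  coordinate hyperplane by a \<open>C\<^sup>k\<close>-diffeomorphism (a homeomorphism if \<open>k = 0\<close>) of open sets of
  the ambient space.\<close>

definition hypersurface :: "nat \<Rightarrow> (real ^ 'n) set \<Rightarrow> bool" where
  "hypersurface k \<Theta> \<longleftrightarrow>
     (\<forall>\<xi>\<in>\<Theta>. \<exists>U V (\<phi> :: real ^ 'n \<Rightarrow> real ^ 'n) \<psi> i. open U \<and> \<xi> \<in> U \<and> open V \<and> homeomorphism U V \<phi> \<psi> \<and>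
        C_diff_on k \<phi> U \<and> C_diff_on k \<psi> V \<and> \<phi> ` (\<Theta> \<inter> U) = {v \<in> V. v $ i = 0})"

definition tangent_space :: "'a::euclidean_space set \<Rightarrow> 'a \<Rightarrow> 'a set" where
  "tangent_space \<Theta> \<xi> =
     {v. \<exists>\<gamma> e. 0 < e \<and> \<gamma> ` {-e<..<e} \<subseteq> \<Theta> \<and> \<gamma> 0 = \<xi> \<and> (\<gamma> has_vector_derivative v) (at (0::real))}"

subsection \<open>Derivatives along a hypersurface\<close>

text \<open>The derivative within \<open>\<Theta>\<close> determines a linear map only on the tangent space. It is
  extended to the ambient space by \<open>0\<close> on the normal space, so that derivatives at different
  points lie in one space and the operation can be iterated.\<close>

definition has_tangential_derivative ::
  "'a::euclidean_space set \<Rightarrow> ('a \<Rightarrow> 'b::real_normed_vector) \<Rightarrow> ('a \<Rightarrow>\<^sub>L 'b) \<Rightarrow> 'a \<Rightarrow> bool" where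
  "has_tangential_derivative \<Theta> f D \<xi> \<longleftrightarrow>
     (f has_derivative blinfun_apply D) (at \<xi> within \<Theta>) \<and>
     (\<forall>v. (\<forall>t\<in>tangent_space \<Theta> \<xi>. orthogonal v t) \<longrightarrow> blinfun_apply D v = 0)"

definition tangentially_differentiable_on ::
  "'a::euclidean_space set \<Rightarrow> ('a \<Rightarrow> 'b::real_normed_vector) \<Rightarrow> 'a set \<Rightarrow> bool" where
  "tangentially_differentiable_on \<Theta> f V \<longleftrightarrow> (\<forall>\<xi>\<in>V. \<exists>D. has_tangential_derivative \<Theta> f D \<xi>)"

definition tangential_derivative ::
  "'a::euclidean_space set \<Rightarrow> ('a \<Rightarrow> 'b::real_normed_vector) \<Rightarrow> 'a \<Rightarrow> ('a \<Rightarrow>\<^sub>L 'b)" where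
  "tangential_derivative \<Theta> f \<xi> = (THE D. has_tangential_derivative \<Theta> f D \<xi>)"

abbreviation tangential_derivative2 ::
  "'a::euclidean_space set \<Rightarrow> ('a \<Rightarrow> 'b::real_normed_vector) \<Rightarrow> 'a \<Rightarrow> ('a \<Rightarrow>\<^sub>L 'a \<Rightarrow>\<^sub>L 'b)" where
  "tangential_derivative2 \<Theta> f \<equiv> tangential_derivative \<Theta> (tangential_derivative \<Theta> f)"

abbreviation tangential_derivative3 ::
  "'a::euclidean_space set \<Rightarrow> ('a \<Rightarrow> 'b::real_normed_vector) \<Rightarrow> 'a \<Rightarrow> ('a \<Rightarrow>\<^sub>L 'a \<Rightarrow>\<^sub>L 'a \<Rightarrow>\<^sub>L 'b)" where
  "tangential_derivative3 \<Theta> f \<equiv> tangential_derivative \<Theta> (tangential_derivative2 \<Theta> f)"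

text \<open>In the next two definitions \<open>V\<close> is meant to be a relatively open part of \<open>\<Theta>\<close>.\<close>

definition C3_along ::
  "'a::euclidean_space set \<Rightarrow> ('a \<Rightarrow> 'b::real_normed_vector) \<Rightarrow> 'a set \<Rightarrow> bool" where
  "C3_along \<Theta> f V \<longleftrightarrow>
     tangentially_differentiable_on \<Theta> f V \<and>
     tangentially_differentiable_on \<Theta> (tangential_derivative \<Theta> f) V \<and>
     tangentially_differentiable_on \<Theta> (tangential_derivative2 \<Theta> f) V \<and>
     continuous_on V (tangential_derivative3 \<Theta> f)"

definition C3b_along ::
  "'a::euclidean_space set \<Rightarrow> ('a \<Rightarrow> 'b::real_normed_vector) \<Rightarrow> 'a set \<Rightarrow> bool" where
  "C3b_along \<Theta> f V \<longleftrightarrow>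
     C3_along \<Theta> f V \<and> bounded (f ` V) \<and> bounded (tangential_derivative \<Theta> f ` V) \<and>
     bounded (tangential_derivative2 \<Theta> f ` V) \<and> bounded (tangential_derivative3 \<Theta> f ` V)"

definition unit_normal_at :: "'a::euclidean_space set \<Rightarrow> 'a \<Rightarrow> 'a \<Rightarrow> bool" where
  "unit_normal_at \<Theta> \<xi> v \<longleftrightarrow> norm v = 1 \<and> (\<forall>t\<in>tangent_space \<Theta> \<xi>. orthogonal v t)"

definition unit_normal_vector ::
  "'a::euclidean_space set \<Rightarrow> 'a set \<Rightarrow> ('a \<Rightarrow> 'a) \<Rightarrow> bool" where
  "unit_normal_vector \<Theta> V n \<longleftrightarrow>
     openin (top_of_set \<Theta>) V \<and> (\<forall>\<zeta>\<in>V. unit_normal_at \<Theta> \<zeta> (n \<zeta>)) \<and> C3_along \<Theta> n V"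

subsection \<open>Piecewise Lipschitz functions\<close>

definition path_length :: "(real \<Rightarrow> 'a::metric_space) \<Rightarrow> ennreal" where
  "path_length \<gamma> =
     (SUP (m, t)\<in>{(m, t). t ` {..m} \<subseteq> {0..1} \<and> mono_on {..m} t}.
        \<Sum>i<m::nat. ennreal (dist (\<gamma> (t i)) (\<gamma> (t (Suc i)))))"

definition intrinsic_metric :: "'a::metric_space set \<Rightarrow> 'a \<Rightarrow> 'a \<Rightarrow> ennreal" where
  "intrinsic_metric A x y =
     (INF \<gamma>\<in>{\<gamma>. path \<gamma> \<and> path_image \<gamma> \<subseteq> A \<and> pathstart \<gamma> = x \<and> pathfinish \<gamma> = y}. path_length \<gamma>)"

text \<open>A function is piecewise Lipschitz iff it has an exceptional set. No smoothness of the
  hypersurface is asked for here.\<close>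

definition exceptional_set :: "(real ^ 'n \<Rightarrow> real ^ 'm) \<Rightarrow> (real ^ 'n) set \<Rightarrow> bool" where
  "exceptional_set f \<Theta> \<longleftrightarrow>
     hypersurface 0 \<Theta> \<and> finite (components \<Theta>) \<and>
     (\<exists>L>0. \<forall>x\<in>-\<Theta>. \<forall>y\<in>-\<Theta>.
        ennreal (norm (f x - f y)) \<le> ennreal L * intrinsic_metric (-\<Theta>) x y)"

subsection \<open>Tubular neighbourhoods and reach\<close>

text \<open>The distance to the empty set is infinite, whereas \<open>infdist x {} = 0\<close>; hence the
  clause \<open>\<Theta> \<noteq> {}\<close>.\<close>

definition tube :: "'a::metric_space set \<Rightarrow> real \<Rightarrow> 'a set" where
  "tube \<Theta> \<epsilon> = {x. \<Theta> \<noteq> {} \<and> infdist x \<Theta> < \<epsilon>}"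

definition unique_closest_point :: "'a::metric_space set \<Rightarrow> real \<Rightarrow> bool" where
  "unique_closest_point \<Theta> \<epsilon> \<longleftrightarrow>
     (\<forall>x\<in>tube \<Theta> \<epsilon>. \<exists>!y. y \<in> \<Theta> \<and> (\<forall>z\<in>\<Theta>. dist x y \<le> dist x z))"

definition reach :: "'a::metric_space set \<Rightarrow> ennreal" where
  "reach \<Theta> = (SUP \<epsilon>\<in>{\<epsilon>. 0 < \<epsilon> \<and> unique_closest_point \<Theta> \<epsilon>}. ennreal \<epsilon>)"

subsection \<open>The adaptive Euler-Maruyama scheme\<close>

text \<open>Inserting \<open>0\<close> has no effect on the supremum of nonnegative numbers, except that it
  fixes the value \<open>0\<close> for an empty tube.\<close>

definition sup_sigma ::
  "(real ^ 'n ^ 'n \<Rightarrow> real) \<Rightarrow> (real ^ 'n \<Rightarrow> real ^ 'n ^ 'n) \<Rightarrow> (real ^ 'n) set \<Rightarrow> real \<Rightarrow> real" where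
  "sup_sigma nm \<sigma> \<Theta> \<epsilon>\<^sub>0 = Sup (insert 0 ((\<lambda>y. nm (\<sigma> y)) ` tube \<Theta> \<epsilon>\<^sub>0))"

definition eps1 :: "real \<Rightarrow> real \<Rightarrow> real" where
  "eps1 S \<delta> = S * ln (1 / \<delta>) * sqrt \<delta>"

definition eps2 :: "real \<Rightarrow> real \<Rightarrow> real" where
  "eps2 S \<delta> = S * ln (1 / \<delta>) * \<delta>"

definition step_size :: "real \<Rightarrow> 'a::metric_space set \<Rightarrow> real \<Rightarrow> 'a \<Rightarrow> real" where
  "step_size S \<Theta> \<delta> y =
     (if y \<in> tube \<Theta> (eps2 S \<delta>) then \<delta>\<^sup>2
      else if y \<in> tube \<Theta> (eps1 S \<delta>) then 1 / S\<^sup>2 * (infdist y \<Theta> / ln (1 / \<delta>))\<^sup>2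
      else \<delta>)"

text \<open>The pair \<open>(\<tau>\<^sub>k, X\<^sup>h\<close> at time \<open>\<tau>\<^sub>k)\<close> for the driving path \<open>w\<close>. The values of the scheme
  between grid points influence neither later grid points nor the number of steps.\<close>

primrec adaptive_EM ::
  "(real ^ 'n \<Rightarrow> real ^ 'n) \<Rightarrow> (real ^ 'n \<Rightarrow> real ^ 'n ^ 'n) \<Rightarrow> (real ^ 'n \<Rightarrow> real) \<Rightarrow> real ^ 'n \<Rightarrow>
   (real \<Rightarrow> real ^ 'n) \<Rightarrow> nat \<Rightarrow> real \<times> (real ^ 'n)" where
  "adaptive_EM \<mu> \<sigma> h x w 0 = (0, x)"
| "adaptive_EM \<mu> \<sigma> h x w (Suc k) =
     (let (t, y) = adaptive_EM \<mu> \<sigma> h x w k; t' = t + h y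
      in (t', y + (t' - t) *\<^sub>R \<mu> y + \<sigma> y *v (w t' - w t)))"

definition num_steps ::
  "(real ^ 'n \<Rightarrow> real ^ 'n) \<Rightarrow> (real ^ 'n \<Rightarrow> real ^ 'n ^ 'n) \<Rightarrow> (real ^ 'n \<Rightarrow> real) \<Rightarrow> real ^ 'n \<Rightarrow>
   real \<Rightarrow> (real \<Rightarrow> real ^ 'n) \<Rightarrow> ennreal" where
  "num_steps \<mu> \<sigma> h x T w = (INF k\<in>{k. T \<le> fst (adaptive_EM \<mu> \<sigma> h x w k)}. of_nat k)"

end

theory Submission
  imports Defs "HOL-Real_Asymp.Real_Asymp"
begin

text \<open>
  Along the scheme consider \<open>C (T + 1 - \<tau>\<^sub>k) + Q (X\<^sub>k)\<close>, where
  \<open>Q = (max 0 (a - g (d(\<cdot>, \<Theta>))))\<^sup>2\<close> and \<open>g\<close> is convex with \<open>g'' (r)\<close> comparable to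
  \<open>\<delta> / ln (1 / \<delta>)\<close> times the reciprocal of the step size at distance \<open>r\<close>. In each step the
  expectation of this bounded nonnegative quantity decreases by at least \<open>c \<delta> / ln (1 / \<delta>)\<close>,
  hence the expected number of steps is at most a constant times \<open>ln (1 / \<delta>) / \<delta>\<close>.

  The distance needs no regularity. Positive reach gives, at a nearest point \<open>\<xi>\<close> of \<open>y\<close>, a ball
  of fixed radius \<open>R\<close> in the direction \<open>\<nu>\<close> of \<open>y\<close> that does not meet \<open>\<Theta>\<close>, so that
  \<open>d(y + v, \<Theta>) \<ge> d(y, \<Theta>) + \<nu> \<cdot> v - |v|\<^sup>2 / R\<close>. As \<open>g\<close> is convex, steps that are large
  compared with \<open>d(y, \<Theta>)\<close> only help, and second and fourth moments of the Gaussian increments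
  suffice. Far from \<open>\<Theta>\<close>, where \<open>\<mu>\<close> and \<open>\<sigma>\<close> grow at most linearly in the distance, \<open>Q\<close>
  vanishes and Chebyshev's inequality bounds the effect of jumps back to \<open>\<Theta>\<close>.
\<close>

subsection \<open>Normal balls of sets with positive reach\<close>

text \<open>Dividing \<open>T\<close> by the smallest step bounds the number of steps only by order
  \<open>1 / \<delta>\<^sup>2\<close>; the point is that the scheme spends little time close to
  \<Theta>. The potential measures this directly for the discrete scheme, and the step size dictates
  its shape. Write \<open>l = ln (1 / \<delta>)\<close>,
  \<open>\<epsilon> = S * l * \<delta>\<close> and \<open>\<rho>\<close> for the distance plus
  \<open>\<epsilon>\<close>. In the tube of radius \<open>eps1 S \<delta>\<close> the step
  \<open>h\<close> is comparable to \<open>(\<rho> / (S * l))\<^sup>2\<close>, so for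
  \<open>g'' = \<epsilon> / \<rho>\<^sup>2\<close> the gain \<open>g'' * h\<close> is of order
  \<open>\<epsilon> / l\<^sup>2\<close>, that is \<open>\<delta> / l\<close>, at every distance.
  This is the source of the logarithm. The integral of \<open>\<epsilon> / \<rho>\<^sup>2\<close>
  over all distances is 1, so \<open>g' \<le> 1\<close> uniformly in \<delta>, and drift, curvature
  and remainder cost at most a constant times \<open>h\<close>. The time term pays for these costs,
  because the step lengths add up to the elapsed time. Nondegeneracy of the noise in the normal
  direction is what turns the convexity of \<open>g\<close> into a gain.\<close>

lemma infdist_eq_dist_iff_closest:
  assumes "y \<in> \<Theta>"
  shows "(\<forall>z\<in>\<Theta>. dist x y \<le> dist x z) \<longleftrightarrow> infdist x \<Theta> = dist x y"
proof
  assume *: "\<forall>z\<in>\<Theta>. dist x y \<le> dist x z"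
  show "infdist x \<Theta> = dist x y"
    using assms * by (intro antisym infdist_le) (auto simp: infdist_def intro!: cINF_greatest)
next
  assume "infdist x \<Theta> = dist x y"
  then show "\<forall>z\<in>\<Theta>. dist x y \<le> dist x z"
    using infdist_le by metis
qed

lemma unique_closest_pointD:
  assumes "unique_closest_point \<Theta> e" "\<Theta> \<noteq> {}" "infdist x \<Theta> < e"
  shows "\<exists>!y. y \<in> \<Theta> \<and> infdist x \<Theta> = dist x y"
proof -
  have "\<exists>!y. y \<in> \<Theta> \<and> (\<forall>z\<in>\<Theta>. dist x y \<le> dist x z)"
    using assms by (auto simp: unique_closest_point_def tube_def)
  then show ?thesis
    using infdist_eq_dist_iff_closest by metis
qed

text \<open>A point of the closure has distance 0 to \<Theta>, so the nearest point that the
  hypothesis provides is the point itself.\<close>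

lemma unique_closest_point_imp_closed:
  assumes "unique_closest_point \<Theta> e" "0 < e"
  shows "closed \<Theta>"
proof (cases "\<Theta> = {}")
  case False
  have "x \<in> \<Theta>" if "x \<in> closure \<Theta>" for x
  proof -
    have "infdist x \<Theta> = 0"
      using that False in_closure_iff_infdist_zero by blast
    then show ?thesis
      using unique_closest_pointD[OF assms(1) False, of x] assms(2) by auto
  qed
  then show ?thesis
    by (metis closure_subset closure_eq subsetI subset_antisym)
qed auto

text \<open>A map into a compact set is continuous once its graph is closed. Uniqueness of the
  nearest point identifies the graph with a set of pairs cut out of a compact product by the closed
  condition \<open>infdist x \<Theta> = dist x y\<close>.\<close>

lemma continuous_on_nearest_point:
  fixes \<Theta> :: "'a::euclidean_space set"
  assumes "unique_closest_point \<Theta> e" "0 < e" "\<Theta> \<noteq> {}" "compact K"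
    and K: "\<And>x. x \<in> K \<Longrightarrow> infdist x \<Theta> < e"
    and p: "\<And>x. x \<in> K \<Longrightarrow> p x \<in> \<Theta> \<and> infdist x \<Theta> = dist x (p x)"
  shows "continuous_on K p"
proof -
  obtain B where B: "\<And>x. x \<in> K \<Longrightarrow> norm x \<le> B"
    using \<open>compact K\<close> compact_imp_bounded bounded_iff by metis
  define T where "T = \<Theta> \<inter> cball 0 (B + e)"
  have cl: "closed \<Theta>"
    using assms unique_closest_point_imp_closed by blast
  have "compact T"
    unfolding T_def using cl by (simp add: closed_Int_compact)
  moreover have "p \<in> K \<rightarrow> T"
  proof
    fix x assume x: "x \<in> K"
    have "norm (p x) \<le> norm x + dist x (p x)"
      by (metis dist_norm norm_minus_commute norm_triangle_sub)
    then show "p x \<in> T"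
      using p[OF x] K[OF x] B[OF x] by (auto simp: T_def)
  qed
  moreover have "closed ((\<lambda>x. (x, p x)) ` K)"
  proof -
    have "(\<lambda>x. (x, p x)) ` K = (K \<times> T) \<inter> {z. infdist (fst z) \<Theta> = dist (fst z) (snd z)}" (is "?l = ?r")
    proof
      show "?l \<subseteq> ?r"
        using p \<open>p \<in> K \<rightarrow> T\<close> by auto
      show "?r \<subseteq> ?l"
      proof
        fix z assume z: "z \<in> ?r"
        then have "\<exists>!y. y \<in> \<Theta> \<and> infdist (fst z) \<Theta> = dist (fst z) y"
          using unique_closest_pointD[OF assms(1,3) K[of "fst z"]] by force
        then have "snd z = p (fst z)"
          using z p[of "fst z"] by (auto simp: T_def)
        then show "z \<in> ?l"
          using z by (auto simp: image_iff intro: prod_eqI)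
      qed
    qed
    moreover have "closed {z::'a\<times>'a. infdist (fst z) \<Theta> = dist (fst z) (snd z)}"
      by (intro closed_Collect_eq continuous_intros)
    ultimately show ?thesis
      using \<open>compact K\<close> \<open>compact T\<close> by (simp add: closed_Int closed_Times compact_imp_closed)
  qed
  ultimately show ?thesis
    by (rule continuous_from_closed_graph)
qed

text \<open>One step of the extension of normal segments up to the reach: the point at distance
  \<open>s\<close> beyond \<open>z\<close> is a fixed point of the map that pushes \<open>z\<close> away from the nearest
  point of its argument.\<close>

lemma normal_segment_step:
  fixes \<Theta> :: "'a::euclidean_space set"
  assumes U: "unique_closest_point \<Theta> e" "0 < e" "\<Theta> \<noteq> {}"
    and \<xi>: "\<xi> \<in> \<Theta>" "norm \<nu> = 1" "infdist (\<xi> + t *\<^sub>R \<nu>) \<Theta> = t" "0 < t"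
    and s: "0 < s" "s < t" "t + s < e"
  shows "infdist (\<xi> + (t + s) *\<^sub>R \<nu>) \<Theta> = t + s"
proof -
  define z where "z = \<xi> + t *\<^sub>R \<nu>"
  define p where "p x = (SOME y. y \<in> \<Theta> \<and> infdist x \<Theta> = dist x y)" for x
  have near: "infdist x \<Theta> < e" if "x \<in> cball z s" for x
    using infdist_triangle[of x \<Theta> z] that s \<xi>(3) by (auto simp: z_def dist_commute)
  have p: "p x \<in> \<Theta> \<and> infdist x \<Theta> = dist x (p x)" if "x \<in> cball z s" for x
    unfolding p_def using unique_closest_pointD[OF U(1,3) near[OF that]]
    by (intro someI_ex[of "\<lambda>y. y \<in> \<Theta> \<and> infdist x \<Theta> = dist x y"]) blast
  have cont: "continuous_on (cball z s) p"
    by (rule continuous_on_nearest_point[OF U compact_cball near p])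
  have zp: "p x \<noteq> z" if "x \<in> cball z s" for x
  proof
    assume "p x = z"
    then have "z \<in> \<Theta>" using p[OF that] by auto
    then show False using \<xi> by (auto simp: z_def)
  qed
  define f where "f x = z + (s / norm (z - p x)) *\<^sub>R (z - p x)" for x
  have "continuous_on (cball z s) f"
    unfolding f_def
  proof (intro continuous_intros cont ballI)
    fix x assume "x \<in> cball z s"
    then show "norm (z - p x) \<noteq> 0" using zp[of x] by simp
  qed
  moreover have "f \<in> cball z s \<rightarrow> cball z s"
  proof
    fix x assume "x \<in> cball z s"
    then show "f x \<in> cball z s" using zp[of x] s by (simp add: f_def dist_norm)
  qed
  ultimately obtain x where x: "x \<in> cball z s" "f x = x"
    using brouwer_ball[OF s(1)] by metis
  define q where "q = z - p x"
  have q: "q \<noteq> 0" using zp[OF x(1)] by (auto simp: q_def)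
  have xq: "x = z + (s / norm q) *\<^sub>R q"
    using x(2) by (simp add: f_def q_def)
  have "x - p x = (1 + s / norm q) *\<^sub>R q"
    by (subst xq) (auto simp: q_def algebra_simps)
  then have "dist x (p x) = \<bar>1 + s / norm q\<bar> * norm q"
    by (simp add: dist_norm)
  also have "\<dots> = norm q + s"
    using q s by (simp add: field_simps)
  finally have dx: "dist x (p x) = norm q + s" .
  \<comment> \<open>As the distance is 1-Lipschitz, \<open>p x\<close> is a nearest point of
    \<open>z\<close> too. Uniqueness at \<open>z\<close> then forces \<open>p x = \<xi>\<close>,
    which puts the fixed point on the ray.\<close>
  have "infdist x \<Theta> \<le> infdist z \<Theta> + s"
    using infdist_triangle[of x \<Theta> z] x(1) by (simp add: dist_commute)
  then have "norm q \<le> infdist z \<Theta>"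
    using p[OF x(1)] dx by linarith
  moreover have "infdist z \<Theta> \<le> norm q"
    using infdist_le[of "p x" \<Theta> z] p[OF x(1)] by (simp add: q_def dist_norm)
  ultimately have "infdist z \<Theta> = dist z (p x)"
    by (simp add: q_def dist_norm)
  moreover have "infdist z \<Theta> = dist z \<xi>"
    using \<xi> by (simp add: z_def dist_norm)
  ultimately have "p x = \<xi>"
    using unique_closest_pointD[OF U(1,3) near, of z] p[OF x(1)] \<xi>(1) s(1) by auto
  then have qt: "q = t *\<^sub>R \<nu>"
    by (simp add: q_def z_def)
  then have "x = \<xi> + (t + s) *\<^sub>R \<nu>"
    using xq \<xi> by (simp add: z_def algebra_simps)
  then show ?thesis
    using p[OF x(1)] dx qt \<xi> by simp
qed

text \<open>The parameters at which the distance to \<Theta> still equals the distance to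
  \<open>\<xi>\<close> form a compact set, and \<open>normal_segment_step\<close> leads beyond any
  of them that is smaller than \<open>R\<close>. The conclusion says that the open ball of radius
  \<open>R\<close> around \<open>\<xi> + R *\<^sub>R \<nu>\<close> misses \<Theta>.\<close>

lemma normal_segment_extension:
  fixes \<Theta> :: "'a::euclidean_space set"
  assumes U: "unique_closest_point \<Theta> e" "\<Theta> \<noteq> {}" and R: "R < e"
    and \<xi>: "\<xi> \<in> \<Theta>" "norm \<nu> = 1" "infdist (\<xi> + t *\<^sub>R \<nu>) \<Theta> = t" "0 < t" "t \<le> R"
  shows "infdist (\<xi> + R *\<^sub>R \<nu>) \<Theta> = R"
proof -
  define A where "A = {u \<in> {t..R}. infdist (\<xi> + u *\<^sub>R \<nu>) \<Theta> = u}"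
  have "A = {t..R} \<inter> {u. infdist (\<xi> + u *\<^sub>R \<nu>) \<Theta> = u}"
    by (auto simp: A_def)
  moreover have "closed {u. infdist (\<xi> + u *\<^sub>R \<nu>) \<Theta> = u}"
    by (intro closed_Collect_eq continuous_intros)
  ultimately have "closed A" by (simp add: closed_Int)
  then have "compact A"
    by (metis (no_types, lifting) A_def bounded_closed_interval bounded_subset
        compact_eq_bounded_closed mem_Collect_eq subsetI)
  moreover have "t \<in> A" using \<xi> by (auto simp: A_def)
  ultimately obtain u where u: "u \<in> A" "\<And>v. v \<in> A \<Longrightarrow> v \<le> u"
    using compact_attains_sup[of A] by blast
  have "u = R"
  proof (rule ccontr)
    assume "u \<noteq> R"
    then have lt: "t \<le> u" "u < R" using u(1) by (auto simp: A_def)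
    \<comment> \<open>\<open>u / 2\<close> respects the limit \<open>s < t\<close> of a single step,
      and \<open>R - u\<close> prevents overshooting.\<close>
    define s where "s = min (u / 2) (R - u)"
    have "infdist (\<xi> + (u + s) *\<^sub>R \<nu>) \<Theta> = u + s"
      using u(1) \<xi> R lt by (intro normal_segment_step[OF U(1) _ U(2)]) (auto simp: A_def s_def)
    then have "u + s \<in> A"
      using lt \<xi>(4) by (auto simp: A_def s_def)
    then show False
      using u(2)[of "u + s"] lt \<xi>(4) by (auto simp: s_def split: if_splits)
  qed
  then show ?thesis using u(1) by (simp add: A_def)
qed

text \<open>Along a curve in \<Theta> through \<open>\<xi>\<close> the squared distance to
  \<open>y\<close> has a minimum at parameter 0, where its derivative is
  \<open>- 2 * ((y - \<xi>) \<bullet> v)\<close>.\<close>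

lemma tangent_space_orthogonal_nearest:
  fixes \<Theta> :: "'a::euclidean_space set"
  assumes "\<xi> \<in> \<Theta>" "infdist y \<Theta> = dist y \<xi>" "v \<in> tangent_space \<Theta> \<xi>"
  shows "orthogonal (y - \<xi>) v"
proof -
  obtain \<gamma> e where \<gamma>: "0 < e" "\<gamma> ` {-e<..<e} \<subseteq> \<Theta>" "\<gamma> 0 = \<xi>" "(\<gamma> has_vector_derivative v) (at (0::real))"
    using assms by (auto simp: tangent_space_def)
  have d: "((\<lambda>t. (y - \<gamma> t) \<bullet> (y - \<gamma> t)) has_real_derivative (- 2 * ((y - \<xi>) \<bullet> v))) (at 0)"
    using \<gamma>(4) unfolding has_field_derivative_def has_vector_derivative_def
    by (auto intro!: derivative_eq_intros simp: \<gamma>(3) inner_commute algebra_simps)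
  have m: "(y - \<gamma> 0) \<bullet> (y - \<gamma> 0) \<le> (y - \<gamma> t) \<bullet> (y - \<gamma> t)" if "\<bar>0 - t\<bar> < e" for t
  proof -
    have "\<gamma> t \<in> \<Theta>" using \<gamma>(2) that by (force simp: image_subset_iff)
    then have "norm (y - \<xi>) \<le> norm (y - \<gamma> t)"
      using infdist_le[of "\<gamma> t" \<Theta> y] assms(2) by (simp add: dist_norm)
    then show ?thesis
      by (simp add: \<gamma>(3) norm_le)
  qed
  have "- 2 * ((y - \<xi>) \<bullet> v) = 0"
    by (rule DERIV_local_min[OF d \<gamma>(1)]) (use m in blast)
  then show ?thesis by (simp add: orthogonal_def)
qed

text \<open>In a chart the derivative \<open>A\<close> of the inverse map is onto and sends the
  hyperplane \<open>w $ i = 0\<close> into the tangent space. The product of a normal vector with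
  \<open>A x\<close> therefore depends on \<open>x $ i\<close> only, which makes any two normals
  proportional. Smoothness of order \<open>Suc k\<close> supplies a differentiable chart.\<close>

lemma unit_normal_unique_up_to_sign:
  fixes \<Theta> :: "(real ^ 'n) set"
  assumes H: "hypersurface (Suc k) \<Theta>" and "\<xi> \<in> \<Theta>"
    and "unit_normal_at \<Theta> \<xi> u" "unit_normal_at \<Theta> \<xi> v"
  shows "u = v \<or> u = - v"
proof -
  obtain U V and \<phi> \<psi> :: "real ^ 'n \<Rightarrow> real ^ 'n" and i where c: "open U" "\<xi> \<in> U" "open V" "homeomorphism U V \<phi> \<psi>"
    "C_diff_on (Suc k) \<phi> U" "C_diff_on (Suc k) \<psi> V" "\<phi> ` (\<Theta> \<inter> U) = {v \<in> V. v $ i = 0}"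
    using H[unfolded hypersurface_def, rule_format, OF \<open>\<xi> \<in> \<Theta>\<close>]
    by (elim exE conjE) (rule that)
  define b where "b = \<phi> \<xi>"
  have b: "b \<in> V" "b $ i = 0"
    using c(2,7) \<open>\<xi> \<in> \<Theta>\<close> by (auto simp: b_def)
  have \<psi>b: "\<psi> b = \<xi>" using c(2,4) by (simp add: b_def homeomorphism_apply1)
  obtain A where A: "(\<psi> has_derivative A) (at b)"
    using c(6) b by auto
  obtain B where B: "(\<phi> has_derivative B) (at \<xi>)"
    using c(2,5) by auto
  interpret A: linear A using A by (rule has_derivative_linear)
  have "((\<lambda>x. \<psi> (\<phi> x)) has_derivative (\<lambda>x. A (B x))) (at \<xi>)"
    using diff_chain_at[OF B] A by (simp add: b_def o_def)
  moreover have "((\<lambda>x. \<psi> (\<phi> x)) has_derivative (\<lambda>x. x)) (at \<xi>)"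
    by (rule has_derivative_transform_within_open[OF has_derivative_ident c(1,2)])
      (use c(4) in \<open>auto simp: homeomorphism_apply1\<close>)
  ultimately have "(\<lambda>x. A (B x)) = (\<lambda>x. x)"
    by (rule has_derivative_unique)
  then have surj: "\<exists>x. A x = y" for y by metis
  have tan: "A w \<in> tangent_space \<Theta> \<xi>" if w: "w $ i = 0" for w
  proof -
    obtain r where r: "0 < r" "ball b r \<subseteq> V" using c(3) b open_contains_ball by blast
    define e where "e = r / (norm w + 1)"
    have pos: "0 < norm w + 1" by (simp add: add_nonneg_pos)
    then have e: "0 < e" using r by (simp add: e_def)
    have *: "b + t *\<^sub>R w \<in> V" if "t \<in> {-e<..<e}" for t
    proof -
      have "\<bar>t\<bar> * norm w \<le> e * norm w" using that by (intro mult_right_mono) auto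
      also have "\<dots> < e * (norm w + 1)" using e by simp
      also have "\<dots> = r" using pos by (simp add: e_def)
      finally show ?thesis using r by (auto simp: dist_norm)
    qed
    have "\<psi> (b + t *\<^sub>R w) \<in> \<Theta>" if "t \<in> {-e<..<e}" for t
    proof -
      have "b + t *\<^sub>R w \<in> \<phi> ` (\<Theta> \<inter> U)"
        using *[OF that] b w by (simp add: c(7))
      then show ?thesis using c(4) by (auto simp: homeomorphism_apply1)
    qed
    moreover have "((\<lambda>t. \<psi> (b + t *\<^sub>R w)) has_vector_derivative A w) (at 0)"
    proof -
      have "((\<lambda>t. b + t *\<^sub>R w) has_derivative (\<lambda>t. t *\<^sub>R w)) (at 0)"
        by (auto intro!: derivative_eq_intros)
      from diff_chain_at[OF this, of \<psi> A] A show ?thesis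
        by (simp add: o_def has_vector_derivative_def A.scaleR)
    qed
    ultimately show ?thesis
      unfolding tangent_space_def mem_Collect_eq using e \<psi>b
      by (intro exI[of _ "\<lambda>t. \<psi> (b + t *\<^sub>R w)"] exI[of _ e]) auto
  qed
  have orth: "w \<bullet> A x = (x $ i) * (w \<bullet> A (axis i 1))" if "unit_normal_at \<Theta> \<xi> w" for w x
  proof -
    have "A (x - (x $ i) *\<^sub>R axis i 1) \<in> tangent_space \<Theta> \<xi>"
      by (rule tan) simp
    then have "w \<bullet> A (x - (x $ i) *\<^sub>R axis i 1) = 0"
      using that by (auto simp: unit_normal_at_def orthogonal_def)
    then show ?thesis by (simp add: A.diff A.scaleR inner_diff_right)
  qed
  define p q where "p = u \<bullet> A (axis i 1)" and "q = v \<bullet> A (axis i 1)"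
  have "(q *\<^sub>R u - p *\<^sub>R v) \<bullet> A x = 0" for x
    using orth[OF assms(3), of x] orth[OF assms(4), of x] by (simp add: inner_diff_left p_def q_def)
  then have "(q *\<^sub>R u - p *\<^sub>R v) \<bullet> y = 0" for y using surj by metis
  then have eq: "q *\<^sub>R u = p *\<^sub>R v" by (metis eq_iff_diff_eq_0 inner_eq_zero_iff)
  have nz: "norm u = 1" "norm v = 1" using assms by (auto simp: unit_normal_at_def)
  have "q \<noteq> 0"
  proof
    assume "q = 0"
    then have "v \<bullet> A x = 0" for x using orth[OF assms(4), of x] by (simp add: q_def)
    then have "v \<bullet> v = 0" using surj by metis
    then show False using nz by simp
  qed
  moreover have "\<bar>q\<bar> = \<bar>p\<bar>" using arg_cong[OF eq, of norm] nz by simp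
  ultimately have "p = q \<or> p = - q" by auto
  then show ?thesis
  proof
    assume "p = q"
    then have "u = v" using eq \<open>q \<noteq> 0\<close> by simp
    then show ?thesis ..
  next
    assume "p = - q"
    then have "q *\<^sub>R u = q *\<^sub>R (- v)" using eq by simp
    then have "u = - v" using \<open>q \<noteq> 0\<close> by (metis scaleR_cancel_left)
    then show ?thesis ..
  qed
qed

text \<open>The distance of a point to \<Theta> is at least \<open>R\<close> minus its distance to
  the centre \<open>\<xi> + R *\<^sub>R \<nu>\<close>. The latter is
  \<open>norm (v - s *\<^sub>R \<nu>)\<close> with \<open>s = R - r\<close>, and completing the
  square bounds it by \<open>s - \<nu> \<bullet> v + (norm v)\<^sup>2 / (2 * s)\<close>. The
  condition \<open>r \<le> R / 2\<close> gives \<open>2 * s \<ge> R\<close>.\<close>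

lemma infdist_lower_bound_normal:
  fixes \<Theta> :: "'a::euclidean_space set"
  assumes "norm \<nu> = 1" "infdist (\<xi> + R *\<^sub>R \<nu>) \<Theta> = R" "0 < R" "0 \<le> r" "r \<le> R / 2"
  shows "r + \<nu> \<bullet> v - (norm v)\<^sup>2 / R \<le> infdist (\<xi> + r *\<^sub>R \<nu> + v) \<Theta>"
proof -
  define s where "s = R - r"
  have s: "R / 2 \<le> s" "0 < s" using assms by (auto simp: s_def)
  have nn: "\<nu> \<bullet> \<nu> = 1" using assms(1) by (simp add: dot_square_norm)
  have "(norm (v - s *\<^sub>R \<nu>))\<^sup>2 = s\<^sup>2 - 2 * s * (\<nu> \<bullet> v) + (norm v)\<^sup>2"
    unfolding power2_norm_eq_inner
    by (simp add: inner_diff_left inner_diff_right nn inner_commute power2_eq_square algebra_simps)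
  also have "\<dots> \<le> (s - \<nu> \<bullet> v + (norm v)\<^sup>2 / (2 * s))\<^sup>2"
  proof -
    have "(s - \<nu> \<bullet> v + (norm v)\<^sup>2 / (2 * s))\<^sup>2
        = s\<^sup>2 + 2 * s * (- (\<nu> \<bullet> v) + (norm v)\<^sup>2 / (2 * s)) + (- (\<nu> \<bullet> v) + (norm v)\<^sup>2 / (2 * s))\<^sup>2"
      by (simp add: power2_eq_square algebra_simps)
    also have "2 * s * (- (\<nu> \<bullet> v) + (norm v)\<^sup>2 / (2 * s)) = - 2 * s * (\<nu> \<bullet> v) + (norm v)\<^sup>2"
      using s by (simp add: field_simps)
    finally show ?thesis by simp
  qed
  finally have sq: "(norm (v - s *\<^sub>R \<nu>))\<^sup>2 \<le> (s - \<nu> \<bullet> v + (norm v)\<^sup>2 / (2 * s))\<^sup>2" .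
  \<comment> \<open>Taking roots requires the right-hand side to be nonnegative.\<close>
  have "\<nu> \<bullet> v \<le> norm v" using Cauchy_Schwarz_ineq2[of \<nu> v] assms(1) by auto
  moreover have "norm v \<le> s + (norm v)\<^sup>2 / (2 * s)"
  proof -
    have "0 \<le> (norm v - s)\<^sup>2 + s\<^sup>2" by simp
    then have "2 * s * norm v \<le> 2 * s\<^sup>2 + (norm v)\<^sup>2"
      by (simp add: power2_eq_square algebra_simps)
    then have "norm v \<le> (2 * s\<^sup>2 + (norm v)\<^sup>2) / (2 * s)"
      using s by (simp add: field_simps)
    also have "\<dots> = s + (norm v)\<^sup>2 / (2 * s)" using s by (simp add: field_simps power2_eq_square)
    finally show ?thesis .
  qed
  ultimately have "0 \<le> s - \<nu> \<bullet> v + (norm v)\<^sup>2 / (2 * s)" by linarith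
  then have "norm (v - s *\<^sub>R \<nu>) \<le> s - \<nu> \<bullet> v + (norm v)\<^sup>2 / (2 * s)"
    using sq power2_le_imp_le by blast
  also have "\<dots> \<le> s - \<nu> \<bullet> v + (norm v)\<^sup>2 / R"
    using s assms(3) by (auto intro!: divide_left_mono)
  finally have "norm (v - s *\<^sub>R \<nu>) \<le> s - \<nu> \<bullet> v + (norm v)\<^sup>2 / R" .
  moreover have "infdist (\<xi> + R *\<^sub>R \<nu>) \<Theta> \<le> infdist (\<xi> + r *\<^sub>R \<nu> + v) \<Theta> + norm (v - s *\<^sub>R \<nu>)"
    using infdist_triangle[of "\<xi> + R *\<^sub>R \<nu>" \<Theta> "\<xi> + r *\<^sub>R \<nu> + v"]
    by (simp add: dist_norm s_def norm_minus_commute algebra_simps)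
  ultimately show ?thesis using assms(2) by (simp add: s_def)
qed

text \<open>The direction from the nearest point to \<open>y\<close> is normal to \<Theta>, hence
  equal to \<open>n \<xi>\<close> or its negative. This transfers the lower bound
  \<open>c\<^sub>0\<close> from the given normals to the direction in which the distance to \<Theta>
  is measured.\<close>

lemma reach_normal_off:
  fixes \<Theta> :: "(real ^ 'n) set" and \<sigma> :: "real ^ 'n \<Rightarrow> real ^ 'n ^ 'n"
  assumes U: "unique_closest_point \<Theta> e" "\<Theta> \<noteq> {}" and R: "0 < R" "R < e"
    and H: "hypersurface (Suc k) \<Theta>" and n: "\<And>\<xi>. \<xi> \<in> \<Theta> \<Longrightarrow> unit_normal_at \<Theta> \<xi> (n \<xi>)"
    and c: "\<And>\<xi>. \<xi> \<in> \<Theta> \<Longrightarrow> c\<^sub>0 \<le> norm (transpose (\<sigma> \<xi>) *v n \<xi>)"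
    and y: "y \<notin> \<Theta>" "infdist y \<Theta> < R"
  obtains \<xi> \<nu> where "\<xi> \<in> \<Theta>" "norm \<nu> = 1" "y = \<xi> + infdist y \<Theta> *\<^sub>R \<nu>"
    "infdist (\<xi> + R *\<^sub>R \<nu>) \<Theta> = R" "c\<^sub>0 \<le> norm (transpose (\<sigma> \<xi>) *v \<nu>)"
proof -
  obtain \<xi> where \<xi>: "\<xi> \<in> \<Theta>" "infdist y \<Theta> = dist y \<xi>"
    using unique_closest_pointD[OF U, of y] y(2) R by auto
  define t where "t = infdist y \<Theta>"
  define \<nu> where "\<nu> = (1 / t) *\<^sub>R (y - \<xi>)"
  have t: "0 < t" using \<xi> y by (auto simp: t_def)
  have norm: "norm \<nu> = 1" using \<xi> t by (simp add: \<nu>_def t_def dist_norm)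
  have y_eq: "y = \<xi> + t *\<^sub>R \<nu>" using t by (simp add: \<nu>_def)
  have "infdist (\<xi> + t *\<^sub>R \<nu>) \<Theta> = t" using y_eq by (simp add: t_def)
  then have ball: "infdist (\<xi> + R *\<^sub>R \<nu>) \<Theta> = R"
    using normal_segment_extension[OF U R(2) \<xi>(1) norm] t y(2) by (simp add: t_def)
  have "unit_normal_at \<Theta> \<xi> \<nu>"
    unfolding unit_normal_at_def using tangent_space_orthogonal_nearest[OF \<xi>] norm t
    by (auto simp: \<nu>_def orthogonal_clauses)
  then have "\<nu> = n \<xi> \<or> \<nu> = - n \<xi>"
    using unit_normal_unique_up_to_sign[OF H \<xi>(1)] n[OF \<xi>(1)] by blast
  moreover have "transpose (\<sigma> \<xi>) *v (- n \<xi>) = - (transpose (\<sigma> \<xi>) *v n \<xi>)"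
    by (simp add: matrix_vector_mult_def sum_negf vec_eq_iff)
  ultimately have "norm (transpose (\<sigma> \<xi>) *v \<nu>) = norm (transpose (\<sigma> \<xi>) *v n \<xi>)"
    by (elim disjE) simp_all
  then show ?thesis
    by (intro that[OF \<xi>(1) norm _ ball]) (use y_eq c[OF \<xi>(1)] in \<open>simp_all add: t_def\<close>)
qed

text \<open>A point of \<Theta> itself determines no direction. There \<open>\<nu>\<close> is a
  limit of the directions belonging to nearby points off \<Theta>: the unit sphere is compact, and
  the required properties pass to the limit because the distance and \<sigma> are
  continuous.\<close>

lemma reach_normal:
  fixes \<Theta> :: "(real ^ 'n) set" and \<sigma> :: "real ^ 'n \<Rightarrow> real ^ 'n ^ 'n"
  assumes reach: "ennreal R < reach \<Theta>" "0 < R" "\<Theta> \<noteq> {}"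
    and H: "hypersurface (Suc k) \<Theta>" and n: "\<And>\<xi>. \<xi> \<in> \<Theta> \<Longrightarrow> unit_normal_at \<Theta> \<xi> (n \<xi>)"
    and \<sigma>: "continuous_on UNIV \<sigma>"
    and c: "\<And>\<xi>. \<xi> \<in> \<Theta> \<Longrightarrow> c\<^sub>0 \<le> norm (transpose (\<sigma> \<xi>) *v n \<xi>)"
    and y: "infdist y \<Theta> < R"
  shows "\<exists>\<xi> \<nu>. \<xi> \<in> \<Theta> \<and> norm \<nu> = 1 \<and> y = \<xi> + infdist y \<Theta> *\<^sub>R \<nu> \<and>
    infdist (\<xi> + R *\<^sub>R \<nu>) \<Theta> = R \<and> c\<^sub>0 \<le> norm (transpose (\<sigma> \<xi>) *v \<nu>)"
proof -
  obtain e where e: "unique_closest_point \<Theta> e" "0 < e" "R < e"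
    using reach(1,2) by (auto simp: reach_def less_SUP_iff ennreal_less_iff)
  define P where "P z \<xi> \<nu> \<longleftrightarrow> \<xi> \<in> \<Theta> \<and> norm \<nu> = 1 \<and> z = \<xi> + infdist z \<Theta> *\<^sub>R \<nu> \<and>
    infdist (\<xi> + R *\<^sub>R \<nu>) \<Theta> = R \<and> c\<^sub>0 \<le> norm (transpose (\<sigma> \<xi>) *v \<nu>)" for z \<xi> \<nu>
  have off: "\<exists>\<xi> \<nu>. P z \<xi> \<nu>" if z: "z \<notin> \<Theta>" "infdist z \<Theta> < R" for z
  proof -
    obtain \<xi> \<nu> where "P z \<xi> \<nu>"
      unfolding P_def by (rule reach_normal_off[OF e(1) reach(3,2) e(3) H n c z]) simp_all
    then show ?thesis by blast
  qed
  have "\<exists>\<xi> \<nu>. P y \<xi> \<nu>"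
  proof (cases "y \<in> \<Theta>")
    case False
    then show ?thesis using off y by simp
  next
    case True
    \<comment> \<open>The line through \<open>y\<close> in direction \<open>n y\<close> cannot stay
      in \<Theta>: its velocity \<open>n y\<close> would be tangent, hence orthogonal to
      itself.\<close>
    have ex: "\<exists>t. \<bar>t\<bar> < d \<and> y + t *\<^sub>R n y \<notin> \<Theta>" if "0 < d" for d
    proof (rule ccontr)
      assume "\<not> ?thesis"
      then have "y + t *\<^sub>R n y \<in> \<Theta>" if "t \<in> {-d<..<d}" for t
        using that by (auto simp: abs_less_iff)
      moreover have "((\<lambda>t. y + t *\<^sub>R n y) has_vector_derivative n y) (at 0)"
        by (auto intro!: derivative_eq_intros)
      ultimately have "n y \<in> tangent_space \<Theta> y"
        unfolding tangent_space_def mem_Collect_eq using \<open>0 < d\<close>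
        by (intro exI[of _ "\<lambda>t. y + t *\<^sub>R n y"] exI[of _ d]) auto
      then have "n y = 0"
        using n[OF True] by (auto simp: unit_normal_at_def orthogonal_def)
      then show False using n[OF True] by (simp add: unit_normal_at_def)
    qed
    \<comment> \<open>The bound \<open>R\<close> keeps the approximating points in the range of
      \<open>off\<close>; the other entry makes them converge to \<open>y\<close>.\<close>
    define d where "d k = min R (inverse (real (Suc k)))" for k
    have dpos: "0 < d k" for k using reach(2) by (simp add: d_def)
    have "\<exists>y' \<xi> \<nu>. dist y' y < d k \<and> P y' \<xi> \<nu>" for k
    proof -
      obtain t where t: "\<bar>t\<bar> < d k" "y + t *\<^sub>R n y \<notin> \<Theta>" using ex[OF dpos] by blast
      have dd: "dist (y + t *\<^sub>R n y) y < d k"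
        using t(1) n[OF True] by (simp add: dist_norm unit_normal_at_def)
      then have "infdist (y + t *\<^sub>R n y) \<Theta> < R"
        using infdist_le[OF True, of "y + t *\<^sub>R n y"] by (simp add: d_def)
      from off[OF t(2) this] dd show ?thesis by blast
    qed
    then obtain y' \<xi> \<nu> where yk: "\<And>k. dist (y' k) y < d k" and Pk: "\<And>k. P (y' k) (\<xi> k) (\<nu> k)"
      by metis
    have f: "\<xi> k \<in> \<Theta>" "norm (\<nu> k) = 1" "y' k = \<xi> k + infdist (y' k) \<Theta> *\<^sub>R \<nu> k"
      "infdist (\<xi> k + R *\<^sub>R \<nu> k) \<Theta> = R" "c\<^sub>0 \<le> norm (transpose (\<sigma> (\<xi> k)) *v \<nu> k)" for k
      using Pk[of k] unfolding P_def by blast+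
    have "\<nu> k \<in> sphere 0 1" for k using f(2) by simp
    then obtain \<nu>' r where r: "\<nu>' \<in> sphere 0 1" "strict_mono r" "(\<nu> \<circ> r) \<longlonglongrightarrow> \<nu>'"
      using compact_sphere[THEN compact_imp_seq_compact, THEN seq_compactE] by metis
    have "dist (\<xi> k) y \<le> 2 * d k" for k
    proof -
      have "dist (\<xi> k) (y' k) = infdist (y' k) \<Theta>"
        by (subst f(3)) (simp add: dist_norm f(2) infdist_nonneg)
      also have "\<dots> \<le> dist (y' k) y" by (rule infdist_le[OF True])
      finally show ?thesis using yk[of k] dist_triangle[of "\<xi> k" y "y' k"] by linarith
    qed
    moreover have "(\<lambda>k. 2 * d k) \<longlonglongrightarrow> 2 * min R 0"
      unfolding d_def by (intro tendsto_intros LIMSEQ_inverse_real_of_nat)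
    ultimately have "(\<lambda>k. dist (\<xi> k) y) \<longlonglongrightarrow> 0"
      using reach(2) by (intro Lim_null_comparison[of "\<lambda>k. dist (\<xi> k) y" "\<lambda>k. 2 * d k"]) auto
    then have "\<xi> \<longlonglongrightarrow> y" by (simp add: tendsto_dist_iff[of \<xi>])
    then have \<xi>r: "(\<xi> \<circ> r) \<longlonglongrightarrow> y" by (rule LIMSEQ_subseq_LIMSEQ[OF _ r(2)])
    have "(\<lambda>k. infdist ((\<xi> \<circ> r) k + R *\<^sub>R (\<nu> \<circ> r) k) \<Theta>) \<longlonglongrightarrow> infdist (y + R *\<^sub>R \<nu>') \<Theta>"
      by (intro tendsto_intros \<xi>r r(3))
    then have ball: "infdist (y + R *\<^sub>R \<nu>') \<Theta> = R"
      using f(4) by (simp add: LIMSEQ_const_iff)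
    have "(\<lambda>k. transpose (\<sigma> ((\<xi> \<circ> r) k)) *v (\<nu> \<circ> r) k) \<longlonglongrightarrow> transpose (\<sigma> y) *v \<nu>'"
    proof -
      have "(\<lambda>k. \<sigma> ((\<xi> \<circ> r) k)) \<longlonglongrightarrow> \<sigma> y"
        using continuous_on_tendsto_compose[OF \<sigma> \<xi>r] by simp
      then show ?thesis
        by (intro vec_tendstoI)
          (auto simp: matrix_vector_mult_def transpose_def intro!: tendsto_intros r(3)[unfolded o_def])
    qed
    then have "c\<^sub>0 \<le> norm (transpose (\<sigma> y) *v \<nu>')"
      using f(5) by (intro LIMSEQ_le_const[OF tendsto_norm]) auto
    then have "P y y \<nu>'"
      using True ball r(1) by (simp add: P_def)
    then show ?thesis by blast
  qed
  then show ?thesis unfolding P_def .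
qed

subsection \<open>The standard Gaussian measure\<close>

text \<open>This is Fubini for product integrands. Lebesgue measure is a product indexed by
  \<open>Basis\<close>, so the proof re-indexes the factors by unit vectors.\<close>

lemma lborel_vec_prod:
  fixes f :: "'n::finite \<Rightarrow> real \<Rightarrow> real"
  assumes f: "\<And>i. integrable lborel (f i)"
  shows "integrable lborel (\<lambda>v::real^'n. \<Prod>i\<in>UNIV. f i (v $ i))"
    and "(\<integral>v. (\<Prod>i\<in>UNIV. f i ((v::real^'n) $ i)) \<partial>lborel) = (\<Prod>i\<in>UNIV. \<integral>x. f i x \<partial>lborel)"
proof -
  define g where "g b = f (THE i. b = axis i (1::real))" for b :: "real^'n"
  have g: "g (axis i 1) = f i" for i
    by (simp add: g_def axis_eq_axis)
  have B: "(Basis :: (real^'n) set) = range (\<lambda>i. axis i 1)"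
    by (auto simp: Basis_vec_def)
  have inj: "inj (\<lambda>i::'n. axis i (1::real))"
    by (auto simp: inj_on_def axis_eq_axis)
  have re: "(\<Prod>b\<in>Basis. h b) = (\<Prod>i\<in>UNIV. h (axis i 1))" for h :: "real^'n \<Rightarrow> real"
    unfolding B by (simp add: prod.reindex[OF inj])
  have eq: "(\<Prod>i\<in>UNIV. f i (v $ i)) = (\<Prod>b\<in>Basis. g b (v \<bullet> b))" for v :: "real^'n"
    unfolding re by (simp add: g inner_axis)
  interpret P: product_sigma_finite "\<lambda>_::real^'n. lborel :: real measure" by standard
  have gi: "integrable lborel (g b)" for b unfolding g_def by (rule f)
  have [measurable]: "g b \<in> borel_measurable borel" for b using gi[of b] by auto
  have comp: "(\<Sum>b'\<in>Basis. f b' *\<^sub>R b') \<bullet> b = f b" if "b \<in> Basis" for b :: "real^'n" and f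
    using that by (simp add: inner_sum_left_Basis)
  have meas: "(\<lambda>v. \<Prod>b\<in>Basis. g b (v \<bullet> b)) \<in> borel_measurable (borel :: (real^'n) measure)" 
    by (intro borel_measurable_prod) measurable
  show "integrable lborel (\<lambda>v::real^'n. \<Prod>i\<in>UNIV. f i (v $ i))"
    unfolding eq lborel_eq[where 'a="real^'n"] using meas
    by (subst integrable_distr_eq) (auto simp: comp cong: prod.cong intro!: P.product_integrable_prod gi)
  have "(\<integral>v. (\<Prod>i\<in>UNIV. f i ((v::real^'n) $ i)) \<partial>lborel)
      = (\<integral>x. (\<Prod>b\<in>Basis. g b (x b)) \<partial>(\<Pi>\<^sub>M b\<in>Basis. lborel))"
    unfolding eq lborel_eq[where 'a="real^'n"] using meas
    by (subst integral_distr) (auto simp: comp cong: prod.cong)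
  also have "\<dots> = (\<Prod>b\<in>Basis. \<integral>x. g b x \<partial>lborel)"
    by (rule P.product_integral_prod) (auto intro: gi)
  finally show "(\<integral>v. (\<Prod>i\<in>UNIV. f i ((v::real^'n) $ i)) \<partial>lborel) = (\<Prod>i\<in>UNIV. \<integral>x. f i x \<partial>lborel)"
    by (simp add: re g)
qed

definition gauss_density :: "real \<Rightarrow> real ^ 'n \<Rightarrow> real" where
  "gauss_density s v = (\<Prod>i\<in>UNIV. normal_density 0 s (v $ i))"

definition std_gauss :: "(real ^ 'n) measure" where
  "std_gauss = density lborel (\<lambda>v. ennreal (gauss_density 1 v))"

lemma gauss_density_nonneg: "0 \<le> gauss_density s v"
  by (auto simp: gauss_density_def intro: prod_nonneg)

lemma gauss_density_measurable [measurable]: "gauss_density s \<in> borel_measurable borel"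
  unfolding gauss_density_def by measurable

lemma sets_std_gauss [measurable_cong, simp]: "sets std_gauss = sets borel"
  and space_std_gauss [simp]: "space std_gauss = UNIV"
  by (simp_all add: std_gauss_def)

text \<open>The second and fourth moments below are sums of such monomials, which factor into
  moments of the one-dimensional normal law.\<close>

lemma std_gauss_monomial:
  fixes e :: "'n::finite \<Rightarrow> nat"
  shows "integrable std_gauss (\<lambda>z::real^'n. \<Prod>i\<in>UNIV. (z $ i) ^ e i)"
    and "(\<integral>z. (\<Prod>i\<in>UNIV. ((z::real^'n) $ i) ^ e i) \<partial>std_gauss)
      = (\<Prod>i\<in>UNIV. \<integral>x. std_normal_density x * x ^ e i \<partial>lborel)"
proof -
  have eq: "gauss_density 1 z * (\<Prod>i\<in>UNIV. (z $ i) ^ e i)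
      = (\<Prod>i\<in>UNIV. std_normal_density (z $ i) * (z $ i) ^ e i)" for z :: "real^'n"
    by (simp add: gauss_density_def prod.distrib)
  have m: "(\<lambda>z::real^'n. \<Prod>i\<in>UNIV. (z $ i) ^ e i) \<in> borel_measurable lborel" by measurable
  note p = lborel_vec_prod[of "\<lambda>i x. std_normal_density x * x ^ e i", OF integrable_std_normal_moment]
  show "integrable std_gauss (\<lambda>z::real^'n. \<Prod>i\<in>UNIV. (z $ i) ^ e i)"
    unfolding std_gauss_def
    by (subst integrable_density) (use p(1) m gauss_density_nonneg in \<open>auto simp: eq\<close>)
  show "(\<integral>z. (\<Prod>i\<in>UNIV. ((z::real^'n) $ i) ^ e i) \<partial>std_gauss)
      = (\<Prod>i\<in>UNIV. \<integral>x. std_normal_density x * x ^ e i \<partial>lborel)"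
    unfolding std_gauss_def
    by (subst integral_density) (use p(2) m gauss_density_nonneg in \<open>auto simp: eq\<close>)
qed

lemma prob_space_std_gauss: "prob_space (std_gauss :: (real^'n) measure)"
proof
  have i: "integrable std_gauss (\<lambda>z::real^'n. 1::real)" "(\<integral>z. 1 \<partial>(std_gauss :: (real^'n) measure)) = (1::real)"
    using std_gauss_monomial[of "\<lambda>_::'n. 0"] by simp_all
  have "(\<integral>\<^sup>+z. ennreal 1 \<partial>(std_gauss :: (real^'n) measure)) = ennreal (\<integral>z. 1 \<partial>(std_gauss :: (real^'n) measure))"
    by (rule nn_integral_eq_integral[OF i(1)]) simp
  then show "emeasure (std_gauss :: (real^'n) measure) (space std_gauss) = 1"
    using i(2) by simp
qed

lemma std_gauss_mult:
  fixes i j :: "'n::finite"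
  shows "integrable std_gauss (\<lambda>z::real^'n. z $ i * z $ j)"
    and "(\<integral>z. (z::real^'n) $ i * z $ j \<partial>std_gauss) = (if i = j then 1 else 0)"
proof -
  \<comment> \<open>The exponents add up to 2 at \<open>i\<close> if \<open>i = j\<close>, so one
    monomial formula covers both the diagonal and the off-diagonal case.\<close>
  define e where "e k = (if k = i then 1 else 0) + (if k = j then 1 else 0::nat)" for k
  have eq: "(\<Prod>k\<in>UNIV. (z $ k) ^ e k) = z $ i * z $ j" for z :: "real^'n"
    by (simp add: e_def power_add prod.distrib if_distrib[of "\<lambda>n. _ ^ n"] cong: if_cong)
  have m0: "(\<integral>x. std_normal_density x \<partial>lborel) = 1"
    by simp
  have m1: "(\<integral>x. std_normal_density x * x \<partial>lborel) = 0"
    using integral_normal_moment_nz_1[of 1 0] by simp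
  have m2: "(\<integral>x. std_normal_density x * x\<^sup>2 \<partial>lborel) = 1"
    using integral_normal_moment_even[of 1 0 1] by simp
  show "integrable std_gauss (\<lambda>z::real^'n. z $ i * z $ j)"
    using std_gauss_monomial(1)[of e] unfolding eq .
  have "(\<integral>z. (z::real^'n) $ i * z $ j \<partial>std_gauss) = (\<Prod>k\<in>UNIV. \<integral>x. std_normal_density x * x ^ e k \<partial>lborel)"
    using std_gauss_monomial(2)[of e] unfolding eq .
  also have "\<dots> = (if i = j then 1 else 0)"
  proof (cases "i = j")
    case True
    then show ?thesis by (intro trans[OF prod.neutral]) (auto simp: e_def m2 numeral_2_eq_2[symmetric])
  next
    case False
    then have "(\<integral>x. std_normal_density x * x ^ e i \<partial>lborel) = 0" by (simp add: e_def m1)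
    then show ?thesis using False by (simp add: prod_zero_iff) blast
  qed
  finally show "(\<integral>z. (z::real^'n) $ i * z $ j \<partial>std_gauss) = (if i = j then 1 else 0)" .
qed

lemma inner_power2_vec:
  fixes a z :: "real^'n"
  shows "(a \<bullet> z)\<^sup>2 = (\<Sum>i\<in>UNIV. \<Sum>j\<in>UNIV. a $ i * a $ j * (z $ i * z $ j))"
  by (simp add: inner_vec_def power2_eq_square sum_product mult_ac)

lemma std_gauss_inner:
  fixes a :: "real^'n"
  shows "integrable std_gauss (\<lambda>z. (a \<bullet> z)\<^sup>2)" "(\<integral>z. (a \<bullet> z)\<^sup>2 \<partial>std_gauss) = (norm a)\<^sup>2"
proof -
  show "integrable std_gauss (\<lambda>z. (a \<bullet> z)\<^sup>2)"
    unfolding inner_power2_vec by (intro Bochner_Integration.integrable_sum integrable_mult_right std_gauss_mult)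
  have "(\<integral>z. (a \<bullet> z)\<^sup>2 \<partial>std_gauss) = (\<Sum>i\<in>UNIV. \<Sum>j\<in>UNIV. a $ i * a $ j * (if i = j then 1 else 0))"
    unfolding inner_power2_vec
    by (subst Bochner_Integration.integral_sum, intro Bochner_Integration.integrable_sum integrable_mult_right std_gauss_mult,
        subst Bochner_Integration.integral_sum, intro integrable_mult_right std_gauss_mult)
       (simp add: std_gauss_mult)
  also have "\<dots> = (norm a)\<^sup>2"
    unfolding power2_norm_eq_inner by (simp add: inner_vec_def if_distrib cong: if_cong)
  finally show "(\<integral>z. (a \<bullet> z)\<^sup>2 \<partial>std_gauss) = (norm a)\<^sup>2" .
qed

lemma integrable_std_gauss_norm2: "integrable std_gauss (\<lambda>z::real^'n. (norm z)\<^sup>2)"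
  unfolding power2_norm_eq_inner inner_vec_def
  by (intro Bochner_Integration.integrable_sum) (simp add: std_gauss_mult)

lemma integrable_std_gauss_norm4: "integrable std_gauss (\<lambda>z::real^'n. (norm z) ^ 4)"
proof -
  have "(norm z) ^ 4 = (\<Sum>i\<in>UNIV. \<Sum>j\<in>UNIV. (z $ i)\<^sup>2 * (z $ j)\<^sup>2)" for z :: "real^'n"
  proof -
    have "(norm z) ^ 4 = ((norm z)\<^sup>2)\<^sup>2" by simp
    also have "\<dots> = (\<Sum>i\<in>UNIV. (z $ i)\<^sup>2)\<^sup>2"
      unfolding power2_norm_eq_inner inner_vec_def by (simp add: power2_eq_square)
    finally show ?thesis unfolding power2_eq_square[of "sum _ _"] sum_product .
  qed
  moreover have "integrable std_gauss (\<lambda>z::real^'n. (z $ i)\<^sup>2 * (z $ j)\<^sup>2)" for i j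
  proof -
    define e where "e k = (if k = i then 2 else 0) + (if k = j then 2 else 0::nat)" for k
    have eq: "(\<Prod>k\<in>UNIV. (z $ k) ^ e k) = (z $ i)\<^sup>2 * (z $ j)\<^sup>2" for z :: "real^'n"
      by (simp add: e_def power_add prod.distrib if_distrib[of "\<lambda>n. _ ^ n"] cong: if_cong)
    show ?thesis using std_gauss_monomial(1)[of e] unfolding eq .
  qed
  ultimately show ?thesis by simp
qed

text \<open>Writes the law of a Brownian increment as a scaled copy of one fixed measure, so that
  the step size enters integrands but not measures.\<close>

lemma density_gauss_scale:
  assumes "0 < q"
  shows "density lborel (\<lambda>v::real^'n. ennreal (gauss_density (sqrt q) v)) = distr std_gauss borel (\<lambda>z. sqrt q *\<^sub>R z)"
proof (rule measure_eqI)
  fix A assume "A \<in> sets (density lborel (\<lambda>v::real^'n. ennreal (gauss_density (sqrt q) v)))"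
  then have [measurable]: "A \<in> sets borel" by simp
  define c where "c = sqrt q"
  have c: "0 < c" using assms by (simp add: c_def)
  have dens: "\<bar>c\<bar> ^ DIM(real^'n) * gauss_density c (c *\<^sub>R z) = gauss_density 1 z" for z :: "real^'n"
  proof -
    have "c * normal_density 0 c (c * x) = normal_density 0 1 x" for x
      using c by (simp add: normal_density_def power_mult_distrib real_sqrt_mult)
    then have "(\<Prod>i\<in>UNIV. c * normal_density 0 c (c * z $ i)) = gauss_density 1 z"
      by (simp add: gauss_density_def)
    then show ?thesis using c by (simp add: gauss_density_def prod.distrib)
  qed
  have "emeasure (density lborel (\<lambda>v. ennreal (gauss_density c v))) A
      = (\<integral>\<^sup>+v. ennreal (gauss_density c v) * indicator A v \<partial>lborel)"
    by (simp add: emeasure_density)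
  also have "\<dots> = (\<integral>\<^sup>+v. ennreal (gauss_density c v) * indicator A v
      \<partial>density (distr lborel borel (\<lambda>x. 0 + c *\<^sub>R x)) (\<lambda>_. \<bar>c\<bar> ^ DIM(real^'n)))"
    using c by (subst lborel_affine[of c 0]) auto
  also have "\<dots> = (\<integral>\<^sup>+z. ennreal (gauss_density 1 z) * indicator A (c *\<^sub>R z) \<partial>(lborel :: (real^'n) measure))"
    by (subst nn_integral_density, simp, simp, subst nn_integral_distr)
      (auto intro!: nn_integral_cong simp: dens[symmetric] ennreal_mult' gauss_density_nonneg mult.assoc)
  also have "\<dots> = emeasure (distr std_gauss borel (\<lambda>z. c *\<^sub>R z)) A"
    by (subst emeasure_distr, simp, simp, subst std_gauss_def, subst emeasure_density)
      (auto intro!: nn_integral_cong simp: indicator_def measurable_sets_borel[OF _ \<open>A \<in> sets borel\<close>] split: if_splits)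
  finally show "emeasure (density lborel (\<lambda>v::real^'n. ennreal (gauss_density (sqrt q) v))) A
      = emeasure (distr std_gauss borel (\<lambda>z. sqrt q *\<^sub>R z)) A" by (simp add: c_def)
qed simp

lemma nn_integral_std_gauss_uminus:
  assumes [measurable]: "f \<in> borel_measurable borel"
  shows "(\<integral>\<^sup>+z. f (- z) \<partial>(std_gauss :: (real^'n) measure)) = (\<integral>\<^sup>+z. f z \<partial>std_gauss)"
proof -
  have sym: "gauss_density 1 (- z) = gauss_density 1 z" for z :: "real^'n"
    by (simp add: gauss_density_def normal_density_def)
  have "(\<integral>\<^sup>+z. f z \<partial>std_gauss) = (\<integral>\<^sup>+z. ennreal (gauss_density 1 z) * f z \<partial>lborel)"
    unfolding std_gauss_def by (rule nn_integral_density) auto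
  also have "\<dots> = (\<integral>\<^sup>+z. ennreal (gauss_density 1 z) * f z
      \<partial>density (distr lborel borel (\<lambda>x. 0 + (-1) *\<^sub>R x)) (\<lambda>_. ennreal (\<bar>-1\<bar> ^ DIM(real^'n))))"
    by (subst lborel_affine[of "-1" 0]) auto
  also have "\<dots> = (\<integral>\<^sup>+z. ennreal (gauss_density 1 z) * f (- z) \<partial>(lborel :: (real^'n) measure))"
    by (subst nn_integral_density, simp, simp, subst nn_integral_distr) (auto simp: sym)
  also have "\<dots> = (\<integral>\<^sup>+z. f (- z) \<partial>std_gauss)"
    unfolding std_gauss_def by (rule nn_integral_density[symmetric]) auto
  finally show ?thesis ..
qed

subsection \<open>The potential\<close>

text \<open>Near 0 the right-hand side behaves like \<open>u\<^sup>2 / 2\<close>. Subtracting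
  \<open>u ^ 4\<close> makes a quadratic lower bound valid for all \<open>u \<ge> 0\<close>, so that
  Gaussian increments need no truncation and a fourth moment controls the loss.\<close>

lemma minus_ln_ge_quartic:
  assumes "0 \<le> (u::real)"
  shows "(u\<^sup>2 - u ^ 4) / 4 \<le> u - ln (1 + u)"
proof -
  define f where "f u = u - ln (1 + u) - (u\<^sup>2 - u ^ 4) / 4" for u :: real
  have "f 0 \<le> f u"
  proof (rule DERIV_nonneg_imp_nondecreasing[OF assms])
    fix x :: real assume x: "0 \<le> x" "x \<le> u"
    have "(f has_real_derivative (1 - 1 / (1 + x) - (2 * x - 4 * x ^ 3) / 4)) (at x)"
      unfolding f_def using x by (auto intro!: derivative_eq_intros simp: field_simps power2_eq_square power3_eq_cube)
    moreover have "1 - 1 / (1 + x) - (2 * x - 4 * x ^ 3) / 4 = x * (1 / (1 + x) - 1 / 2 + x\<^sup>2)"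
      using x by (simp add: field_simps power2_eq_square power3_eq_cube)
    moreover have "0 \<le> 1 / (1 + x) - 1 / 2 + x\<^sup>2"
    proof (cases "x \<le> 1")
      case True
      then have "1 / 2 \<le> 1 / (1 + x)" using x by (intro divide_left_mono) auto
      then show ?thesis by (simp add: add_nonneg_nonneg)
    next
      case False
      then have "1 \<le> x\<^sup>2" by (simp add: one_le_power)
      moreover have "0 \<le> 1 / (1 + x)" using x by simp
      ultimately show ?thesis by linarith
    qed
    ultimately show "\<exists>y. (f has_real_derivative y) (at x) \<and> 0 \<le> y"
      using x by (metis mult_nonneg_nonneg)
  qed
  then show ?thesis by (simp add: f_def)
qed

text \<open>On \<open>r \<ge> 0\<close> this is the antiderivative with value and slope \<open>0\<close> at \<open>0\<close> of
  \<open>\<epsilon> / (r + \<epsilon>)\<^sup>2\<close>: up to constants, the reciprocal of the step size at distance \<open>r\<close>.\<close>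

definition soft :: "real \<Rightarrow> real \<Rightarrow> real" where
  "soft \<epsilon> r = (if r \<le> 0 then 0 else r - \<epsilon> * ln (1 + r / \<epsilon>))"

lemma soft_pos_eq: "0 \<le> r \<Longrightarrow> soft \<epsilon> r = r - \<epsilon> * ln (1 + r / \<epsilon>)"
  by (simp add: soft_def)

text \<open>The slope is \<open>r / (r + \<epsilon>)\<close> for \<open>r \<ge> 0\<close> and 0 for
  negative \<open>r\<close>, so it lies between 0 and 1 whatever \<epsilon> is. This keeps the later
  constants independent of \<delta>.\<close>

lemma soft_incr:
  assumes "0 < \<epsilon>" "r \<le> s"
  shows "soft \<epsilon> r \<le> soft \<epsilon> s" "soft \<epsilon> s - soft \<epsilon> r \<le> s - r"
proof -
  have *: "soft \<epsilon> r \<le> soft \<epsilon> s \<and> soft \<epsilon> s - soft \<epsilon> r \<le> s - r" if rs: "0 \<le> r" "r \<le> s" for r s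
  proof -
    have p: "0 < 1 + r / \<epsilon>" "1 + r / \<epsilon> \<le> 1 + s / \<epsilon>" "1 \<le> 1 + r / \<epsilon>"
      using assms rs by (auto simp: add_pos_nonneg divide_right_mono)
    have "ln (1 + s / \<epsilon>) - ln (1 + r / \<epsilon>) \<le> ((1 + s / \<epsilon>) - (1 + r / \<epsilon>)) / (1 + r / \<epsilon>)"
      using p by (intro ln_diff_le) auto
    also have "\<dots> \<le> ((1 + s / \<epsilon>) - (1 + r / \<epsilon>)) / 1"
      using p by (intro divide_left_mono) auto
    finally have "ln (1 + s / \<epsilon>) - ln (1 + r / \<epsilon>) \<le> (s - r) / \<epsilon>" by (simp add: diff_divide_distrib)
    then have "\<epsilon> * (ln (1 + s / \<epsilon>) - ln (1 + r / \<epsilon>)) \<le> s - r"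
      using assms by (simp add: field_simps)
    moreover have "0 \<le> \<epsilon> * (ln (1 + s / \<epsilon>) - ln (1 + r / \<epsilon>))"
      using assms p by simp
    ultimately show ?thesis using rs by (simp add: soft_pos_eq algebra_simps)
  qed
  have "soft \<epsilon> r \<le> soft \<epsilon> s \<and> soft \<epsilon> s - soft \<epsilon> r \<le> s - r"
  proof (cases "0 \<le> r")
    case True
    then show ?thesis using * assms by simp
  next
    case False
    have z: "soft \<epsilon> 0 = 0" "soft \<epsilon> r = 0" using False by (simp_all add: soft_def)
    show ?thesis
    proof (cases "0 \<le> s")
      case True
      then show ?thesis using *[of 0 s] False unfolding z by linarith
    next
      case False
      then show ?thesis using assms z by (simp add: soft_def)
    qed
  qed
  then show "soft \<epsilon> r \<le> soft \<epsilon> s" "soft \<epsilon> s - soft \<epsilon> r \<le> s - r" by blast+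
qed

lemma soft_lipschitz: "0 < \<epsilon> \<Longrightarrow> \<bar>soft \<epsilon> r - soft \<epsilon> s\<bar> \<le> \<bar>r - s\<bar>"
  using soft_incr[of \<epsilon> r s] soft_incr[of \<epsilon> s r] by linarith

lemma soft_bounds: "0 < \<epsilon> \<Longrightarrow> 0 \<le> soft \<epsilon> r" "0 < \<epsilon> \<Longrightarrow> 0 \<le> r \<Longrightarrow> soft \<epsilon> r \<le> r"
  using soft_incr[of \<epsilon> 0 r] soft_incr[of \<epsilon> r 0] by (auto simp: soft_def)

lemma continuous_on_soft: "0 < \<epsilon> \<Longrightarrow> continuous_on A (soft \<epsilon>)"
  by (rule continuous_onI) (metis dist_real_def soft_lipschitz order_le_less_trans less_imp_le)

text \<open>This is convexity in quantitative form: \<open>r / (r + \<epsilon>)\<close> is the slope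
  at \<open>r\<close>, and the extra term for \<open>\<zeta> \<ge> 0\<close> is the exact excess
  over the tangent. Negative \<open>r + \<zeta>\<close> must be allowed, since \<open>soft\<close>
  will be evaluated at lower bounds of a distance.\<close>

lemma soft_tangent:
  assumes \<epsilon>: "0 < \<epsilon>" "0 \<le> r"
  shows "soft \<epsilon> r + r / (r + \<epsilon>) * \<zeta> + (if 0 \<le> \<zeta> then \<epsilon> * (\<zeta> / (r + \<epsilon>) - ln (1 + \<zeta> / (r + \<epsilon>))) else 0)
    \<le> soft \<epsilon> (r + \<zeta>)"
proof -
  define \<rho> where "\<rho> = r + \<epsilon>"
  have \<rho>: "0 < \<rho>" "1 + r / \<epsilon> = \<rho> / \<epsilon>" using \<epsilon> by (auto simp: \<rho>_def field_simps)
  show ?thesis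
  proof (cases "0 \<le> r + \<zeta>")
    case True
    have p: "0 < 1 + \<zeta> / \<rho>" using True \<rho> \<epsilon> by (simp add: \<rho>_def field_simps)
    have A: "(\<rho> / \<epsilon>) * (1 + \<zeta> / \<rho>) = (\<rho> + \<zeta>) / \<epsilon>"
      using \<rho>(1) by (simp add: distrib_left add_divide_distrib)
    have "1 + (r + \<zeta>) / \<epsilon> = (\<rho> / \<epsilon>) * (1 + \<zeta> / \<rho>)"
      unfolding A using \<epsilon> by (simp add: \<rho>_def add_divide_distrib)
    then have "ln (1 + (r + \<zeta>) / \<epsilon>) = ln (1 + r / \<epsilon>) + ln (1 + \<zeta> / \<rho>)"
      using ln_mult[of "\<rho> / \<epsilon>" "1 + \<zeta> / \<rho>"] p \<rho> \<epsilon> by simp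
    then have "soft \<epsilon> (r + \<zeta>) = soft \<epsilon> r + \<zeta> - \<epsilon> * ln (1 + \<zeta> / \<rho>)"
      using True \<epsilon> by (simp add: soft_pos_eq algebra_simps)
    moreover have "\<zeta> = r / \<rho> * \<zeta> + \<epsilon> * (\<zeta> / \<rho>)"
    proof -
      have "r / \<rho> * \<zeta> + \<epsilon> * (\<zeta> / \<rho>) = (r + \<epsilon>) * \<zeta> / \<rho>"
        by (simp add: add_divide_distrib distrib_right)
      then show ?thesis using \<rho>(1) by (simp add: \<rho>_def[symmetric])
    qed
    ultimately have "soft \<epsilon> (r + \<zeta>) = soft \<epsilon> r + r / \<rho> * \<zeta> + \<epsilon> * (\<zeta> / \<rho> - ln (1 + \<zeta> / \<rho>))"
      by (simp add: algebra_simps)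
    moreover have "0 \<le> \<epsilon> * (\<zeta> / \<rho> - ln (1 + \<zeta> / \<rho>))"
      using ln_le_minus_one[OF p] \<epsilon> by simp
    ultimately show ?thesis by (simp add: \<rho>_def)
  next
    case False
    \<comment> \<open>The tangent at \<open>r\<close> has a value \<le> 0 at the argument 0, hence
      also at the negative argument \<open>r + \<zeta>\<close>, where \<open>soft\<close>
      vanishes.\<close>
    have "ln (\<epsilon> / \<rho>) \<le> \<epsilon> / \<rho> - 1" using \<epsilon> \<rho> by (intro ln_le_minus_one) auto
    then have "1 - \<epsilon> / \<rho> \<le> ln (1 + r / \<epsilon>)"
      using \<epsilon> \<rho> by (simp add: ln_div)
    then have "\<epsilon> * (1 - \<epsilon> / \<rho>) \<le> \<epsilon> * ln (1 + r / \<epsilon>)"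
      using \<epsilon> by (intro mult_left_mono) auto
    moreover have "r - r / \<rho> * r = \<epsilon> * (1 - \<epsilon> / \<rho>)"
    proof -
      have q: "r / \<rho> = 1 - \<epsilon> / \<rho>"
        using \<rho>(1) by (simp add: \<rho>_def field_simps)
      have "r - r / \<rho> * r = (1 - r / \<rho>) * r" by (simp add: left_diff_distrib)
      also have "1 - r / \<rho> = \<epsilon> / \<rho>" using q by simp
      also have "\<epsilon> / \<rho> * r = \<epsilon> * (r / \<rho>)" by simp
      also have "\<dots> = \<epsilon> * (1 - \<epsilon> / \<rho>)" by (simp only: q)
      finally show ?thesis .
    qed
    moreover have "r / \<rho> * \<zeta> \<le> r / \<rho> * (- r)"
      using False \<epsilon> \<rho> by (intro mult_left_mono) auto
    ultimately have "soft \<epsilon> r + r / \<rho> * \<zeta> \<le> 0"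
      unfolding soft_pos_eq[OF \<epsilon>(2)] by linarith
    then show ?thesis using False \<epsilon> soft_bounds(1)[of \<epsilon> "r + \<zeta>"] by (simp add: \<rho>_def)
  qed
qed

text \<open>The tangent terms of the two signs cancel. The gain comes from the sign that increases
  the argument; for the other sign plain convexity is enough, however far it passes below 0.\<close>

lemma soft_symmetric_gain:
  assumes \<epsilon>: "0 < \<epsilon>" "0 \<le> r"
  shows "2 * soft \<epsilon> r + \<epsilon> * ((\<zeta> / (r + \<epsilon>))\<^sup>2 - (\<zeta> / (r + \<epsilon>)) ^ 4) / 4 \<le> soft \<epsilon> (r + \<zeta>) + soft \<epsilon> (r - \<zeta>)"
proof -
  have *: "2 * soft \<epsilon> r + \<epsilon> * ((\<zeta> / (r + \<epsilon>))\<^sup>2 - (\<zeta> / (r + \<epsilon>)) ^ 4) / 4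
      \<le> soft \<epsilon> (r + \<zeta>) + soft \<epsilon> (r - \<zeta>)" if "0 \<le> \<zeta>" for \<zeta>
  proof -
    define u where "u = \<zeta> / (r + \<epsilon>)"
    have "\<epsilon> * ((u\<^sup>2 - u ^ 4) / 4) \<le> \<epsilon> * (u - ln (1 + u))"
      using \<epsilon> that by (intro mult_left_mono minus_ln_ge_quartic) (auto simp: u_def)
    moreover have "soft \<epsilon> r + r / (r + \<epsilon>) * \<zeta> + \<epsilon> * (u - ln (1 + u)) \<le> soft \<epsilon> (r + \<zeta>)"
      using soft_tangent[OF \<epsilon>, of \<zeta>] that by (simp add: u_def)
    moreover have "soft \<epsilon> r - r / (r + \<epsilon>) * \<zeta> \<le> soft \<epsilon> (r - \<zeta>)"
      using soft_tangent[OF \<epsilon>, of "- \<zeta>"] that by (cases "\<zeta> = 0") auto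
    ultimately have "2 * soft \<epsilon> r + \<epsilon> * (u\<^sup>2 - u ^ 4) / 4 \<le> soft \<epsilon> (r + \<zeta>) + soft \<epsilon> (r - \<zeta>)"
      by simp
    then show ?thesis unfolding u_def .
  qed
  show ?thesis using *[of \<zeta>] *[of "- \<zeta>"] by (cases "0 \<le> \<zeta>") auto
qed

text \<open>The positive part makes the potential bounded and lets it vanish away from \<Theta>.
  Squaring removes the kink where \<open>soft \<epsilon> r = a\<close>: a kink would cost order
  \<open>sqrt h\<close> in a step, while the time term can only pay for order
  \<open>h\<close>.\<close>

definition potential :: "real \<Rightarrow> real \<Rightarrow> real \<Rightarrow> real" where
  "potential a \<epsilon> r = (max 0 (a - soft \<epsilon> r))\<^sup>2"

lemma potential_bounds:
  assumes "0 < \<epsilon>" "0 \<le> a"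
  shows "0 \<le> potential a \<epsilon> r" "potential a \<epsilon> r \<le> a\<^sup>2"
  unfolding potential_def using soft_bounds(1)[OF assms(1), of r] assms by (auto intro!: power_mono)

lemma continuous_on_potential: "0 < \<epsilon> \<Longrightarrow> continuous_on A (potential a \<epsilon>)"
  unfolding potential_def by (intro continuous_intros continuous_on_soft)

text \<open>The squared positive part has the derivative \<open>2 * max 0 m\<close>, which is
  Lipschitz with constant 2; hence the remainder \<open>\<eta>\<^sup>2\<close> of its first-order
  expansion.\<close>

lemma max_zero_diff_power2_le:
  fixes m \<eta> :: real
  shows "(max 0 (m - \<eta>))\<^sup>2 \<le> (max 0 m)\<^sup>2 - 2 * max 0 m * \<eta> + \<eta>\<^sup>2"
proof (cases "0 \<le> m")
  case True
  have "(max 0 (m - \<eta>))\<^sup>2 \<le> (m - \<eta>)\<^sup>2" by (auto simp: max_def)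
  then show ?thesis using True by (simp add: power2_eq_square algebra_simps)
next
  case False
  then have "(max 0 (m - \<eta>))\<^sup>2 \<le> \<eta>\<^sup>2" by (intro abs_le_square_iff[THEN iffD1]) (auto simp: max_def)
  then show ?thesis using False by simp
qed

text \<open>Pairing \<open>w\<close> with \<open>- w\<close> cancels the linear terms. What remains
  is the gain of \<open>soft\<close>, weighted by the slope \<open>2 * m\<close> of the square,
  against the drift, the correction \<open>(norm v)\<^sup>2 / R\<close> of the normal ball and the
  quadratic remainder, which become costs of order \<open>h\<close> after integration.\<close>

lemma potential_near_pointwise:
  fixes \<Theta> :: "'a::euclidean_space set" and b w :: 'a
  assumes \<nu>: "norm \<nu> = 1" "y = \<xi> + infdist y \<Theta> *\<^sub>R \<nu>" "infdist (\<xi> + R *\<^sub>R \<nu>) \<Theta> = R" "0 < R"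
    and d: "infdist y \<Theta> \<le> R / 2" and \<epsilon>: "0 < \<epsilon>" and a: "0 \<le> a" and h: "0 \<le> h"
  defines "u \<equiv> (\<nu> \<bullet> w) / (infdist y \<Theta> + \<epsilon>)"
  shows "potential a \<epsilon> (infdist (y + h *\<^sub>R b + w) \<Theta>) + potential a \<epsilon> (infdist (y + h *\<^sub>R b - w) \<Theta>)
    \<le> 2 * potential a \<epsilon> (infdist y \<Theta>) - max 0 (a - soft \<epsilon> (infdist y \<Theta>)) * \<epsilon> / 2 * (u\<^sup>2 - u ^ 4)
      + 4 * a * h * norm b + (1 + 2 * a / R) * (2 * h\<^sup>2 * (norm b)\<^sup>2 + 2 * (norm w)\<^sup>2)"
proof -
  define r where "r = infdist y \<Theta>"
  define m where "m = max 0 (a - soft \<epsilon> r)"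
  have r0: "0 \<le> r" by (simp add: r_def infdist_nonneg)
  have m: "0 \<le> m" "m \<le> a" using soft_bounds(1)[OF \<epsilon>, of r] a by (auto simp: m_def)
  define \<eta> where "\<eta> v = soft \<epsilon> (infdist (y + v) \<Theta>) - soft \<epsilon> r" for v
  have pot: "potential a \<epsilon> (infdist (y + v) \<Theta>) \<le> potential a \<epsilon> r - 2 * m * \<eta> v + (norm v)\<^sup>2" for v
  proof -
    have "\<bar>\<eta> v\<bar> \<le> \<bar>infdist (y + v) \<Theta> - r\<bar>"
      unfolding \<eta>_def by (rule soft_lipschitz[OF \<epsilon>])
    also have "\<dots> \<le> norm v"
      using infdist_triangle_abs[of "y + v" \<Theta> y] by (simp add: r_def dist_norm)
    finally have "(\<eta> v)\<^sup>2 \<le> (norm v)\<^sup>2" by (simp add: abs_le_square_iff[symmetric])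
    then show ?thesis
      using max_zero_diff_power2_le[of "a - soft \<epsilon> r" "\<eta> v"]
      by (simp add: potential_def \<eta>_def m_def)
  qed
  \<comment> \<open>Monotonicity of \<open>soft\<close> inserts the normal-ball bound
    \<open>s\<close>; its Lipschitz property then separates drift and curvature from the normal
    component \<open>\<nu> \<bullet> w'\<close>.\<close>
  have low: "soft \<epsilon> (r + \<nu> \<bullet> w') - soft \<epsilon> r - h * norm b - (norm (h *\<^sub>R b + w'))\<^sup>2 / R \<le> \<eta> (h *\<^sub>R b + w')" for w'
  proof -
    define s where "s = r + \<nu> \<bullet> (h *\<^sub>R b + w') - (norm (h *\<^sub>R b + w'))\<^sup>2 / R"
    have "s \<le> infdist (\<xi> + r *\<^sub>R \<nu> + (h *\<^sub>R b + w')) \<Theta>"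
      unfolding s_def using infdist_lower_bound_normal[OF \<nu>(1,3,4) r0] d by (simp add: r_def)
    also have "\<xi> + r *\<^sub>R \<nu> = y" using \<nu>(2) by (simp add: r_def)
    finally have "soft \<epsilon> s \<le> soft \<epsilon> (infdist (y + (h *\<^sub>R b + w')) \<Theta>)"
      by (rule soft_incr(1)[OF \<epsilon>])
    moreover have "r + \<nu> \<bullet> w' - h * norm b - (norm (h *\<^sub>R b + w'))\<^sup>2 / R \<le> s"
    proof -
      have "- norm b \<le> \<nu> \<bullet> b" using Cauchy_Schwarz_ineq2[of \<nu> b] \<nu>(1) by auto
      then have "h * (- norm b) \<le> h * (\<nu> \<bullet> b)" using h by (rule mult_left_mono)
      then show ?thesis by (simp add: s_def inner_add_right)
    qed
    moreover have "soft \<epsilon> (r + \<nu> \<bullet> w') - soft \<epsilon> s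
        \<le> h * norm b + (norm (h *\<^sub>R b + w'))\<^sup>2 / R"
    proof (cases "s \<le> r + \<nu> \<bullet> w'")
      case True
      then show ?thesis using soft_incr(2)[OF \<epsilon> True] calculation(2) by linarith
    next
      case False
      then have "soft \<epsilon> (r + \<nu> \<bullet> w') \<le> soft \<epsilon> s" by (intro soft_incr[OF \<epsilon>]) simp
      moreover have "0 \<le> h * norm b + (norm (h *\<^sub>R b + w'))\<^sup>2 / R" using h \<nu>(4) by simp
      ultimately show ?thesis by linarith
    qed
    ultimately show ?thesis by (simp add: \<eta>_def)
  qed
  \<comment> \<open>By the parallelogram law the mixed terms of drift and noise cancel between the
    two signs.\<close>
  have par: "(norm (h *\<^sub>R b + w))\<^sup>2 + (norm (h *\<^sub>R b + - w))\<^sup>2 = 2 * h\<^sup>2 * (norm b)\<^sup>2 + 2 * (norm w)\<^sup>2"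
    unfolding power2_norm_eq_inner
    by (simp add: inner_add_left inner_add_right inner_diff_left inner_diff_right inner_commute power2_eq_square algebra_simps)
  have e: "y + h *\<^sub>R b + w = y + (h *\<^sub>R b + w)" "y + h *\<^sub>R b - w = y + (h *\<^sub>R b + - w)"
    by simp_all
  have "\<epsilon> * (u\<^sup>2 - u ^ 4) / 4 - 2 * h * norm b - (2 * h\<^sup>2 * (norm b)\<^sup>2 + 2 * (norm w)\<^sup>2) / R
      \<le> \<eta> (h *\<^sub>R b + w) + \<eta> (h *\<^sub>R b + - w)"
    using low[of w] low[of "- w"] soft_symmetric_gain[OF \<epsilon> r0, of "\<nu> \<bullet> w"]
    unfolding par[symmetric] add_divide_distrib by (simp add: u_def r_def)
  from mult_left_mono[OF this, of "2 * m"] m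
  have "2 * m * (\<epsilon> * (u\<^sup>2 - u ^ 4) / 4) - 2 * m * (2 * h * norm b) - 2 * m * ((2 * h\<^sup>2 * (norm b)\<^sup>2 + 2 * (norm w)\<^sup>2) / R)
      \<le> 2 * m * (\<eta> (h *\<^sub>R b + w) + \<eta> (h *\<^sub>R b + - w))"
    by (simp add: right_diff_distrib)
  moreover have "2 * m * (2 * h * norm b) \<le> 2 * a * (2 * h * norm b)"
    using m h by (intro mult_right_mono) auto
  moreover have "2 * m * ((2 * h\<^sup>2 * (norm b)\<^sup>2 + 2 * (norm w)\<^sup>2) / R) \<le> 2 * a * ((2 * h\<^sup>2 * (norm b)\<^sup>2 + 2 * (norm w)\<^sup>2) / R)"
    using m \<nu>(4) by (intro mult_right_mono) auto
  moreover have "potential a \<epsilon> (infdist (y + h *\<^sub>R b + w) \<Theta>) + potential a \<epsilon> (infdist (y + h *\<^sub>R b - w) \<Theta>)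
      \<le> 2 * potential a \<epsilon> r - 2 * m * (\<eta> (h *\<^sub>R b + w) + \<eta> (h *\<^sub>R b + - w)) + (2 * h\<^sup>2 * (norm b)\<^sup>2 + 2 * (norm w)\<^sup>2)"
    using pot[of "h *\<^sub>R b + w"] pot[of "h *\<^sub>R b + - w"] unfolding par[symmetric] e distrib_left by linarith
  moreover have "2 * m * (\<epsilon> * (u\<^sup>2 - u ^ 4) / 4) = m * \<epsilon> / 2 * (u\<^sup>2 - u ^ 4)"
    "2 * a * (2 * h * norm b) = 4 * a * h * norm b"
    "(1 + 2 * a / R) * (2 * h\<^sup>2 * (norm b)\<^sup>2 + 2 * (norm w)\<^sup>2)
      = (2 * h\<^sup>2 * (norm b)\<^sup>2 + 2 * (norm w)\<^sup>2) + 2 * a * ((2 * h\<^sup>2 * (norm b)\<^sup>2 + 2 * (norm w)\<^sup>2) / R)"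
    by (simp_all add: distrib_right)
  ultimately show ?thesis
    unfolding r_def[symmetric] m_def[symmetric] by linarith
qed

text \<open>The potential is 0 at \<open>y\<close> and becomes positive only through a jump to
  within \<open>\<kappa>\<close> of \<Theta>. If \<open>y\<close> has distance at most
  \<open>2 * \<kappa>\<close>, the new value is at most the square of the distance lost. Otherwise
  the jump covers at least half the distance, and the bound is the pointwise form of Chebyshev's
  inequality. The division by the squared distance later absorbs the linear growth of the
  coefficients.\<close>

lemma potential_far_pointwise:
  fixes \<Theta> :: "'a::euclidean_space set"
  assumes \<epsilon>: "0 < \<epsilon>" and a: "0 \<le> a" "a \<le> soft \<epsilon> \<kappa>" "a \<le> \<kappa>" "0 < \<kappa>" and d: "\<kappa> \<le> infdist y \<Theta>"
  shows "potential a \<epsilon> (infdist (y + v) \<Theta>) \<le> 4 * \<kappa>\<^sup>2 * (norm v)\<^sup>2 / (infdist y \<Theta>)\<^sup>2"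
proof -
  define r s where "r = infdist y \<Theta>" and "s = infdist (y + v) \<Theta>"
  have rs: "r - s \<le> norm v"
    using infdist_triangle[of y \<Theta> "y + v"] by (simp add: r_def s_def dist_norm)
  have r: "0 < r" "\<kappa> \<le> r" using a d by (auto simp: r_def)
  show ?thesis
  proof (cases "\<kappa> \<le> s")
    case True
    then have "a \<le> soft \<epsilon> s" using soft_incr(1)[OF \<epsilon> True] a by simp
    then show ?thesis unfolding s_def[symmetric] by (simp add: potential_def)
  next
    case False
    show ?thesis
    proof (cases "r \<le> 2 * \<kappa>")
      case True
      have "a \<le> soft \<epsilon> r" using soft_incr(1)[OF \<epsilon> r(2)] a by simp
      moreover have "soft \<epsilon> r - soft \<epsilon> s \<le> r - s"
        using False r by (intro soft_incr(2)[OF \<epsilon>]) simp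
      ultimately have "potential a \<epsilon> s \<le> (norm v)\<^sup>2"
        unfolding potential_def using rs by (intro power_mono) auto
      also have "\<dots> = 1 * (norm v)\<^sup>2" by simp
      also have "\<dots> \<le> (4 * \<kappa>\<^sup>2 / r\<^sup>2) * (norm v)\<^sup>2"
        using True r power_mono[OF True, of 2] by (intro mult_right_mono) (auto simp: power_mult_distrib)
      finally show ?thesis by (simp add: r_def s_def)
    next
      case f2: False
      have "potential a \<epsilon> s \<le> a\<^sup>2" by (rule potential_bounds[OF \<epsilon> a(1)])
      also have "\<dots> \<le> \<kappa>\<^sup>2 * 1" using a by (simp add: power_mono)
      also have "\<dots> \<le> \<kappa>\<^sup>2 * (4 * (norm v)\<^sup>2 / r\<^sup>2)"
      proof (rule mult_left_mono)
        have "r \<le> 2 * norm v" using rs f2 False by simp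
        from power_mono[OF this, of 2] r show "1 \<le> 4 * (norm v)\<^sup>2 / r\<^sup>2"
          by (simp add: power_mult_distrib)
      qed simp
      finally show ?thesis by (simp add: r_def s_def mult.commute mult.left_commute)
    qed
  qed
qed

subsection \<open>Expected change of the potential in one step\<close>

lemma distr_std_gauss_uminus: "distr std_gauss borel uminus = (std_gauss :: (real^'n) measure)"
proof (rule measure_eqI)
  fix A assume "A \<in> sets (distr (std_gauss :: (real^'n) measure) borel uminus)"
  then have [measurable]: "A \<in> sets borel" by simp
  have "emeasure (distr std_gauss borel uminus) A
      = (\<integral>\<^sup>+z. indicator A z \<partial>distr (std_gauss :: (real^'n) measure) borel uminus)"
    by simp
  also have "\<dots> = (\<integral>\<^sup>+z. indicator A (- z) \<partial>(std_gauss :: (real^'n) measure))"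
    by (rule nn_integral_distr) auto
  also have "\<dots> = (\<integral>\<^sup>+z. indicator A z \<partial>(std_gauss :: (real^'n) measure))"
    by (rule nn_integral_std_gauss_uminus) simp
  finally show "emeasure (distr std_gauss borel uminus) A = emeasure std_gauss A" by simp
qed simp

definition gauss_moment2 :: "'n::finite itself \<Rightarrow> real" where
  "gauss_moment2 _ = (\<integral>z. (norm (z :: real^'n))\<^sup>2 \<partial>std_gauss)"

definition gauss_moment4 :: "'n::finite itself \<Rightarrow> real" where
  "gauss_moment4 _ = (\<integral>z. (norm (z :: real^'n)) ^ 4 \<partial>std_gauss)"

lemma gauss_moment_nonneg: "0 \<le> gauss_moment2 TYPE('n::finite)" "0 \<le> gauss_moment4 TYPE('n::finite)"
  by (simp_all add: gauss_moment2_def gauss_moment4_def)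

lemma borel_measurable_matrix_vector_mult [measurable (raw)]:
  fixes f :: "'a \<Rightarrow> real^'n^'m"
  assumes "f \<in> borel_measurable M" "g \<in> borel_measurable M"
  shows "(\<lambda>x. f x *v g x) \<in> borel_measurable M"
proof (rule borel_measurable_continuous_Pair[OF assms])
  show "continuous_on UNIV (\<lambda>x::(real^'n^'m) \<times> (real^'n). fst x *v snd x)"
    unfolding matrix_vector_mult_def by (intro continuous_intros)
qed

lemma borel_measurable_potential [measurable (raw)]:
  assumes "0 < \<epsilon>" "f \<in> borel_measurable M"
  shows "(\<lambda>x. potential a \<epsilon> (f x)) \<in> borel_measurable M"
  by (rule borel_measurable_continuous_on[OF continuous_on_potential[OF assms(1)] assms(2)])

lemma borel_measurable_infdist [measurable (raw)]:
  fixes f :: "'a \<Rightarrow> 'b::metric_space"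
  assumes "f \<in> borel_measurable M"
  shows "(\<lambda>x. infdist (f x) \<Theta>) \<in> borel_measurable M"
  by (rule borel_measurable_continuous_on[OF _ assms]) (intro continuous_intros)

lemma integrable_potential_step:
  fixes y :: "real^'n" and A :: "real^'n^'n"
  assumes "0 < \<epsilon>" "0 \<le> a"
  shows "integrable std_gauss (\<lambda>z. potential a \<epsilon> (infdist (y + c *\<^sub>R (A *v z)) \<Theta>))"
proof -
  interpret G: prob_space "std_gauss :: (real^'n) measure" by (rule prob_space_std_gauss)
  show ?thesis
    using potential_bounds[OF assms] assms(1)
    by (intro G.integrable_const_bound[where B = "a\<^sup>2"]) auto
qed

lemma matrix_scale_bound:
  fixes A :: "real^'n^'n"
  assumes A: "\<And>v. norm (A *v v) \<le> S * norm v" and h: "0 \<le> h"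
  shows "(norm (sqrt h *\<^sub>R (A *v z)))\<^sup>2 \<le> h * S\<^sup>2 * (norm z)\<^sup>2"
proof -
  have "(norm (A *v z))\<^sup>2 \<le> (S * norm z)\<^sup>2" by (rule power_mono[OF A]) simp
  then have "h * (norm (A *v z))\<^sup>2 \<le> h * (S * norm z)\<^sup>2" using h by (rule mult_left_mono)
  then show ?thesis using h by (simp add: power_mult_distrib mult.assoc)
qed

text \<open>By symmetry of the Gaussian, integrating \<open>f z + f (- z)\<close> gives twice the
  expectation, so \<open>potential_near_pointwise\<close> applies. Here \<open>q\<close> is the
  second moment of the normal displacement relative to
  \<open>infdist y \<Theta> + \<epsilon>\<close>; Cauchy-Schwarz bounds the corresponding fourth
  moment by \<open>gauss_moment4\<close> times \<open>q\<^sup>2\<close>.\<close>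

lemma step_near_integral:
  fixes \<Theta> :: "(real^'n) set" and A :: "real^'n^'n" and b :: "real^'n"
  assumes \<nu>: "norm \<nu> = 1" "y = \<xi> + infdist y \<Theta> *\<^sub>R \<nu>" "infdist (\<xi> + R *\<^sub>R \<nu>) \<Theta> = R" "0 < R"
    and d: "infdist y \<Theta> \<le> R / 2" and \<epsilon>: "0 < \<epsilon>" and a: "0 \<le> a" and h: "0 \<le> h" "h \<le> 1"
    and A: "\<And>v. norm (A *v v) \<le> S * norm v"
  defines "q \<equiv> h * (norm (transpose A *v \<nu>))\<^sup>2 / (infdist y \<Theta> + \<epsilon>)\<^sup>2"
  shows "(\<integral>z. potential a \<epsilon> (infdist (y + h *\<^sub>R b + sqrt h *\<^sub>R (A *v z)) \<Theta>) \<partial>std_gauss)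
    \<le> potential a \<epsilon> (infdist y \<Theta>)
      - max 0 (a - soft \<epsilon> (infdist y \<Theta>)) * \<epsilon> / 4 * (q - gauss_moment4 TYPE('n) * q\<^sup>2)
      + (2 * a * norm b + (1 + 2 * a / R) * ((norm b)\<^sup>2 + S\<^sup>2 * gauss_moment2 TYPE('n))) * h"
proof -
  interpret G: prob_space "std_gauss :: (real^'n) measure" by (rule prob_space_std_gauss)
  define \<alpha> where "\<alpha> = transpose A *v \<nu>"
  define \<rho> where "\<rho> = infdist y \<Theta> + \<epsilon>"
  define m where "m = max 0 (a - soft \<epsilon> (infdist y \<Theta>))"
  define p where "p = potential a \<epsilon> (infdist y \<Theta>)"
  have \<rho>: "0 < \<rho>" using \<epsilon> by (simp add: \<rho>_def add_nonneg_pos infdist_nonneg)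
  have m: "0 \<le> m" by (simp add: m_def)
  define f where "f z = potential a \<epsilon> (infdist (y + h *\<^sub>R b + sqrt h *\<^sub>R (A *v z)) \<Theta>)" for z
  have fi: "integrable std_gauss f" "integrable std_gauss (\<lambda>z. f (- z))"
    unfolding f_def using integrable_potential_step[OF \<epsilon> a, of "y + h *\<^sub>R b" "sqrt h" A \<Theta>]
      integrable_potential_step[OF \<epsilon> a, of "y + h *\<^sub>R b" "- sqrt h" A \<Theta>]
    by (simp_all add: linear_neg[OF matrix_vector_mul_linear])
  have [measurable]: "f \<in> borel_measurable borel" using fi(1) by auto
  have "(\<integral>z. f z \<partial>std_gauss) = (\<integral>z. f z \<partial>distr (std_gauss :: (real^'n) measure) borel uminus)"
    by (simp add: distr_std_gauss_uminus)
  also have "\<dots> = (\<integral>z. f (- z) \<partial>std_gauss)"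
    by (rule integral_distr) auto
  finally have sym: "(\<integral>z. f z \<partial>std_gauss) = (\<integral>z. f (- z) \<partial>std_gauss)" .
  define c where "c = 2 * p + 4 * a * h * norm b + (1 + 2 * a / R) * (2 * h\<^sup>2 * (norm b)\<^sup>2)"
  define g where "g z = c - m * \<epsilon> / 2 * (h / \<rho>\<^sup>2) * (\<alpha> \<bullet> z)\<^sup>2 + m * \<epsilon> / 2 * (h\<^sup>2 * norm \<alpha> ^ 4 / \<rho> ^ 4) * norm z ^ 4
      + (1 + 2 * a / R) * (2 * h * S\<^sup>2) * (norm z)\<^sup>2" for z
  have pw: "f z + f (- z) \<le> g z" for z
  proof -
    define E K where "E = m * \<epsilon> / 2" and "K = 1 + 2 * a / R"
    define w where "w = sqrt h *\<^sub>R (A *v z)"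
    define u where "u = (\<nu> \<bullet> w) / \<rho>"
    have "\<nu> \<bullet> (A *v z) = \<alpha> \<bullet> z" unfolding \<alpha>_def by (simp add: dot_lmul_matrix[symmetric])
    then have u: "u = sqrt h * (\<alpha> \<bullet> z) / \<rho>" by (simp add: u_def w_def)
    have u2: "u\<^sup>2 = h / \<rho>\<^sup>2 * (\<alpha> \<bullet> z)\<^sup>2"
      using h by (simp add: u power_divide power_mult_distrib)
    have "u ^ 4 = (u\<^sup>2)\<^sup>2" by simp
    also have "\<dots> = h\<^sup>2 / \<rho> ^ 4 * (\<alpha> \<bullet> z) ^ 4"
      by (simp add: u2 power_mult_distrib power_divide)
    also have "\<dots> \<le> h\<^sup>2 / \<rho> ^ 4 * (norm \<alpha> * norm z) ^ 4"
    proof (rule mult_left_mono)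
      have "\<bar>\<alpha> \<bullet> z\<bar> ^ 4 \<le> (norm \<alpha> * norm z) ^ 4"
        by (rule power_mono[OF Cauchy_Schwarz_ineq2]) simp
      then show "(\<alpha> \<bullet> z) ^ 4 \<le> (norm \<alpha> * norm z) ^ 4" by (simp add: power_even_abs)
    qed simp
    finally have u4: "u ^ 4 \<le> h\<^sup>2 * norm \<alpha> ^ 4 / \<rho> ^ 4 * norm z ^ 4"
      by (simp add: power_mult_distrib)
    have "f z + f (- z) \<le> 2 * p - E * (u\<^sup>2 - u ^ 4)
      + 4 * a * h * norm b + K * (2 * h\<^sup>2 * (norm b)\<^sup>2 + 2 * (norm w)\<^sup>2)"
      using potential_near_pointwise[OF \<nu> d \<epsilon> a h(1), where w = w and b = b]
      by (simp add: f_def w_def p_def m_def u_def \<rho>_def E_def K_def linear_neg[OF matrix_vector_mul_linear])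
    moreover have "E * u ^ 4 \<le> E * (h\<^sup>2 * norm \<alpha> ^ 4 / \<rho> ^ 4 * norm z ^ 4)"
      using m \<epsilon> by (intro mult_left_mono[OF u4]) (simp add: E_def)
    moreover have "K * (2 * (norm w)\<^sup>2) \<le> K * (2 * (h * S\<^sup>2 * (norm z)\<^sup>2))"
      unfolding w_def K_def using a \<nu>(4) matrix_scale_bound[OF A h(1), of z] by (intro mult_left_mono) auto
    ultimately show ?thesis
      unfolding g_def c_def E_def[symmetric] K_def[symmetric]
      by (simp only: u2 right_diff_distrib distrib_left mult.assoc)
  qed
  have gi: "integrable std_gauss g"
    unfolding g_def using integrable_std_gauss_norm2 integrable_std_gauss_norm4 std_gauss_inner(1)[of \<alpha>]
    by (intro Bochner_Integration.integrable_add Bochner_Integration.integrable_diff integrable_mult_right) auto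
  have "2 * (\<integral>z. f z \<partial>std_gauss) = (\<integral>z. f z + f (- z) \<partial>std_gauss)"
    using fi sym by simp
  also have "\<dots> \<le> (\<integral>z. g z \<partial>std_gauss)"
    using fi gi pw by (intro integral_mono) auto
  also have "\<dots> = c - m * \<epsilon> / 2 * (h / \<rho>\<^sup>2) * (norm \<alpha>)\<^sup>2
      + m * \<epsilon> / 2 * (h\<^sup>2 * norm \<alpha> ^ 4 / \<rho> ^ 4) * gauss_moment4 TYPE('n)
      + (1 + 2 * a / R) * (2 * h * S\<^sup>2) * gauss_moment2 TYPE('n)"
  proof -
    have "(\<integral>z. c - k1 * (\<alpha> \<bullet> z)\<^sup>2 + k2 * norm z ^ 4 + k3 * (norm z)\<^sup>2 \<partial>(std_gauss :: (real^'n) measure))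
      = c - k1 * (norm \<alpha>)\<^sup>2 + k2 * gauss_moment4 TYPE('n) + k3 * gauss_moment2 TYPE('n)" for k1 k2 k3
      unfolding gauss_moment4_def gauss_moment2_def std_gauss_inner(2)[of \<alpha>, symmetric]
      using integrable_std_gauss_norm2 integrable_std_gauss_norm4 std_gauss_inner(1)[of \<alpha>] G.prob_space
      by (subst Bochner_Integration.integral_add Bochner_Integration.integral_diff; auto)+
    then show ?thesis unfolding g_def .
  qed
  also have "\<dots> = c - m * \<epsilon> / 2 * (q - gauss_moment4 TYPE('n) * q\<^sup>2)
      + (1 + 2 * a / R) * (2 * h * S\<^sup>2) * gauss_moment2 TYPE('n)"
    unfolding q_def \<alpha>_def[symmetric] \<rho>_def[symmetric]
    by (simp add: power_divide power_mult_distrib algebra_simps)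
  also have "\<dots> \<le> 2 * (p - m * \<epsilon> / 4 * (q - gauss_moment4 TYPE('n) * q\<^sup>2)
      + (2 * a * norm b + (1 + 2 * a / R) * ((norm b)\<^sup>2 + S\<^sup>2 * gauss_moment2 TYPE('n))) * h)"
  proof -
    have "h\<^sup>2 \<le> h" using h by (simp add: power2_eq_square mult_left_le)
    then have "(1 + 2 * a / R) * (2 * h\<^sup>2 * (norm b)\<^sup>2) \<le> (1 + 2 * a / R) * (2 * h * (norm b)\<^sup>2)"
      using a \<nu>(4) by (intro mult_left_mono mult_right_mono) auto
    then show ?thesis unfolding c_def by (simp add: algebra_simps)
  qed
  finally show ?thesis unfolding f_def p_def m_def by (simp only: mult_le_cancel_left_pos zero_less_numeral)
qed

lemma step_far_integral:
  fixes \<Theta> :: "(real^'n) set" and A :: "real^'n^'n" and b :: "real^'n"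
  assumes \<epsilon>: "0 < \<epsilon>" and a: "0 \<le> a" "a \<le> soft \<epsilon> \<kappa>" "a \<le> \<kappa>" "0 < \<kappa>" and d: "\<kappa> \<le> infdist y \<Theta>"
    and h: "0 \<le> h" "h \<le> 1" and A: "\<And>v. norm (A *v v) \<le> S * norm v"
  shows "(\<integral>z. potential a \<epsilon> (infdist (y + h *\<^sub>R b + sqrt h *\<^sub>R (A *v z)) \<Theta>) \<partial>std_gauss)
    \<le> 4 * \<kappa>\<^sup>2 / (infdist y \<Theta>)\<^sup>2 * (2 * (norm b)\<^sup>2 + 2 * S\<^sup>2 * gauss_moment2 TYPE('n)) * h"
proof -
  interpret G: prob_space "std_gauss :: (real^'n) measure" by (rule prob_space_std_gauss)
  define c where "c = 4 * \<kappa>\<^sup>2 / (infdist y \<Theta>)\<^sup>2"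
  have c: "0 \<le> c" by (simp add: c_def)
  have "potential a \<epsilon> (infdist (y + h *\<^sub>R b + sqrt h *\<^sub>R (A *v z)) \<Theta>)
      \<le> c * (2 * h * (norm b)\<^sup>2 + 2 * h * S\<^sup>2 * (norm z)\<^sup>2)" for z
  proof -
    define w where "w = sqrt h *\<^sub>R (A *v z)"
    have "(norm (h *\<^sub>R b + w))\<^sup>2 + (norm (h *\<^sub>R b - w))\<^sup>2 = 2 * h\<^sup>2 * (norm b)\<^sup>2 + 2 * (norm w)\<^sup>2"
      unfolding power2_norm_eq_inner
      by (simp add: inner_add_left inner_add_right inner_diff_left inner_diff_right inner_commute power2_eq_square algebra_simps)
    then have "(norm (h *\<^sub>R b + w))\<^sup>2 \<le> 2 * h\<^sup>2 * (norm b)\<^sup>2 + 2 * (norm w)\<^sup>2"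
      using zero_le_power2[of "norm (h *\<^sub>R b - w)"] by linarith
    also have "\<dots> \<le> 2 * h * (norm b)\<^sup>2 + 2 * (h * S\<^sup>2 * (norm z)\<^sup>2)"
    proof -
      have "h\<^sup>2 \<le> h" using h by (simp add: power2_eq_square mult_left_le)
      then show ?thesis unfolding w_def using matrix_scale_bound[OF A h(1), of z]
        by (intro add_mono mult_right_mono mult_left_mono) auto
    qed
    finally have "c * (norm (h *\<^sub>R b + w))\<^sup>2 \<le> c * (2 * h * (norm b)\<^sup>2 + 2 * h * S\<^sup>2 * (norm z)\<^sup>2)"
      using c by (intro mult_left_mono) (auto simp: mult.assoc)
    moreover have "potential a \<epsilon> (infdist (y + (h *\<^sub>R b + w)) \<Theta>) \<le> c * (norm (h *\<^sub>R b + w))\<^sup>2"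
      using potential_far_pointwise[OF \<epsilon> a d, of "h *\<^sub>R b + w"] by (simp add: c_def)
    ultimately show ?thesis by (simp add: w_def add.assoc)
  qed
  then have "(\<integral>z. potential a \<epsilon> (infdist (y + h *\<^sub>R b + sqrt h *\<^sub>R (A *v z)) \<Theta>) \<partial>std_gauss)
      \<le> (\<integral>z. c * (2 * h * (norm b)\<^sup>2 + 2 * h * S\<^sup>2 * (norm z)\<^sup>2) \<partial>(std_gauss :: (real^'n) measure))"
    using integrable_std_gauss_norm2
    by (intro integral_mono integrable_potential_step[OF \<epsilon> a(1)]) auto
  also have "\<dots> = c * (2 * h * (norm b)\<^sup>2 + 2 * h * S\<^sup>2 * gauss_moment2 TYPE('n))"
  proof -
    have "(\<integral>z. 2 * h * (norm b)\<^sup>2 + 2 * h * S\<^sup>2 * (norm z)\<^sup>2 \<partial>(std_gauss :: (real^'n) measure))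
      = (\<integral>z. 2 * h * (norm b)\<^sup>2 \<partial>(std_gauss :: (real^'n) measure))
        + (\<integral>z. 2 * h * S\<^sup>2 * (norm z)\<^sup>2 \<partial>(std_gauss :: (real^'n) measure))"
      using integrable_std_gauss_norm2 by (intro Bochner_Integration.integral_add) auto
    also have "\<dots> = 2 * h * (norm b)\<^sup>2 + 2 * h * S\<^sup>2 * gauss_moment2 TYPE('n)"
      using G.prob_space by (simp add: gauss_moment2_def)
    finally show ?thesis by simp
  qed
  finally show ?thesis by (simp add: c_def algebra_simps)
qed

text \<open>For \<open>w = transpose A *v u\<close> one has
  \<open>w \<bullet> w = (A *v w) \<bullet> u\<close>. The argument uses only the action of
  \<open>A\<close> on vectors, because a compatible matrix norm need not be invariant under
  transposition.\<close>

lemma transpose_bound: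
  fixes A :: "real^'n^'n"
  assumes "\<And>v. norm (A *v v) \<le> s * norm v"
  shows "norm (transpose A *v u) \<le> s * norm u"
proof -
  define w where "w = transpose A *v u"
  have "w \<bullet> w = (A *v w) \<bullet> u"
    unfolding w_def by (metis dot_lmul_matrix inner_commute transpose_matrix_vector)
  also have "\<dots> \<le> norm (A *v w) * norm u" by (rule norm_cauchy_schwarz)
  also have "\<dots> \<le> s * norm w * norm u" by (intro mult_right_mono assms) simp
  finally have *: "norm w * norm w \<le> (s * norm u) * norm w"
    by (simp add: dot_square_norm power2_eq_square mult_ac)
  show ?thesis
  proof (cases "w = 0")
    case True
    have "0 \<le> s * norm u" using order_trans[OF norm_ge_zero assms] .
    then show ?thesis using True by (simp add: w_def)
  next
    case False
    then show ?thesis using * by (simp add: w_def)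
  qed
qed

section \<open>The step size and the one-step inequality\<close>

lemma eps2_pos: "0 < S \<Longrightarrow> 0 < \<delta> \<Longrightarrow> \<delta> < 1 \<Longrightarrow> 0 < eps2 S \<delta>"
  by (simp add: eps2_def)

text \<open>With \<open>l = S * ln (1 / \<delta>)\<close> all three branches equal
  \<open>(r / l)\<^sup>2\<close>, where \<open>r\<close> is the distance clamped between
  \<open>eps2 S \<delta>\<close> and \<open>eps1 S \<delta>\<close>. In the larger tube
  \<open>r\<close> lies between \<open>\<rho> / 2\<close> and \<open>\<rho>\<close>, and
  \<open>\<rho>\<close> is the shifted distance in the second derivative of
  \<open>soft\<close>.\<close>

lemma step_size_cases:
  fixes y :: "'a::metric_space"
  assumes "\<Theta> \<noteq> {}" "0 < S" "0 < \<delta>" "\<delta> < 1"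
  defines "\<epsilon> \<equiv> eps2 S \<delta>" and "\<rho> \<equiv> infdist y \<Theta> + eps2 S \<delta>" and "h \<equiv> step_size S \<Theta> \<delta> y"
  shows "0 < h" "h \<le> \<delta>" "\<delta>\<^sup>2 \<le> h"
    and "h \<le> \<rho>\<^sup>2 / (S * ln (1 / \<delta>))\<^sup>2"
    and "eps1 S \<delta> \<le> infdist y \<Theta> \<Longrightarrow> h = \<delta>"
    and "infdist y \<Theta> < eps1 S \<delta> \<Longrightarrow> \<rho>\<^sup>2 / (S * ln (1 / \<delta>))\<^sup>2 / 4 \<le> h"
proof -
  define l d where "l = S * ln (1 / \<delta>)" and "d = infdist y \<Theta>"
  have l: "0 < l" unfolding l_def using assms by (intro mult_pos_pos) auto
  have d: "0 \<le> d" by (simp add: d_def infdist_nonneg)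
  have e: "\<epsilon> = l * \<delta>" "eps1 S \<delta> = l * sqrt \<delta>"
    by (simp_all add: \<epsilon>_def eps2_def eps1_def l_def)
  have \<epsilon>: "0 < \<epsilon>" using e l assms by simp
  have "\<delta> \<le> sqrt \<delta>" using assms by (intro real_le_rsqrt) (simp add: power2_eq_square mult_left_le)
  then have e12: "\<epsilon> \<le> eps1 S \<delta>" using e l by simp
  have \<rho>: "\<rho> = d + \<epsilon>" by (simp add: \<rho>_def d_def \<epsilon>_def)
  have "\<delta>\<^sup>2 \<le> \<delta>" using assms by (simp add: power2_eq_square mult_left_le)
  have h: "h = (if d < \<epsilon> then \<delta>\<^sup>2 else if d < eps1 S \<delta> then d\<^sup>2 / l\<^sup>2 else \<delta>)"
    using assms(1) by (simp add: h_def step_size_def tube_def d_def \<epsilon>_def l_def power_divide power_mult_distrib)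
  have sq: "(s / l)\<^sup>2 \<le> (t / l)\<^sup>2" if "0 \<le> s" "s \<le> t" for s t
    using that l by (intro power_mono divide_right_mono) auto
  have \<delta>2: "\<delta>\<^sup>2 = (\<epsilon> / l)\<^sup>2" "\<delta> = (eps1 S \<delta> / l)\<^sup>2"
    unfolding e using l assms(3) by simp_all
  show "0 < h" using h \<epsilon> l assms by auto
  show "h \<le> \<delta>"
    using h \<open>\<delta>\<^sup>2 \<le> \<delta>\<close> sq[OF d, of "eps1 S \<delta>"] \<delta>2(2) by (auto simp: power_divide)
  show "\<delta>\<^sup>2 \<le> h"
    using h \<open>\<delta>\<^sup>2 \<le> \<delta>\<close> sq[of \<epsilon> d] \<delta>2(1) \<epsilon> by (auto simp: power_divide)
  have "h \<le> (\<rho> / l)\<^sup>2"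
    using h sq[of \<epsilon> \<rho>] sq[of d \<rho>] sq[of "eps1 S \<delta>" \<rho>] \<delta>2 \<epsilon> d e12 by (auto simp: \<rho> power_divide)
  then show "h \<le> \<rho>\<^sup>2 / (S * ln (1 / \<delta>))\<^sup>2" by (simp add: power_divide l_def)
  show "h = \<delta>" if "eps1 S \<delta> \<le> infdist y \<Theta>"
    using that h e12 by (auto simp: d_def)
  show "\<rho>\<^sup>2 / (S * ln (1 / \<delta>))\<^sup>2 / 4 \<le> h" if "infdist y \<Theta> < eps1 S \<delta>"
  proof -
    have "(\<rho> / 2 / l)\<^sup>2 \<le> h"
      using that h sq[of "\<rho> / 2" \<epsilon>] sq[of "\<rho> / 2" d] \<delta>2 \<epsilon> d by (auto simp: \<rho> power_divide d_def)
    then show ?thesis by (simp add: power_divide l_def mult.commute)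
  qed
qed

text \<open>The two-sided bounds on the step size give \<open>q \<le> 1 / l\<^sup>2\<close>, so the
  quartic term loses at most half of the gain once \<open>l\<close> is large, and in the tube of
  radius \<open>eps1 S \<delta>\<close> they give \<open>q\<close> at least
  \<open>c\<^sub>1\<^sup>2 / (4 * (S * l)\<^sup>2)\<close>. The decrease is thus of order
  \<open>\<epsilon> / l\<^sup>2\<close>. Outside that tube \<open>h = \<delta>\<close>, and the last
  summand in the coefficient of \<open>h\<close> outweighs the subtracted term.\<close>

lemma one_step_near:
  fixes \<Theta> :: "(real^'n) set" and A :: "real^'n^'n" and b :: "real^'n"
  assumes \<Theta>: "\<Theta> \<noteq> {}" and S: "0 < S" and \<delta>: "0 < \<delta>" "\<delta> < 1"
    and \<nu>: "norm \<nu> = 1" "y = \<xi> + infdist y \<Theta> *\<^sub>R \<nu>" "infdist (\<xi> + R *\<^sub>R \<nu>) \<Theta> = R" "0 < R"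
    and d: "infdist y \<Theta> \<le> R / 2" and a: "0 \<le> a" and A: "\<And>v. norm (A *v v) \<le> S * norm v"
    and c\<^sub>1: "0 \<le> c\<^sub>1" "c\<^sub>1 \<le> norm (transpose A *v \<nu>)"
    and l: "1 \<le> ln (1 / \<delta>)" "2 * gauss_moment4 TYPE('n) \<le> (ln (1 / \<delta>))\<^sup>2" and e1: "2 * eps1 S \<delta> \<le> a"
  defines "h \<equiv> step_size S \<Theta> \<delta> y" and "\<epsilon> \<equiv> eps2 S \<delta>"
  shows "(\<integral>z. potential a \<epsilon> (infdist (y + h *\<^sub>R b + sqrt h *\<^sub>R (A *v z)) \<Theta>) \<partial>std_gauss)
    \<le> potential a \<epsilon> (infdist y \<Theta>)
      + (2 * a * norm b + (1 + 2 * a / R) * ((norm b)\<^sup>2 + S\<^sup>2 * gauss_moment2 TYPE('n)) + a * c\<^sub>1\<^sup>2 / (64 * S)) * h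
      - a * c\<^sub>1\<^sup>2 / (64 * S) * \<delta> / ln (1 / \<delta>)"
proof -
  define l where "l = ln (1 / \<delta>)"
  define K where "K = gauss_moment4 TYPE('n)"
  define \<rho> where "\<rho> = infdist y \<Theta> + \<epsilon>"
  define N where "N = norm (transpose A *v \<nu>)"
  define q where "q = h * N\<^sup>2 / \<rho>\<^sup>2"
  define m where "m = max 0 (a - soft \<epsilon> (infdist y \<Theta>))"
  \<comment> \<open>The constant is \<open>64 = 2 * 4 * 8\<close>: 2 from
    \<open>m \<ge> a / 2\<close>, 4 from \<open>step_near_integral\<close>, and 8 from half the
    lower bound \<open>c\<^sub>1\<^sup>2 / (4 * (S * l)\<^sup>2)\<close> for
    \<open>q\<close>.\<close>
  define c where "c = a * c\<^sub>1\<^sup>2 / (64 * S)"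
  note sc = step_size_cases[OF \<Theta> S \<delta>, of y, folded h_def \<epsilon>_def, folded \<rho>_def l_def]
  have e2p: "0 < \<epsilon>" unfolding \<epsilon>_def by (rule eps2_pos[OF S \<delta>])
  have l': "1 \<le> l" "2 * K \<le> l\<^sup>2" using l by (simp_all add: l_def K_def)
  have K: "0 \<le> K" unfolding K_def by (rule gauss_moment_nonneg)
  have \<rho>: "0 < \<rho>" using e2p by (simp add: \<rho>_def add_nonneg_pos infdist_nonneg)
  have N: "0 \<le> N" "N \<le> S" "c\<^sub>1 \<le> N"
    using transpose_bound[OF A, of \<nu>] \<nu>(1) c\<^sub>1 by (simp_all add: N_def)
  have m0: "0 \<le> m" by (simp add: m_def)
  have c0: "0 \<le> c" using a S by (simp add: c_def)
  have q0: "0 \<le> q" using sc(1) by (simp add: q_def)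
  have q1: "q \<le> 1 / l\<^sup>2"
  proof -
    have "q \<le> (\<rho>\<^sup>2 / (S * l)\<^sup>2) * S\<^sup>2 / \<rho>\<^sup>2"
      unfolding q_def using sc(1,4) N by (intro divide_right_mono mult_mono power_mono) auto
    also have "\<dots> = 1 / l\<^sup>2" using \<rho> S by (simp add: power_mult_distrib)
    finally show ?thesis .
  qed
  have "K * q \<le> K * (1 / l\<^sup>2)" using K q1 by (rule mult_left_mono[rotated])
  also have "\<dots> \<le> 1 / 2" using l' by (simp add: field_simps)
  finally have "K * q * q \<le> 1 / 2 * q" using q0 by (rule mult_right_mono)
  then have qq: "q / 2 \<le> q - K * q\<^sup>2" by (simp add: power2_eq_square)
  define B where "B = 2 * a * norm b + (1 + 2 * a / R) * ((norm b)\<^sup>2 + S\<^sup>2 * gauss_moment2 TYPE('n))"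
  have main: "(\<integral>z. potential a \<epsilon> (infdist (y + h *\<^sub>R b + sqrt h *\<^sub>R (A *v z)) \<Theta>) \<partial>std_gauss)
    \<le> potential a \<epsilon> (infdist y \<Theta>) - m * \<epsilon> / 4 * (q - K * q\<^sup>2) + B * h"
    using step_near_integral[OF \<nu> d e2p a _ _ A, of h b] sc(1,2) \<delta>
    by (simp add: q_def N_def \<rho>_def m_def B_def K_def)
  have gain: "c * \<delta> / l - c * h \<le> m * \<epsilon> / 4 * (q - K * q\<^sup>2)"
  proof (cases "infdist y \<Theta> < eps1 S \<delta>")
    case True
    have "soft \<epsilon> (infdist y \<Theta>) \<le> infdist y \<Theta>" by (rule soft_bounds(2)[OF e2p infdist_nonneg])
    then have "a / 2 \<le> a - soft \<epsilon> (infdist y \<Theta>)" using True e1 by linarith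
    then have m: "a / 2 \<le> m" unfolding m_def by (rule max.coboundedI2)
    have "c\<^sub>1\<^sup>2 / (4 * (S * l)\<^sup>2) = (\<rho>\<^sup>2 / (S * l)\<^sup>2 / 4) * c\<^sub>1\<^sup>2 / \<rho>\<^sup>2" using \<rho> by simp
    also have "\<dots> \<le> q"
      unfolding q_def using sc(6)[OF True] N c\<^sub>1(1)
      by (intro divide_right_mono mult_mono power_mono) (auto simp: sc(1) less_imp_le)
    finally have q2: "c\<^sub>1\<^sup>2 / (4 * (S * l)\<^sup>2) / 2 \<le> q - K * q\<^sup>2" using qq by simp
    have "c * \<delta> / l = (a / 2) * \<epsilon> / 4 * (c\<^sub>1\<^sup>2 / (4 * (S * l)\<^sup>2) / 2)"
      using S l'(1) by (simp add: c_def \<epsilon>_def eps2_def l_def[symmetric] power2_eq_square field_simps)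
    also have "\<dots> \<le> m * \<epsilon> / 4 * (q - K * q\<^sup>2)"
      using m q2 e2p m0 by (intro mult_mono divide_right_mono mult_right_mono) auto
    finally have "c * \<delta> / l \<le> m * \<epsilon> / 4 * (q - K * q\<^sup>2)" .
    moreover have "0 \<le> c * h" using c0 sc(1) by simp
    ultimately show ?thesis by linarith
  next
    case False
    have "c * \<delta> / l \<le> c * \<delta> / 1" using l'(1) c0 \<delta> by (intro divide_left_mono) auto
    moreover have "0 \<le> m * \<epsilon> / 4 * (q - K * q\<^sup>2)"
      using m0 e2p q0 qq by (intro mult_nonneg_nonneg) auto
    moreover have "h = \<delta>" using sc(5) False by simp
    ultimately show ?thesis by (simp only: \<open>h = \<delta>\<close>)
  qed
  have "- m * \<epsilon> / 4 * (q - K * q\<^sup>2) + B * h \<le> (B + c) * h - c * \<delta> / l"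
    using gain by (simp add: distrib_right)
  then show ?thesis using main unfolding B_def c_def l_def by linarith
qed

text \<open>The near and far estimates meet at distance \<open>\<kappa>\<close>, below which
  \<sigma> is still nondegenerate in the direction \<open>\<nu>\<close>. Beyond
  \<open>\<kappa>\<close> the potential cannot decrease; there \<open>h = \<delta>\<close>, and
  \<open>C * h\<close> covers both the jumps back and the subtracted term. The constants depend
  neither on \<delta> nor on \<open>y\<close>.\<close>

lemma one_step:
  fixes \<Theta> :: "(real^'n) set" and \<mu> :: "real^'n \<Rightarrow> real^'n" and \<sigma> :: "real^'n \<Rightarrow> real^'n^'n"
  assumes \<Theta>: "\<Theta> \<noteq> {}" and R: "0 < R" and c\<^sub>0: "0 < c\<^sub>0" and S: "0 < S" and G: "0 \<le> G"
    and normal: "\<And>y. infdist y \<Theta> < R \<Longrightarrow> \<exists>\<xi> \<nu>. \<xi> \<in> \<Theta> \<and> norm \<nu> = 1 \<and> y = \<xi> + infdist y \<Theta> *\<^sub>R \<nu> \<and>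
      infdist (\<xi> + R *\<^sub>R \<nu>) \<Theta> = R \<and> c\<^sub>0 \<le> norm (transpose (\<sigma> \<xi>) *v \<nu>)"
    and \<sigma>S: "\<And>y v. infdist y \<Theta> < R \<Longrightarrow> norm (\<sigma> y *v v) \<le> S * norm v"
    and \<sigma>G: "\<And>y v. norm (\<sigma> y *v v) \<le> G * (1 + infdist y \<Theta>) * norm v"
    and \<mu>G: "\<And>y. norm (\<mu> y) \<le> G * (1 + infdist y \<Theta>)"
    and L: "\<And>y z v. norm ((\<sigma> y - \<sigma> z) *v v) \<le> L * norm (y - z) * norm v"
  shows "\<exists>a C c \<delta>\<^sub>0. 0 < a \<and> 0 \<le> C \<and> 0 < c \<and> 0 < \<delta>\<^sub>0 \<and> \<delta>\<^sub>0 < 1 \<and> (\<forall>\<delta> y. 0 < \<delta> \<and> \<delta> < \<delta>\<^sub>0 \<longrightarrow>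
     (\<integral>z. potential a (eps2 S \<delta>) (infdist (y + step_size S \<Theta> \<delta> y *\<^sub>R \<mu> y + sqrt (step_size S \<Theta> \<delta> y) *\<^sub>R (\<sigma> y *v z)) \<Theta>) \<partial>std_gauss)
       \<le> potential a (eps2 S \<delta>) (infdist y \<Theta>) + C * step_size S \<Theta> \<delta> y - c * \<delta> / ln (1 / \<delta>))"
proof -
  \<comment> \<open>Within \<open>R / 4\<close> the normal-ball estimate is available. The second
    entry keeps the change of \<sigma> between \<open>y\<close> and its nearest point below
    \<open>c\<^sub>0 / 2\<close>, so that half of the nondegeneracy survives at \<open>y\<close>;
    the \<open>+ 1\<close> avoids a zero denominator.\<close>
  define \<kappa> where "\<kappa> = min (R / 4) (c\<^sub>0 / (2 * (\<bar>L\<bar> + 1)))"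
  \<comment> \<open>Strictly below \<open>\<kappa>\<close>, because
    \<open>soft (eps2 S \<delta>) \<kappa>\<close> approaches \<open>\<kappa>\<close> from below as
    \<delta> tends to 0 and has to be at least \<open>a\<close>.\<close>
  define a where "a = \<kappa> / 2"
  have L1: "0 < \<bar>L\<bar> + 1" by simp
  have \<kappa>: "0 < \<kappa>" "\<kappa> \<le> R / 4" "\<kappa> * (\<bar>L\<bar> + 1) \<le> c\<^sub>0 / 2"
  proof -
    show "0 < \<kappa>" unfolding \<kappa>_def using R c\<^sub>0 L1 by simp
    show "\<kappa> \<le> R / 4" unfolding \<kappa>_def by (rule min.cobounded1)
    have "\<kappa> \<le> (c\<^sub>0 / 2) / (\<bar>L\<bar> + 1)" by (simp add: \<kappa>_def)
    then show "\<kappa> * (\<bar>L\<bar> + 1) \<le> c\<^sub>0 / 2" using L1 by (simp only: pos_le_divide_eq)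
  qed
  have a: "0 < a" "a \<le> \<kappa>" using \<kappa> by (auto simp: a_def)
  define K2 where "K2 = gauss_moment2 TYPE('n)"
  have K2: "0 \<le> K2" unfolding K2_def by (rule gauss_moment_nonneg)
  define c where "c = a * (c\<^sub>0 / 2)\<^sup>2 / (64 * S)"
  define Gk where "Gk = G * (1 + \<kappa>)"
  define C1 where "C1 = 2 * a * Gk + (1 + 2 * a / R) * (Gk\<^sup>2 + S\<^sup>2 * K2)"
  \<comment> \<open>For \<open>d \<ge> \<kappa>\<close> the growth factor satisfies
    \<open>1 + d \<le> (1 + \<kappa>) / \<kappa> * d\<close>; its square cancels both
    \<open>\<kappa>\<^sup>2\<close> and \<open>d\<^sup>2\<close> in the far estimate.\<close>
  define C2 where "C2 = 4 * (1 + \<kappa>)\<^sup>2 * G\<^sup>2 * (2 + 2 * K2)"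
  have c: "0 < c" using a c\<^sub>0 S by (simp add: c_def)
  have Gk: "0 \<le> Gk" using G \<kappa> by (simp add: Gk_def)
  have C: "0 \<le> C1" "0 \<le> C2" using a R Gk G K2 by (simp_all add: C1_def C2_def)
  have "\<forall>\<^sub>F \<delta> :: real in at_right 0. 1 \<le> ln (1 / \<delta>)" by real_asymp
  moreover have "\<forall>\<^sub>F \<delta> :: real in at_right 0. 2 * gauss_moment4 TYPE('n) \<le> (ln (1 / \<delta>))\<^sup>2" by real_asymp
  moreover have "\<forall>\<^sub>F \<delta> in at_right 0. 2 * (S * ln (1 / \<delta>) * sqrt \<delta>) \<le> a"
    using a(1) by real_asymp
  moreover have "\<forall>\<^sub>F \<delta> in at_right 0. a \<le> \<kappa> - (S * ln (1 / \<delta>) * \<delta>) * ln (1 + \<kappa> / (S * ln (1 / \<delta>) * \<delta>))"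
    unfolding a_def using S \<kappa>(1) by real_asymp
  ultimately have "\<forall>\<^sub>F \<delta> :: real in at_right 0. 1 \<le> ln (1 / \<delta>) \<and> 2 * gauss_moment4 TYPE('n) \<le> (ln (1 / \<delta>))\<^sup>2
      \<and> 2 * eps1 S \<delta> \<le> a \<and> a \<le> soft (eps2 S \<delta>) \<kappa>"
    by eventually_elim (use \<kappa>(1) in \<open>simp add: eps1_def eps2_def soft_pos_eq\<close>)
  then obtain \<delta>' where \<delta>': "0 < \<delta>'" and ev: "\<And>\<delta>. 0 < \<delta> \<Longrightarrow> \<delta> < \<delta>' \<Longrightarrow> 1 \<le> ln (1 / \<delta>) \<and> 2 * gauss_moment4 TYPE('n) \<le> (ln (1 / \<delta>))\<^sup>2
      \<and> 2 * eps1 S \<delta> \<le> a \<and> a \<le> soft (eps2 S \<delta>) \<kappa>"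
    by (auto simp: eventually_at_right[of 0 1])
  define \<delta>\<^sub>0 where "\<delta>\<^sub>0 = min \<delta>' (1 / 2)"
  have "(\<integral>z. potential a (eps2 S \<delta>) (infdist (y + step_size S \<Theta> \<delta> y *\<^sub>R \<mu> y + sqrt (step_size S \<Theta> \<delta> y) *\<^sub>R (\<sigma> y *v z)) \<Theta>) \<partial>std_gauss)
       \<le> potential a (eps2 S \<delta>) (infdist y \<Theta>) + (C1 + C2 + c) * step_size S \<Theta> \<delta> y - c * \<delta> / ln (1 / \<delta>)"
    if \<delta>: "0 < \<delta>" "\<delta> < \<delta>\<^sub>0" for \<delta> y
  proof -
    have \<delta>1: "\<delta> < 1" using \<delta> by (simp add: \<delta>\<^sub>0_def)
    have e: "1 \<le> ln (1 / \<delta>)" "2 * gauss_moment4 TYPE('n) \<le> (ln (1 / \<delta>))\<^sup>2" "2 * eps1 S \<delta> \<le> a" "a \<le> soft (eps2 S \<delta>) \<kappa>"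
      using ev[of \<delta>] \<delta> by (auto simp: \<delta>\<^sub>0_def)
    define h d where "h = step_size S \<Theta> \<delta> y" and "d = infdist y \<Theta>"
    note sc = step_size_cases[OF \<Theta> S \<delta>(1) \<delta>1, of y, folded h_def]
    note e2p = eps2_pos[OF S \<delta>(1) \<delta>1]
    have d0: "0 \<le> d" by (simp add: d_def infdist_nonneg)
    show ?thesis
    proof (cases "d < \<kappa>")
      case True
      then have dR: "infdist y \<Theta> < R" "infdist y \<Theta> \<le> R / 2" using \<kappa> R by (simp_all add: d_def)
      obtain \<xi> \<nu> where \<nu>: "norm \<nu> = 1" "y = \<xi> + infdist y \<Theta> *\<^sub>R \<nu>"
        "infdist (\<xi> + R *\<^sub>R \<nu>) \<Theta> = R" "c\<^sub>0 \<le> norm (transpose (\<sigma> \<xi>) *v \<nu>)"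
        using normal[OF dR(1)] by blast
      have "norm (transpose (\<sigma> \<xi> - \<sigma> y) *v \<nu>) \<le> L * norm (\<xi> - y) * norm \<nu>"
        by (rule transpose_bound) (rule L)
      also have "norm (\<xi> - y) = d" using \<nu>(1) by (subst \<nu>(2)) (simp add: d_def infdist_nonneg)
      also have "L * d * norm \<nu> \<le> (\<bar>L\<bar> + 1) * \<kappa>"
        using \<nu>(1) True d0 by (simp add: mult_mono)
      also have "\<dots> \<le> c\<^sub>0 / 2" using \<kappa>(3) by (simp add: mult.commute)
      finally have diff: "norm (transpose (\<sigma> \<xi> - \<sigma> y) *v \<nu>) \<le> c\<^sub>0 / 2" .
      have "transpose (\<sigma> \<xi>) *v \<nu> = transpose (\<sigma> y) *v \<nu> + transpose (\<sigma> \<xi> - \<sigma> y) *v \<nu>"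
        by (simp add: transpose_def matrix_vector_mult_def vec_eq_iff sum.distrib[symmetric] algebra_simps)
      then have "norm (transpose (\<sigma> \<xi>) *v \<nu>) \<le> norm (transpose (\<sigma> y) *v \<nu>) + norm (transpose (\<sigma> \<xi> - \<sigma> y) *v \<nu>)"
        by (metis norm_triangle_ineq)
      then have low: "c\<^sub>0 / 2 \<le> norm (transpose (\<sigma> y) *v \<nu>)" using diff \<nu>(4) by linarith
      have b: "norm (\<mu> y) \<le> Gk"
      proof -
        have "G * (1 + infdist y \<Theta>) \<le> G * (1 + \<kappa>)" using True G by (intro mult_left_mono) (auto simp: d_def)
        then show ?thesis using \<mu>G[of y] by (simp add: Gk_def)
      qed
      have "2 * a * norm (\<mu> y) + (1 + 2 * a / R) * ((norm (\<mu> y))\<^sup>2 + S\<^sup>2 * K2) \<le> C1"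
        unfolding C1_def using b a R by (intro add_mono mult_left_mono power_mono) auto
      then have "(2 * a * norm (\<mu> y) + (1 + 2 * a / R) * ((norm (\<mu> y))\<^sup>2 + S\<^sup>2 * K2) + c) * h \<le> (C1 + C2 + c) * h"
        using C sc(1) by (intro mult_right_mono) auto
      then show ?thesis
        using one_step_near[OF \<Theta> S \<delta>(1) \<delta>1 \<nu>(1-3) R dR(2) less_imp_le[OF a(1)] \<sigma>S[OF dR(1)] _ low e(1-3), of "\<mu> y"] c\<^sub>0
        unfolding h_def[symmetric] c_def[symmetric] K2_def[symmetric] by linarith
    next
      case False
      then have d: "\<kappa> \<le> infdist y \<Theta>" "0 < d" using \<kappa>(1) by (simp_all add: d_def)
      have "eps1 S \<delta> \<le> infdist y \<Theta>" using e(3) a d by simp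
      then have h: "h = \<delta>" by (rule sc(5))
      have g: "1 + d \<le> (1 + \<kappa>) / \<kappa> * d"
        using d(1) \<kappa>(1) by (simp add: d_def[symmetric] field_simps)
      have "4 * \<kappa>\<^sup>2 / d\<^sup>2 * (2 * (norm (\<mu> y))\<^sup>2 + 2 * (G * (1 + d))\<^sup>2 * K2)
          \<le> 4 * \<kappa>\<^sup>2 / d\<^sup>2 * (2 * (G * (1 + d))\<^sup>2 + 2 * (G * (1 + d))\<^sup>2 * K2)"
        using \<mu>G[of y] by (intro mult_left_mono add_mono power_mono) (auto simp: d_def)
      also have "\<dots> = 4 * \<kappa>\<^sup>2 / d\<^sup>2 * (1 + d)\<^sup>2 * (G\<^sup>2 * (2 + 2 * K2))"
        by (simp only: power_mult_distrib) (simp add: algebra_simps add_divide_distrib)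
      also have "\<dots> \<le> 4 * \<kappa>\<^sup>2 / d\<^sup>2 * ((1 + \<kappa>) / \<kappa> * d)\<^sup>2 * (G\<^sup>2 * (2 + 2 * K2))"
        using d0 K2 by (intro mult_right_mono mult_left_mono power_mono[OF g]) auto
      also have "\<dots> = C2"
        using d(2) \<kappa>(1) by (simp add: C2_def power_mult_distrib power_divide)
      finally have C2: "4 * \<kappa>\<^sup>2 / d\<^sup>2 * (2 * (norm (\<mu> y))\<^sup>2 + 2 * (G * (1 + d))\<^sup>2 * K2) * h \<le> C2 * h"
        using sc(1) by (intro mult_right_mono) auto
      have "c * \<delta> / ln (1 / \<delta>) \<le> c * \<delta> / 1" using e(1) c \<delta>(1) \<delta>1 by (intro divide_left_mono) auto
      then have "C2 * h \<le> (C1 + C2 + c) * h - c * \<delta> / ln (1 / \<delta>)"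
        using C(1) \<delta>(1) by (simp add: h distrib_right)
      moreover have "0 \<le> potential a (eps2 S \<delta>) (infdist y \<Theta>)"
        using potential_bounds(1)[OF e2p] a by simp
      moreover have h1: "h \<le> 1" using sc(2) \<delta>1 by simp
      ultimately show ?thesis
        using step_far_integral[OF e2p less_imp_le[OF a(1)] e(4) a(2) \<kappa>(1) d(1) less_imp_le[OF sc(1)] h1 \<sigma>G[of y], of "\<mu> y"] C2
        unfolding h_def[symmetric] d_def[symmetric] K2_def[symmetric] by linarith
    qed
  qed
  then show ?thesis
    using a(1) C c \<delta>' by (intro exI[of _ a] exI[of _ "C1 + C2 + c"] exI[of _ c] exI[of _ \<delta>\<^sub>0]) (auto simp: \<delta>\<^sub>0_def)
qed

subsection \<open>The strong Markov property of the scheme\<close>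

lemma dyadic_tendsto:
  assumes "\<And>m. \<bar>real_of_int (i m) - 2 ^ m * t\<bar> \<le> 1"
  shows "(\<lambda>m. real_of_int (i m) / 2 ^ m) \<longlonglongrightarrow> t"
proof (rule Lim_null_comparison[THEN LIM_zero_cancel])
  show "\<forall>\<^sub>F m in sequentially. norm (real_of_int (i m) / 2 ^ m - t) \<le> (1 / 2) ^ m"
  proof (intro always_eventually allI)
    fix m :: nat
    have "real_of_int (i m) / 2 ^ m - t = (real_of_int (i m) - 2 ^ m * t) / 2 ^ m"
      by (simp add: diff_divide_distrib)
    then have "norm (real_of_int (i m) / 2 ^ m - t) = \<bar>real_of_int (i m) - 2 ^ m * t\<bar> / 2 ^ m"
      by (simp add: abs_divide)
    then show "norm (real_of_int (i m) / 2 ^ m - t) \<le> (1 / 2) ^ m"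
      using assms[of m] by (simp add: power_divide divide_right_mono)
  qed
  show "(\<lambda>m. (1 / 2 :: real) ^ m) \<longlonglongrightarrow> 0" by (rule LIMSEQ_power_zero) simp
qed

lemma nn_integral_countable_partition:
  fixes g :: "'a \<Rightarrow> nat"
  assumes [measurable]: "f \<in> borel_measurable M" "g \<in> measurable M (count_space UNIV)"
  shows "(\<integral>\<^sup>+x. f x \<partial>M) = (\<Sum>i. \<integral>\<^sup>+x. (if g x = i then f x else 0) \<partial>M)"
proof -
  have "(\<Sum>i. if g x = i then f x else 0) = f x" for x
    using sums_single[of "g x" "\<lambda>_. f x"] by (simp add: sums_iff eq_commute)
  then have "(\<integral>\<^sup>+x. f x \<partial>M) = (\<integral>\<^sup>+x. (\<Sum>i. if g x = i then f x else 0) \<partial>M)" by simp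
  also have "\<dots> = (\<Sum>i. \<integral>\<^sup>+x. (if g x = i then f x else 0) \<partial>M)"
    by (rule nn_integral_suminf) measurable
  finally show ?thesis .
qed

text \<open>Independence makes the joint law of \<open>X\<close> and the increment a product, so by
  Fubini the increment can be integrated out with \<open>X\<close> frozen.\<close>

lemma brownian_increment:
  fixes W :: "real \<Rightarrow> 'w \<Rightarrow> real^'n"
  assumes M: "prob_space M" and bm: "brownian_motion M F W" and sub: "subalgebra M (F s)"
    and s: "0 \<le> s" "0 < q" and X: "X \<in> measurable (F s) K"
    and \<phi>[measurable]: "case_prod \<phi> \<in> borel_measurable (K \<Otimes>\<^sub>M borel)"
  shows "(\<integral>\<^sup>+\<omega>. \<phi> (X \<omega>) (W (s + q) \<omega> - W s \<omega>) \<partial>M) = (\<integral>\<^sup>+\<omega>. (\<integral>\<^sup>+z. \<phi> (X \<omega>) (sqrt q *\<^sub>R z) \<partial>std_gauss) \<partial>M)"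
proof -
  interpret prob_space M by fact
  interpret G: prob_space "std_gauss :: (real^'n) measure" by (rule prob_space_std_gauss)
  define D where "D \<omega> = W (s + q) \<omega> - W s \<omega>" for \<omega>
  have ind: "indep_set (sets (F s)) {D -` A \<inter> space M | A. A \<in> sets borel}"
    and dist: "distributed M lborel D (\<lambda>v. ennreal (gauss_density (sqrt q) v))"
    using bm[unfolded brownian_motion_def, THEN conjunct2, THEN conjunct2, THEN conjunct2, rule_format, of s "s + q"] s
    unfolding D_def gauss_density_def by simp_all
  have D[measurable]: "D \<in> borel_measurable M"
    using distributed_measurable[OF dist] by simp
  have XM[measurable]: "X \<in> measurable M K"
    using X sub by (rule measurable_from_subalg[rotated])
  have spF: "space (F s) = space M" using sub by (simp add: subalgebra_def)
  interpret X: prob_space "distr M K X" by (rule prob_space_distr) simp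
  interpret D: prob_space "distr M borel D" by (rule prob_space_distr) simp
  have prod: "distr M K X \<Otimes>\<^sub>M distr M borel D = distr M (K \<Otimes>\<^sub>M borel) (\<lambda>\<omega>. (X \<omega>, D \<omega>))"
  proof (rule pair_measure_eqI)
    show "sigma_finite_measure (distr M K X)" "sigma_finite_measure (distr M borel D)" by unfold_locales
    fix A B assume "A \<in> sets (distr M K X)" "B \<in> sets (distr M borel D)"
    then have [measurable]: "A \<in> sets K" "B \<in> sets borel" by simp_all
    have "prob ((X -` A \<inter> space M) \<inter> (D -` B \<inter> space M)) = prob (X -` A \<inter> space M) * prob (D -` B \<inter> space M)"
    proof (rule indep_setD[OF ind])
      show "X -` A \<inter> space M \<in> sets (F s)"
        using measurable_sets[OF X, of A] by (simp add: spF)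
      show "D -` B \<inter> space M \<in> {D -` A \<inter> space M |A. A \<in> sets borel}"
        using \<open>B \<in> sets borel\<close> by (intro CollectI exI[of _ B] conjI refl)
    qed
    moreover have "(\<lambda>\<omega>. (X \<omega>, D \<omega>)) -` (A \<times> B) \<inter> space M = (X -` A \<inter> space M) \<inter> (D -` B \<inter> space M)"
      by auto
    ultimately show "emeasure (distr M K X) A * emeasure (distr M borel D) B
        = emeasure (distr M (K \<Otimes>\<^sub>M borel) (\<lambda>\<omega>. (X \<omega>, D \<omega>))) (A \<times> B)"
      by (simp add: emeasure_distr emeasure_eq_measure ennreal_mult[symmetric])
  qed (simp cong: sets_pair_measure_cong)
  have distD: "distr M borel D = distr std_gauss borel (\<lambda>z. sqrt q *\<^sub>R z)"
  proof -
    have "distr M borel D = distr M lborel D" by (rule distr_cong) auto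
    also have "\<dots> = density lborel (\<lambda>v. ennreal (gauss_density (sqrt q) v))"
      by (rule distributed_distr_eq_density[OF dist])
    finally show ?thesis using density_gauss_scale[OF s(2)] by simp
  qed
  have "(\<integral>\<^sup>+\<omega>. \<phi> (X \<omega>) (D \<omega>) \<partial>M) = (\<integral>\<^sup>+p. case_prod \<phi> p \<partial>distr M (K \<Otimes>\<^sub>M borel) (\<lambda>\<omega>. (X \<omega>, D \<omega>)))"
    by (subst nn_integral_distr) auto
  also have "\<dots> = (\<integral>\<^sup>+x. (\<integral>\<^sup>+v. \<phi> x v \<partial>distr M borel D) \<partial>distr M K X)"
    unfolding prod[symmetric] by (subst D.nn_integral_fst[symmetric]) auto
  also have "\<dots> = (\<integral>\<^sup>+x. (\<integral>\<^sup>+z. \<phi> x (sqrt q *\<^sub>R z) \<partial>std_gauss) \<partial>distr M K X)"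
    unfolding distD by (intro nn_integral_cong nn_integral_distr) auto
  also have "\<dots> = (\<integral>\<^sup>+\<omega>. (\<integral>\<^sup>+z. \<phi> (X \<omega>) (sqrt q *\<^sub>R z) \<partial>std_gauss) \<partial>M)"
    by (subst nn_integral_distr) auto
  finally show ?thesis by (simp add: D_def)
qed


text \<open>Rounding \<open>T\<close> down to a dyadic grid leaves countably many times, where
  measurability is clear; continuity in \<open>u\<close> gives the limit.\<close>

lemma borel_measurable_caratheodory:
  fixes f :: "real \<Rightarrow> 'a \<Rightarrow> 'b::metric_space"
  assumes f: "\<And>u. f u \<in> borel_measurable N" and T: "T \<in> borel_measurable N"
    and cont: "\<And>\<omega>. \<omega> \<in> space N \<Longrightarrow> continuous_on UNIV (\<lambda>u. f u \<omega>)"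
  shows "(\<lambda>\<omega>. f (T \<omega>) \<omega>) \<in> borel_measurable N"
proof (rule borel_measurable_LIMSEQ_metric)
  fix m :: nat
  have "(\<lambda>\<omega>. \<lfloor>2 ^ m * T \<omega>\<rfloor>) \<in> measurable N (count_space UNIV)"
    using T by measurable
  from measurable_compose_countable[OF _ this, where f = "\<lambda>i. f (real_of_int i / 2 ^ m)"]
  show "(\<lambda>\<omega>. f (real_of_int \<lfloor>2 ^ m * T \<omega>\<rfloor> / 2 ^ m) \<omega>) \<in> borel_measurable N"
    using f by simp
next
  fix \<omega> assume \<omega>: "\<omega> \<in> space N"
  have "(\<lambda>m. real_of_int \<lfloor>2 ^ m * T \<omega>\<rfloor> / 2 ^ m) \<longlonglongrightarrow> T \<omega>"
    by (rule dyadic_tendsto) linarith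
  then show "(\<lambda>m. f (real_of_int \<lfloor>2 ^ m * T \<omega>\<rfloor> / 2 ^ m) \<omega>) \<longlonglongrightarrow> f (T \<omega>) \<omega>"
    using continuous_on_tendsto_compose[OF cont[OF \<omega>]] by simp
qed

lemma normal_filtrationD:
  assumes "normal_filtration M F"
  shows "0 \<le> t \<Longrightarrow> subalgebra M (F t)" "0 \<le> s \<Longrightarrow> s \<le> t \<Longrightarrow> sets (F s) \<subseteq> sets (F t)"
    "null_sets M \<subseteq> sets (F 0)"
  using assms[unfolded normal_filtration_def, THEN conjunct1]
    assms[unfolded normal_filtration_def, THEN conjunct2, THEN conjunct1]
    assms[unfolded normal_filtration_def, THEN conjunct2, THEN conjunct2, THEN conjunct1]
  by simp_all

text \<open>Paths are replaced by 0 on a null set outside which they are continuous. Adaptedness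
  survives because a normal filtration contains every null set from time 0 on. Clipping the time at
  0 extends continuity to the whole line.\<close>

lemma brownian_continuous_modification:
  fixes W :: "real \<Rightarrow> 'w \<Rightarrow> real^'n"
  assumes nf: "normal_filtration M F" and bm: "brownian_motion M F W"
  obtains B where "\<And>t. 0 \<le> t \<Longrightarrow> B t \<in> borel_measurable (F t)"
    "\<And>\<omega>. continuous_on UNIV (\<lambda>t. B t \<omega>)" "AE \<omega> in M. \<forall>t\<ge>0. B t \<omega> = W t \<omega>"
proof -
  have "AE \<omega> in M. continuous_on {0..} (\<lambda>t. W t \<omega>)"
    using bm by (simp add: brownian_motion_def)
  then obtain N where N: "{\<omega> \<in> space M. \<not> continuous_on {0..} (\<lambda>t. W t \<omega>)} \<subseteq> N" "emeasure M N = 0" "N \<in> sets M"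
    by (rule AE_E)
  define B where "B t \<omega> = (if \<omega> \<in> space M - N then W (max 0 t) \<omega> else 0)" for t \<omega>
  show ?thesis
  proof
    fix t :: real assume t: "0 \<le> t"
    have spF: "space (F t) = space M" using normal_filtrationD(1)[OF nf t] by (simp add: subalgebra_def)
    have "N \<in> null_sets M" using N by (simp add: null_sets_def)
    then have "N \<in> sets (F t)" using normal_filtrationD(2,3)[OF nf] t by blast
    then have *: "space M - N \<in> sets (F t)" using sets.compl_sets[of N "F t"] spF by simp
    have "W t \<in> borel_measurable (F t)" using bm t by (simp add: brownian_motion_def)
    then show "B t \<in> borel_measurable (F t)"
      unfolding B_def[abs_def] using t * by (intro measurable_If_set) (auto simp: spF Int_absorb2)
  next
    fix \<omega>
    show "continuous_on UNIV (\<lambda>t. B t \<omega>)"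
    proof (cases "\<omega> \<in> space M - N")
      case True
      then have "continuous_on {0..} (\<lambda>t. W t \<omega>)" using N(1) by auto
      then have "continuous_on UNIV (\<lambda>t. W (max 0 t) \<omega>)"
        by (rule continuous_on_compose2) (auto intro!: continuous_intros)
      then show ?thesis using True by (simp add: B_def)
    next
      case False
      then show ?thesis unfolding B_def by (simp del: Diff_iff)
    qed
  next
    have "AE \<omega> in M. \<omega> \<notin> N" using N by (intro AE_not_in) (simp add: null_sets_def)
    then show "AE \<omega> in M. \<forall>t\<ge>0. B t \<omega> = W t \<omega>"
      using AE_space by eventually_elim (simp add: B_def)
  qed
qed

locale continuous_adapted =
  fixes M :: "'w measure" and F :: "real \<Rightarrow> 'w measure" and B :: "real \<Rightarrow> 'w \<Rightarrow> real^'n"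
  assumes subalg: "0 \<le> t \<Longrightarrow> subalgebra M (F t)"
    and F_mono: "0 \<le> s \<Longrightarrow> s \<le> t \<Longrightarrow> sets (F s) \<subseteq> sets (F t)"
    and B_adapted: "0 \<le> t \<Longrightarrow> B t \<in> borel_measurable (F t)"
    and B_cont: "continuous_on UNIV (\<lambda>t. B t \<omega>)"
begin

lemma space_F: "0 \<le> t \<Longrightarrow> space (F t) = space M"
  using subalg by (simp add: subalgebra_def)

text \<open>\<open>fst X\<close> is a stopping time and \<open>X\<close> is measurable with respect to its \<open>\<sigma>\<close>-algebra.\<close>

definition stopped_state :: "('w \<Rightarrow> real \<times> (real^'n)) \<Rightarrow> bool" where
  "stopped_state X \<longleftrightarrow> (\<forall>\<omega>. 0 \<le> fst (X \<omega>)) \<and>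
     (\<forall>t\<ge>0. \<forall>A\<in>sets borel. {\<omega> \<in> space M. fst (X \<omega>) \<le> t \<and> X \<omega> \<in> A} \<in> sets (F t))"

text \<open>Makes \<open>X\<close> a random variable that is known at time \<open>t\<close>. The
  default has a time component beyond \<open>t\<close>, which marks the state as not yet
  reached.\<close>

definition stop_at :: "real \<Rightarrow> ('w \<Rightarrow> real \<times> (real^'n)) \<Rightarrow> 'w \<Rightarrow> real \<times> (real^'n)" where
  "stop_at t X \<omega> = (if fst (X \<omega>) \<le> t then X \<omega> else (t + 1, 0))"

lemma stop_at_measurable:
  assumes X: "stopped_state X" and t: "0 \<le> t"
  shows "stop_at t X \<in> borel_measurable (F t)"
proof (rule measurableI)
  fix A :: "(real \<times> (real^'n)) set" assume A: "A \<in> sets borel"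
  have *: "{\<omega> \<in> space M. fst (X \<omega>) \<le> t \<and> X \<omega> \<in> A'} \<in> sets (F t)" if "A' \<in> sets borel" for A'
    using X t that by (simp add: stopped_state_def)
  have "{\<omega> \<in> space M. fst (X \<omega>) \<le> t \<and> X \<omega> \<in> UNIV} \<in> sets (F t)" by (rule *) simp
  from sets.compl_sets[OF this]
  have "space M - {\<omega> \<in> space M. fst (X \<omega>) \<le> t \<and> X \<omega> \<in> UNIV} \<in> sets (F t)"
    unfolding space_F[OF t] .
  moreover have "stop_at t X -` A \<inter> space (F t) = {\<omega> \<in> space M. fst (X \<omega>) \<le> t \<and> X \<omega> \<in> A} \<union>
      (if (t + 1, 0) \<in> A then space M - {\<omega> \<in> space M. fst (X \<omega>) \<le> t \<and> X \<omega> \<in> UNIV} else {})"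
    using space_F[OF t] by (auto simp: stop_at_def split: if_splits)
  ultimately show "stop_at t X -` A \<inter> space (F t) \<in> sets (F t)"
    using *[OF A] by auto
qed simp

lemma stopped_state_measurable:
  assumes X: "stopped_state X"
  shows "X \<in> borel_measurable M"
proof (rule measurableI)
  fix A :: "(real \<times> (real^'n)) set" assume A: "A \<in> sets borel"
  have "{\<omega> \<in> space M. fst (X \<omega>) \<le> real k \<and> X \<omega> \<in> A} \<in> sets M" for k
    using X A subalg[of "real k"] by (auto simp: stopped_state_def subalgebra_def)
  then have "(\<Union>k. {\<omega> \<in> space M. fst (X \<omega>) \<le> real k \<and> X \<omega> \<in> A}) \<in> sets M" by blast
  also have "(\<Union>k. {\<omega> \<in> space M. fst (X \<omega>) \<le> real k \<and> X \<omega> \<in> A}) = X -` A \<inter> space M"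
    using real_arch_simple by auto
  finally show "X -` A \<inter> space M \<in> sets M" .
qed simp

lemma stopped_state_const: "0 \<le> t \<Longrightarrow> stopped_state (\<lambda>_. (t, x))"
  unfolding stopped_state_def using space_F sets.top[of "F _"] by (auto simp: space_F[symmetric] conj_commute)

text \<open>Clipping the random time to \<open>{0..t}\<close> leaves only the part of the path that
  is known at time \<open>t\<close>.\<close>

lemma frozen_measurable:
  assumes T: "T \<in> borel_measurable (F t)" and t: "0 \<le> t"
  shows "(\<lambda>\<omega>. B (min (max 0 (T \<omega>)) t) \<omega>) \<in> borel_measurable (F t)"
proof (rule borel_measurable_caratheodory[OF _ T])
  fix u
  define s where "s = min (max 0 u) t"
  have s: "0 \<le> s" "s \<le> t" using t by (auto simp: s_def)
  have "subalgebra (F t) (F s)"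
    using F_mono[OF s] space_F[OF s(1)] space_F[OF t] by (simp add: subalgebra_def)
  then show "B (min (max 0 u) t) \<in> borel_measurable (F t)"
    using B_adapted[OF s(1)] measurable_from_subalg unfolding s_def by blast
next
  fix \<omega>
  show "continuous_on UNIV (\<lambda>u. B (min (max 0 u) t) \<omega>)"
    by (rule continuous_on_compose2[OF B_cont]) (auto intro!: continuous_intros)
qed

lemma B_random_time_measurable:
  assumes T: "T \<in> borel_measurable M"
  shows "(\<lambda>\<omega>. B (max 0 (T \<omega>)) \<omega>) \<in> borel_measurable M"
proof (rule borel_measurable_caratheodory[OF _ T])
  fix u :: real
  show "B (max 0 u) \<in> borel_measurable M"
    by (rule measurable_from_subalg[OF subalg B_adapted]) simp_all
next
  fix \<omega>
  show "continuous_on UNIV (\<lambda>u. B (max 0 u) \<omega>)"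
    by (rule continuous_on_compose2[OF B_cont]) (auto intro!: continuous_intros)
qed

text \<open>If the new time is at most \<open>t\<close>, so is the old one, and the new state can be
  computed from \<open>stop_at t X\<close> and the path clipped at \<open>t\<close>. If the old time
  exceeds \<open>t\<close>, the default of \<open>stop_at\<close> also leads to a new time beyond
  \<open>t\<close>.\<close>

lemma stopped_state_step:
  assumes X: "stopped_state X"
    and h: "h \<in> borel_measurable borel" "\<And>y. 0 \<le> h y"
    and g: "case_prod g \<in> borel_measurable (borel \<Otimes>\<^sub>M borel)"
  shows "stopped_state (\<lambda>\<omega>. (fst (X \<omega>) + h (snd (X \<omega>)),
    g (snd (X \<omega>)) (B (fst (X \<omega>) + h (snd (X \<omega>))) \<omega> - B (fst (X \<omega>)) \<omega>)))" (is "stopped_state ?X'")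
  unfolding stopped_state_def
proof (intro conjI allI impI ballI)
  show "0 \<le> fst (?X' \<omega>)" for \<omega> using X h(2) by (simp add: stopped_state_def)
  fix t :: real and A :: "(real \<times> (real^'n)) set" assume t: "0 \<le> t" and A: "A \<in> sets borel"
  define Z where "Z = stop_at t X"
  define \<tau> where "\<tau> \<omega> = fst (Z \<omega>) + h (snd (Z \<omega>))" for \<omega>
  define Y where "Y \<omega> = g (snd (Z \<omega>)) (B (min (max 0 (\<tau> \<omega>)) t) \<omega> - B (min (max 0 (fst (Z \<omega>))) t) \<omega>)" for \<omega>
  have Z: "Z \<in> borel_measurable (F t)" unfolding Z_def by (rule stop_at_measurable[OF X t])
  then have [measurable]: "(\<lambda>\<omega>. fst (Z \<omega>)) \<in> borel_measurable (F t)" "(\<lambda>\<omega>. snd (Z \<omega>)) \<in> borel_measurable (F t)"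
    by (auto simp: borel_prod[symmetric])
  note h(1)[measurable]
  have \<tau>[measurable]: "\<tau> \<in> borel_measurable (F t)" unfolding \<tau>_def by measurable
  have [measurable]: "(\<lambda>\<omega>. B (min (max 0 (\<tau> \<omega>)) t) \<omega>) \<in> borel_measurable (F t)"
    "(\<lambda>\<omega>. B (min (max 0 (fst (Z \<omega>))) t) \<omega>) \<in> borel_measurable (F t)"
    by (rule frozen_measurable[OF _ t], measurable)+
  have Y[measurable]: "Y \<in> borel_measurable (F t)"
    unfolding Y_def by (rule measurable_compose[OF _ g, of "\<lambda>\<omega>. (_ \<omega>, _ \<omega>)", simplified]) measurable
  have "(\<lambda>\<omega>. (\<tau> \<omega>, Y \<omega>)) \<in> borel_measurable (F t)" by measurable
  then have "(\<lambda>\<omega>. (\<tau> \<omega>, Y \<omega>)) -` A \<inter> space (F t) \<in> sets (F t)" using A by (rule measurable_sets)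
  moreover have "\<tau> -` {..t} \<inter> space (F t) \<in> sets (F t)" by (rule measurable_sets[OF \<tau>]) simp
  moreover have "{\<omega> \<in> space M. fst (?X' \<omega>) \<le> t \<and> ?X' \<omega> \<in> A}
      = ((\<lambda>\<omega>. (\<tau> \<omega>, Y \<omega>)) -` A \<inter> space (F t)) \<inter> (\<tau> -` {..t} \<inter> space (F t))"
  proof -
    have "fst (?X' \<omega>) \<le> t \<and> ?X' \<omega> \<in> A \<longleftrightarrow> (\<tau> \<omega>, Y \<omega>) \<in> A \<and> \<tau> \<omega> \<le> t" for \<omega>
    proof (cases "fst (X \<omega>) \<le> t")
      case True
      then have Zw: "Z \<omega> = X \<omega>" by (simp add: Z_def stop_at_def)
      have \<tau>w: "\<tau> \<omega> = fst (?X' \<omega>)" by (simp add: \<tau>_def Zw)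
      have "Y \<omega> = snd (?X' \<omega>)" if "\<tau> \<omega> \<le> t"
        using that True X h(2)[of "snd (X \<omega>)"] by (simp add: Y_def Zw \<tau>_def stopped_state_def min_def max_def)
      then have "\<tau> \<omega> \<le> t \<Longrightarrow> (\<tau> \<omega>, Y \<omega>) = ?X' \<omega>" using \<tau>w by (simp add: prod_eq_iff)
      then show ?thesis using \<tau>w by metis
    next
      case False
      then have "t < fst (?X' \<omega>)" using h(2)[of "snd (X \<omega>)"] by simp
      moreover have "t < \<tau> \<omega>" using False h(2)[of 0] by (simp add: \<tau>_def Z_def stop_at_def)
      ultimately show ?thesis by simp
    qed
    then show ?thesis using space_F[OF t] by auto
  qed
  ultimately show "{\<omega> \<in> space M. fst (?X' \<omega>) \<le> t \<and> ?X' \<omega> \<in> A} \<in> sets (F t)" by auto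
qed

end

lemma borel_measurable_fst_snd [measurable]:
  "fst \<in> borel_measurable (borel :: ('a::second_countable_topology \<times> 'b::second_countable_topology) measure)"
  "snd \<in> borel_measurable (borel :: ('a::second_countable_topology \<times> 'b::second_countable_topology) measure)"
  by (auto simp: borel_prod[symmetric])

locale continuous_brownian = continuous_adapted M F B + prob_space M
  for M :: "'w measure" and F :: "real \<Rightarrow> 'w measure" and B :: "real \<Rightarrow> 'w \<Rightarrow> real^'n" +
  fixes W :: "real \<Rightarrow> 'w \<Rightarrow> real^'n"
  assumes bm: "brownian_motion M F W" and BW: "AE \<omega> in M. \<forall>t\<ge>0. B t \<omega> = W t \<omega>"
begin

text \<open>On one cell, given by the values \<open>j\<close> and \<open>l\<close>, the increment
  starts at the constant time \<open>s\<close> and has the constant length \<open>q\<close>.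
  Membership in the cell is known at time \<open>s\<close>, so ordinary independence is enough. The
  condition \<open>i_s\<close> keeps the default value of \<open>stop_at\<close> out of the
  cell.\<close>

lemma strong_markov_discrete:
  fixes i :: "real \<Rightarrow> nat" and k :: "real^'n \<Rightarrow> nat" and h q :: real
  assumes X: "stopped_state X"
    and \<phi>[measurable]: "case_prod \<phi> \<in> borel_measurable (borel \<Otimes>\<^sub>M borel)"
    and i[measurable]: "i \<in> measurable borel (count_space UNIV)" and k[measurable]: "k \<in> measurable borel (count_space UNIV)"
    and s: "0 \<le> s" "0 < q"
    and iX: "\<And>\<omega>. i (fst (X \<omega>)) = j \<Longrightarrow> fst (X \<omega>) \<le> s" and i_s: "i (s + 1) \<noteq> j"
  shows "(\<integral>\<^sup>+\<omega>. (if i (fst (X \<omega>)) = j \<and> k (snd (X \<omega>)) = l then \<phi> (X \<omega>) (B (s + q) \<omega> - B s \<omega>) else 0) \<partial>M)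
    = (\<integral>\<^sup>+\<omega>. (if i (fst (X \<omega>)) = j \<and> k (snd (X \<omega>)) = l then (\<integral>\<^sup>+z. \<phi> (X \<omega>) (sqrt q *\<^sub>R z) \<partial>std_gauss) else 0) \<partial>M)"
proof -
  define P where "P x \<longleftrightarrow> i (fst x) = j \<and> k (snd x) = l" for x
  define \<psi> where "\<psi> x v = (if P x then \<phi> x v else 0)" for x v
  have [measurable]: "Measurable.pred borel P" unfolding P_def by measurable
  have \<psi>: "case_prod \<psi> \<in> borel_measurable (borel \<Otimes>\<^sub>M borel)"
    unfolding \<psi>_def[abs_def] by measurable
  have stopP: "(if P (X \<omega>) then f \<omega> (X \<omega>) else 0) = (if P (stop_at s X \<omega>) then f \<omega> (stop_at s X \<omega>) else 0)"
    for \<omega> and f :: "_ \<Rightarrow> _ \<Rightarrow> ennreal"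
    using iX[of \<omega>] i_s by (auto simp: stop_at_def P_def)
  have "(\<integral>\<^sup>+\<omega>. (if P (X \<omega>) then \<phi> (X \<omega>) (B (s + q) \<omega> - B s \<omega>) else 0) \<partial>M)
      = (\<integral>\<^sup>+\<omega>. \<psi> (stop_at s X \<omega>) (W (s + q) \<omega> - W s \<omega>) \<partial>M)"
  proof (rule nn_integral_cong_AE, use BW in eventually_elim)
    fix \<omega> assume "\<forall>t\<ge>0. B t \<omega> = W t \<omega>"
    then have "B (s + q) \<omega> = W (s + q) \<omega>" "B s \<omega> = W s \<omega>" using s by simp_all
    then show "(if P (X \<omega>) then \<phi> (X \<omega>) (B (s + q) \<omega> - B s \<omega>) else 0) = \<psi> (stop_at s X \<omega>) (W (s + q) \<omega> - W s \<omega>)"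
      using stopP[of \<omega> "\<lambda>\<omega> x. \<phi> x (W (s + q) \<omega> - W s \<omega>)"] by (simp only: \<psi>_def)
  qed
  also have "\<dots> = (\<integral>\<^sup>+\<omega>. (\<integral>\<^sup>+z. \<psi> (stop_at s X \<omega>) (sqrt q *\<^sub>R z) \<partial>std_gauss) \<partial>M)"
    by (rule brownian_increment[OF prob_space_axioms bm subalg[OF s(1)] s stop_at_measurable[OF X s(1)] \<psi>])
  also have "\<dots> = (\<integral>\<^sup>+\<omega>. (if P (X \<omega>) then (\<integral>\<^sup>+z. \<phi> (X \<omega>) (sqrt q *\<^sub>R z) \<partial>std_gauss) else 0) \<partial>M)"
    by (intro nn_integral_cong) (simp add: \<psi>_def stopP[of _ "\<lambda>_ x. \<integral>\<^sup>+z. \<phi> x (sqrt q *\<^sub>R z) \<partial>std_gauss"])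
  finally show ?thesis by (simp add: P_def)
qed

text \<open>Start times are rounded up, so that the state is known when the rounded increment
  begins. Lengths are rounded down and raised by one grid unit, so that they are positive even where
  \<open>h\<close> vanishes. The countably many cells are summed through
  \<open>prod_encode\<close>.\<close>

lemma strong_markov_dyadic:
  fixes h :: "real^'n \<Rightarrow> real"
  assumes X: "stopped_state X" and h[measurable]: "h \<in> borel_measurable borel" and h0: "\<And>y. 0 \<le> h y"
    and \<phi>[measurable]: "case_prod \<phi> \<in> borel_measurable (borel \<Otimes>\<^sub>M borel)"
  defines "a \<equiv> \<lambda>m \<omega>. real_of_int \<lceil>2 ^ m * fst (X \<omega>)\<rceil> / 2 ^ m"
    and "b \<equiv> \<lambda>m \<omega>. real_of_int (\<lfloor>2 ^ m * h (snd (X \<omega>))\<rfloor> + 1) / 2 ^ m"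
  shows "(\<integral>\<^sup>+\<omega>. \<phi> (X \<omega>) (B (a m \<omega> + b m \<omega>) \<omega> - B (a m \<omega>) \<omega>) \<partial>M)
    = (\<integral>\<^sup>+\<omega>. (\<integral>\<^sup>+z. \<phi> (X \<omega>) (sqrt (b m \<omega>) *\<^sub>R z) \<partial>std_gauss) \<partial>M)"
proof -
  interpret G: prob_space "std_gauss :: (real^'n) measure" by (rule prob_space_std_gauss)
  note [measurable] = stopped_state_measurable[OF X]
  have X0: "0 \<le> fst (X \<omega>)" for \<omega> using X by (simp add: stopped_state_def)
  define i where "i t = nat \<lceil>2 ^ m * t\<rceil>" for t :: real
  define k where "k y = nat \<lfloor>2 ^ m * h y\<rfloor>" for y
  define g where "g \<omega> = prod_encode (i (fst (X \<omega>)), k (snd (X \<omega>)))" for \<omega>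
  have [measurable]: "i \<in> measurable borel (count_space UNIV)" "k \<in> measurable borel (count_space UNIV)"
    unfolding i_def[abs_def] k_def[abs_def] by measurable
  have [measurable]: "g \<in> measurable M (count_space UNIV)"
    unfolding g_def by measurable
  have ab: "a m \<omega> = real (i (fst (X \<omega>))) / 2 ^ m" "b m \<omega> = (real (k (snd (X \<omega>))) + 1) / 2 ^ m" for \<omega>
    using X0[of \<omega>] h0[of "snd (X \<omega>)"] by (simp_all add: a_def b_def i_def k_def)
  have ab0: "0 \<le> a m \<omega>" "0 \<le> b m \<omega>" for \<omega> unfolding ab by simp_all
  have [measurable]: "a m \<in> borel_measurable M" "b m \<in> borel_measurable M"
    unfolding a_def b_def by measurable
  have Bm: "(\<lambda>\<omega>. B (max 0 (a m \<omega> + b m \<omega>)) \<omega>) \<in> borel_measurable M" "(\<lambda>\<omega>. B (max 0 (a m \<omega>)) \<omega>) \<in> borel_measurable M"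
    by (rule B_random_time_measurable, measurable)+
  have [measurable]: "(\<lambda>\<omega>. B (a m \<omega> + b m \<omega>) \<omega>) \<in> borel_measurable M" "(\<lambda>\<omega>. B (a m \<omega>) \<omega>) \<in> borel_measurable M"
    using Bm ab0 by simp_all
  define f1 where "f1 \<omega> = \<phi> (X \<omega>) (B (a m \<omega> + b m \<omega>) \<omega> - B (a m \<omega>) \<omega>)" for \<omega>
  define f2 where "f2 \<omega> = (\<integral>\<^sup>+z. \<phi> (X \<omega>) (sqrt (b m \<omega>) *\<^sub>R z) \<partial>std_gauss)" for \<omega>
  have [measurable]: "f1 \<in> borel_measurable M" unfolding f1_def by measurable
  have [measurable]: "f2 \<in> borel_measurable M" unfolding f2_def by measurable
  have "(\<integral>\<^sup>+\<omega>. (if g \<omega> = p then f1 \<omega> else 0) \<partial>M) = (\<integral>\<^sup>+\<omega>. (if g \<omega> = p then f2 \<omega> else 0) \<partial>M)" for p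
  proof -
    obtain j l where p: "p = prod_encode (j, l)" by (metis prod_decode_inverse surj_pair)
    have g: "g \<omega> = p \<longleftrightarrow> i (fst (X \<omega>)) = j \<and> k (snd (X \<omega>)) = l" for \<omega>
      by (simp add: g_def p)
    define s q where "s = real j / 2 ^ m" and "q = (real l + 1) / 2 ^ m"
    have "(\<integral>\<^sup>+\<omega>. (if i (fst (X \<omega>)) = j \<and> k (snd (X \<omega>)) = l then \<phi> (X \<omega>) (B (s + q) \<omega> - B s \<omega>) else 0) \<partial>M)
      = (\<integral>\<^sup>+\<omega>. (if i (fst (X \<omega>)) = j \<and> k (snd (X \<omega>)) = l then (\<integral>\<^sup>+z. \<phi> (X \<omega>) (sqrt q *\<^sub>R z) \<partial>std_gauss) else 0) \<partial>M)"
    proof (rule strong_markov_discrete[OF X \<phi>])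
      show "fst (X \<omega>) \<le> s" if "i (fst (X \<omega>)) = j" for \<omega>
      proof -
        have "2 ^ m * fst (X \<omega>) \<le> real j" using that unfolding i_def by linarith
        then show ?thesis by (simp add: s_def field_simps)
      qed
      have "2 ^ m * (s + 1) = real j + 2 ^ m" by (simp add: s_def field_simps)
      then have "i (s + 1) = j + 2 ^ m"
        unfolding i_def by (metis ceiling_of_nat nat_int of_nat_add of_nat_numeral of_nat_power)
      then show "i (s + 1) \<noteq> j" by simp
    qed (auto simp: s_def q_def)
    then show ?thesis
      unfolding g f1_def f2_def ab s_def q_def by (simp cong: if_cong nn_integral_cong conj_cong) 
  qed
  then have "(\<integral>\<^sup>+\<omega>. f1 \<omega> \<partial>M) = (\<integral>\<^sup>+\<omega>. f2 \<omega> \<partial>M)"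
    by (subst (1 2) nn_integral_countable_partition[where g = g]) simp_all
  then show ?thesis by (simp add: f1_def f2_def)
qed

text \<open>The length of a step depends on the current state, so grid times are random and
  increments must be handled at stopping times. The dyadic identity passes to the limit by
  continuity of the paths and of \<open>\<phi> x\<close>. An upper bound on \<open>\<phi>\<close> is
  enough for domination, since \<open>ennreal\<close> sends negative values to 0.\<close>

lemma strong_markov:
  fixes \<phi> :: "real \<times> (real^'n) \<Rightarrow> real^'n \<Rightarrow> real"
  assumes X: "stopped_state X" and h[measurable]: "h \<in> borel_measurable borel" and h0: "\<And>y. 0 \<le> h y"
    and \<phi>[measurable]: "case_prod \<phi> \<in> borel_measurable (borel \<Otimes>\<^sub>M borel)"
    and bounded: "\<And>x v. \<phi> x v \<le> c" and cont: "\<And>x. continuous_on UNIV (\<phi> x)"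
  shows "(\<integral>\<^sup>+\<omega>. ennreal (\<phi> (X \<omega>) (B (fst (X \<omega>) + h (snd (X \<omega>))) \<omega> - B (fst (X \<omega>)) \<omega>)) \<partial>M)
    = (\<integral>\<^sup>+\<omega>. (\<integral>\<^sup>+z. ennreal (\<phi> (X \<omega>) (sqrt (h (snd (X \<omega>))) *\<^sub>R z)) \<partial>std_gauss) \<partial>M)"
proof -
  interpret G: prob_space "std_gauss :: (real^'n) measure" by (rule prob_space_std_gauss)
  note [measurable] = stopped_state_measurable[OF X]
  have X0: "0 \<le> fst (X \<omega>)" for \<omega> using X by (simp add: stopped_state_def)
  define a where "a m \<omega> = real_of_int \<lceil>2 ^ m * fst (X \<omega>)\<rceil> / 2 ^ m" for m :: nat and \<omega>
  define b where "b m \<omega> = real_of_int (\<lfloor>2 ^ m * h (snd (X \<omega>))\<rfloor> + 1) / 2 ^ m" for m :: nat and \<omega>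
  have a: "(\<lambda>m. a m \<omega>) \<longlonglongrightarrow> fst (X \<omega>)" for \<omega> unfolding a_def by (rule dyadic_tendsto) linarith
  have b: "(\<lambda>m. b m \<omega>) \<longlonglongrightarrow> h (snd (X \<omega>))" for \<omega> unfolding b_def by (rule dyadic_tendsto) linarith
  have ab0: "0 \<le> a m \<omega>" "0 \<le> b m \<omega>" for m \<omega>
  proof -
    have "0 \<le> 2 ^ m * fst (X \<omega>)" "0 \<le> 2 ^ m * h (snd (X \<omega>))" using X0 h0 by simp_all
    then have "0 \<le> \<lceil>2 ^ m * fst (X \<omega>)\<rceil>" "0 \<le> \<lfloor>2 ^ m * h (snd (X \<omega>))\<rfloor> + 1" by linarith+
    then show "0 \<le> a m \<omega>" "0 \<le> b m \<omega>" unfolding a_def b_def by (simp_all del: of_int_add)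
  qed
  have [measurable]: "a m \<in> borel_measurable M" "b m \<in> borel_measurable M" for m
    unfolding a_def b_def by measurable
  have Bm: "(\<lambda>\<omega>. B (max 0 (a m \<omega> + b m \<omega>)) \<omega>) \<in> borel_measurable M" "(\<lambda>\<omega>. B (max 0 (a m \<omega>)) \<omega>) \<in> borel_measurable M"
    "(\<lambda>\<omega>. B (max 0 (fst (X \<omega>) + h (snd (X \<omega>)))) \<omega>) \<in> borel_measurable M" "(\<lambda>\<omega>. B (max 0 (fst (X \<omega>))) \<omega>) \<in> borel_measurable M" for m
    by (rule B_random_time_measurable, measurable)+
  have [measurable]: "(\<lambda>\<omega>. B (a m \<omega> + b m \<omega>) \<omega>) \<in> borel_measurable M" "(\<lambda>\<omega>. B (a m \<omega>) \<omega>) \<in> borel_measurable M"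
    "(\<lambda>\<omega>. B (fst (X \<omega>) + h (snd (X \<omega>))) \<omega>) \<in> borel_measurable M" "(\<lambda>\<omega>. B (fst (X \<omega>)) \<omega>) \<in> borel_measurable M" for m
    using Bm(1,2)[of m] Bm(3,4) ab0 X0 h0 by simp_all
  have Bt: "(\<lambda>m. B (t m) \<omega>) \<longlonglongrightarrow> B t' \<omega>" if "t \<longlonglongrightarrow> t'" for t t' \<omega>
    using continuous_on_tendsto_compose[OF B_cont that] by simp
  have \<phi>t: "(\<lambda>m. ennreal (\<phi> x (v m))) \<longlonglongrightarrow> ennreal (\<phi> x v')" if "v \<longlonglongrightarrow> v'" for x v v'
    using continuous_on_tendsto_compose[OF cont that] by (intro tendsto_ennrealI) simp
  have le: "ennreal (\<phi> x v) \<le> ennreal c" for x v using bounded by (rule ennreal_leI)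
  have conv: "(\<lambda>m. ennreal (\<phi> (X \<omega>) (B (a m \<omega> + b m \<omega>) \<omega> - B (a m \<omega>) \<omega>)))
      \<longlonglongrightarrow> ennreal (\<phi> (X \<omega>) (B (fst (X \<omega>) + h (snd (X \<omega>))) \<omega> - B (fst (X \<omega>)) \<omega>))"
    "(\<lambda>m. ennreal (\<phi> (X \<omega>) (sqrt (b m \<omega>) *\<^sub>R z))) \<longlonglongrightarrow> ennreal (\<phi> (X \<omega>) (sqrt (h (snd (X \<omega>))) *\<^sub>R z))" for \<omega> z
    by (intro \<phi>t tendsto_diff Bt tendsto_add a b tendsto_scaleR tendsto_const tendsto_real_sqrt)+
  have "(\<lambda>m. \<integral>\<^sup>+\<omega>. ennreal (\<phi> (X \<omega>) (B (a m \<omega> + b m \<omega>) \<omega> - B (a m \<omega>) \<omega>)) \<partial>M)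
    \<longlonglongrightarrow> (\<integral>\<^sup>+\<omega>. ennreal (\<phi> (X \<omega>) (B (fst (X \<omega>) + h (snd (X \<omega>))) \<omega> - B (fst (X \<omega>)) \<omega>)) \<partial>M)"
    by (rule nn_integral_dominated_convergence[where w = "\<lambda>_. ennreal c"])
      (auto intro!: AE_I2 le conv simp: emeasure_space_1)
  moreover have "(\<lambda>m. \<integral>\<^sup>+\<omega>. (\<integral>\<^sup>+z. ennreal (\<phi> (X \<omega>) (sqrt (b m \<omega>) *\<^sub>R z)) \<partial>std_gauss) \<partial>M)
    \<longlonglongrightarrow> (\<integral>\<^sup>+\<omega>. (\<integral>\<^sup>+z. ennreal (\<phi> (X \<omega>) (sqrt (h (snd (X \<omega>))) *\<^sub>R z)) \<partial>std_gauss) \<partial>M)"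
  proof (rule nn_integral_dominated_convergence[where w = "\<lambda>_. ennreal c"])
    show "AE \<omega> in M. (\<integral>\<^sup>+z. ennreal (\<phi> (X \<omega>) (sqrt (b m \<omega>) *\<^sub>R z)) \<partial>std_gauss) \<le> ennreal c" for m
    proof (rule AE_I2)
      fix \<omega>
      have "(\<integral>\<^sup>+z. ennreal (\<phi> (X \<omega>) (sqrt (b m \<omega>) *\<^sub>R z)) \<partial>std_gauss) \<le> (\<integral>\<^sup>+z. ennreal c \<partial>(std_gauss :: (real^'n) measure))"
        by (intro nn_integral_mono le)
      then show "(\<integral>\<^sup>+z. ennreal (\<phi> (X \<omega>) (sqrt (b m \<omega>) *\<^sub>R z)) \<partial>std_gauss) \<le> ennreal c"
        using G.emeasure_space_1 by simp
    qed
    show "AE \<omega> in M. (\<lambda>m. \<integral>\<^sup>+z. ennreal (\<phi> (X \<omega>) (sqrt (b m \<omega>) *\<^sub>R z)) \<partial>std_gauss)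
      \<longlonglongrightarrow> (\<integral>\<^sup>+z. ennreal (\<phi> (X \<omega>) (sqrt (h (snd (X \<omega>))) *\<^sub>R z)) \<partial>std_gauss)"
    proof (rule AE_I2)
      fix \<omega>
      have [measurable]: "\<phi> (X \<omega>) \<in> borel_measurable borel"
        using cont by (rule borel_measurable_continuous_onI)
      show "(\<lambda>m. \<integral>\<^sup>+z. ennreal (\<phi> (X \<omega>) (sqrt (b m \<omega>) *\<^sub>R z)) \<partial>std_gauss)
        \<longlonglongrightarrow> (\<integral>\<^sup>+z. ennreal (\<phi> (X \<omega>) (sqrt (h (snd (X \<omega>))) *\<^sub>R z)) \<partial>std_gauss)"
        by (rule nn_integral_dominated_convergence[where w = "\<lambda>_. ennreal c"])
          (use G.emeasure_space_1 in \<open>auto intro!: AE_I2 le conv\<close>)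
    qed
    show "(\<integral>\<^sup>+\<omega>. ennreal c \<partial>M) < \<infinity>" by (simp add: emeasure_space_1)
  qed measurable
  moreover have "(\<integral>\<^sup>+\<omega>. ennreal (\<phi> (X \<omega>) (B (a m \<omega> + b m \<omega>) \<omega> - B (a m \<omega>) \<omega>)) \<partial>M)
      = (\<integral>\<^sup>+\<omega>. (\<integral>\<^sup>+z. ennreal (\<phi> (X \<omega>) (sqrt (b m \<omega>) *\<^sub>R z)) \<partial>std_gauss) \<partial>M)" for m
    unfolding a_def b_def by (rule strong_markov_dyadic[OF X h h0]) measurable
  ultimately show ?thesis using LIMSEQ_unique by simp
qed

end

subsection \<open>The expected number of steps\<close>

lemma adaptive_EM_nonneg:
  assumes "\<And>y. 0 \<le> h y"
  shows "0 \<le> fst (adaptive_EM \<mu> \<sigma> h x w k)"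
  using assms by (induction k) (auto simp: case_prod_unfold Let_def)

lemma adaptive_EM_cong:
  assumes "\<And>y. 0 \<le> h y" and "\<And>t. 0 \<le> t \<Longrightarrow> w t = w' t"
  shows "adaptive_EM \<mu> \<sigma> h x w k = adaptive_EM \<mu> \<sigma> h x w' k"
proof (induction k)
  case (Suc k)
  have "0 \<le> fst (adaptive_EM \<mu> \<sigma> h x w' k)" by (rule adaptive_EM_nonneg[OF assms(1)])
  then show ?case
    using Suc assms by (simp add: case_prod_unfold Let_def)
qed simp

text \<open>Each index before the first one whose time is at least \<open>T\<close> contributes 1.
  If there is no such index, the infimum is taken over the empty set and equals infinity, and so
  does the sum.\<close>

lemma num_steps_le_suminf:
  "num_steps \<mu> \<sigma> h x T w \<le> (\<Sum>k. if fst (adaptive_EM \<mu> \<sigma> h x w k) < T then 1 else 0)"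
    (is "_ \<le> suminf ?f")
proof (cases "\<exists>k. T \<le> fst (adaptive_EM \<mu> \<sigma> h x w k)")
  case True
  define k where "k = (LEAST k. T \<le> fst (adaptive_EM \<mu> \<sigma> h x w k))"
  have k: "T \<le> fst (adaptive_EM \<mu> \<sigma> h x w k)" unfolding k_def using True by (rule LeastI_ex)
  have "?f i = 1" if "i < k" for i
    using not_less_Least[OF that[unfolded k_def]] by simp
  then have "(\<Sum>i<k. ?f i) = of_nat k" by simp
  moreover have "(\<Sum>i<k. ?f i) \<le> suminf ?f" by (rule sum_le_suminf) auto
  moreover have "num_steps \<mu> \<sigma> h x T w \<le> of_nat k"
    unfolding num_steps_def using k by (intro INF_lower) simp
  ultimately show ?thesis by simp
next
  case False
  then have f: "?f k = 1" for k by (simp add: not_le)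
  have "of_nat n \<le> suminf ?f" for n
  proof -
    have "(\<Sum>i<n. ?f i) \<le> suminf ?f" by (rule sum_le_suminf) auto
    then show ?thesis unfolding f by simp
  qed
  then have "suminf ?f = \<infinity>" by (metis ennreal_SUP_of_nat_eq_top SUP_least top.extremum_unique infinity_ennreal_def)
  then show ?thesis by simp
qed

context continuous_brownian
begin

text \<open>The Lyapunov function \<open>V\<close> is set to 0 once the time has reached
  \<open>T\<close>. Killing can only lower it, so each step that starts before \<open>T\<close>
  still costs \<open>c\<close> in expectation, and these costs telescope against the initial
  value.\<close>

lemma expected_num_steps_le:
  fixes Q :: "real^'n \<Rightarrow> real" and h :: "real^'n \<Rightarrow> real"
  assumes \<mu>[measurable]: "\<mu> \<in> borel_measurable borel" and \<sigma>[measurable]: "\<sigma> \<in> borel_measurable borel"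
    and h[measurable]: "h \<in> borel_measurable borel" and h01: "\<And>y. 0 \<le> h y" "\<And>y. h y \<le> 1"
    and Q: "continuous_on UNIV Q" "\<And>y. 0 \<le> Q y" "\<And>y. Q y \<le> q" and C: "0 \<le> C" and c: "0 < c" and T: "0 \<le> T"
    and step: "\<And>y. (\<integral>z. Q (y + h y *\<^sub>R \<mu> y + sqrt (h y) *\<^sub>R (\<sigma> y *v z)) \<partial>std_gauss) \<le> Q y + C * h y - c"
  shows "(\<integral>\<^sup>+\<omega>. num_steps \<mu> \<sigma> h x T (\<lambda>t. W t \<omega>) \<partial>M) \<le> ennreal ((C * (T + 1) + q) / c)"
proof -
  interpret G: prob_space "std_gauss :: (real^'n) measure" by (rule prob_space_std_gauss)
  define X where "X k \<omega> = adaptive_EM \<mu> \<sigma> h x (\<lambda>t. B t \<omega>) k" for k \<omega>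
  define g where "g y v = y + h y *\<^sub>R \<mu> y + \<sigma> y *v v" for y v
  have [measurable]: "Q \<in> borel_measurable borel" using Q(1) by (rule borel_measurable_continuous_onI)
  have g[measurable]: "case_prod g \<in> borel_measurable (borel \<Otimes>\<^sub>M borel)"
    unfolding g_def[abs_def] by measurable
  have XS: "X (Suc k) \<omega> = (fst (X k \<omega>) + h (snd (X k \<omega>)),
      g (snd (X k \<omega>)) (B (fst (X k \<omega>) + h (snd (X k \<omega>))) \<omega> - B (fst (X k \<omega>)) \<omega>))" for k \<omega>
    by (simp add: X_def g_def case_prod_unfold Let_def)
  have st: "stopped_state (X k)" for k
  proof (induction k)
    case 0
    then show ?case using stopped_state_const[of 0 x] by (simp add: X_def)
  next
    case (Suc k)
    show ?case
      using stopped_state_step[OF Suc h h01(1) g] unfolding XS[abs_def, symmetric] by (simp add: XS[abs_def])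
  qed
  note [measurable] = stopped_state_measurable[OF st]
  have X0: "0 \<le> fst (X k \<omega>)" for k \<omega> using st by (simp add: stopped_state_def)
  \<comment> \<open>With \<open>T + 1\<close> in place of \<open>T\<close> the time term stays
    nonnegative at the end of a step that starts before \<open>T\<close>, because
    \<open>h \<le> 1\<close>.\<close>
  define V where "V x = (if fst x < T then ennreal (C * (T + 1 - fst x) + Q (snd x)) else 0)" for x
  define I where "I x = (if fst x < T then 1 else 0 :: ennreal)" for x :: "real \<times> (real^'n)"
  \<comment> \<open>The value after the step, before killing. The condition
    \<open>0 \<le> fst x\<close> makes it bounded above for every pair \<open>x\<close>, as
    \<open>strong_markov\<close> demands.\<close>
  define \<phi> where "\<phi> x v = (if 0 \<le> fst x \<and> fst x < T then C * (T + 1 - (fst x + h (snd x))) + Q (g (snd x) v) else 0)" for x v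
  have [measurable]: "V \<in> borel_measurable borel" "I \<in> borel_measurable borel"
    unfolding V_def[abs_def] I_def[abs_def] by measurable
  have \<phi>m[measurable]: "case_prod \<phi> \<in> borel_measurable (borel \<Otimes>\<^sub>M borel)"
    unfolding \<phi>_def[abs_def] by measurable
  have \<phi>b: "\<phi> x v \<le> C * (T + 1) + q" for x v
  proof (cases "0 \<le> fst x \<and> fst x < T")
    case True
    then have "C * (T + 1 - (fst x + h (snd x))) \<le> C * (T + 1)"
      using C h01(1)[of "snd x"] by (intro mult_left_mono) auto
    then show ?thesis using True Q(3)[of "g (snd x) v"] by (simp add: \<phi>_def)
  next
    case False
    have "0 \<le> q" using Q(2,3) order_trans by blast
    moreover have "\<phi> x v = 0" unfolding \<phi>_def using False by (rule if_not_P)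
    ultimately show ?thesis using C T by simp
  qed
  have \<phi>c: "continuous_on UNIV (\<phi> x)" for x
  proof (cases "0 \<le> fst x \<and> fst x < T")
    case True
    have "continuous_on UNIV (\<lambda>v. Q (g (snd x) v))"
      unfolding g_def
      by (rule continuous_on_compose2[OF Q(1)])
        (auto intro!: continuous_intros)
    then show ?thesis using True unfolding \<phi>_def[abs_def] by (auto intro!: continuous_intros)
  next
    case False
    then have "\<phi> x = (\<lambda>_. 0)" by (auto simp: \<phi>_def)
    then show ?thesis by simp
  qed
  have one: "(\<integral>\<^sup>+z. ennreal (\<phi> x (sqrt (h (snd x)) *\<^sub>R z)) \<partial>std_gauss) + ennreal c * I x \<le> V x"
    if x: "0 \<le> fst x" for x
  proof (cases "fst x < T")
    case True
    define r y where "r = C * (T + 1 - (fst x + h (snd x)))" and "y = snd x"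
    have r: "0 \<le> r" using True C h01(2)[of "snd x"] by (simp add: r_def)
    define f where "f z = Q (y + h y *\<^sub>R \<mu> y + sqrt (h y) *\<^sub>R (\<sigma> y *v z))" for z
    have f0: "0 \<le> f z" for z unfolding f_def by (rule Q(2))
    have fi: "integrable std_gauss f"
      unfolding f_def using Q(2,3) by (intro G.integrable_const_bound[where B = q]) auto
    have "\<phi> x (sqrt (h (snd x)) *\<^sub>R z) = r + f z" for z
      using True x by (simp add: \<phi>_def r_def f_def g_def y_def matrix_vector_mult_scaleR)
    then have "(\<integral>\<^sup>+z. ennreal (\<phi> x (sqrt (h (snd x)) *\<^sub>R z)) \<partial>std_gauss) = (\<integral>\<^sup>+z. ennreal (r + f z) \<partial>std_gauss)"
      by simp
    also have "\<dots> = ennreal (\<integral>z. r + f z \<partial>std_gauss)"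
      using fi r f0 by (intro nn_integral_eq_integral) auto
    also have "(\<integral>z. r + f z \<partial>std_gauss) = r + (\<integral>z. f z \<partial>std_gauss)"
      using fi G.prob_space by simp
    finally have "(\<integral>\<^sup>+z. ennreal (\<phi> x (sqrt (h (snd x)) *\<^sub>R z)) \<partial>std_gauss) + ennreal c * I x
        = ennreal (r + (\<integral>z. f z \<partial>std_gauss) + c)"
      using True r c f0 by (simp add: I_def ennreal_plus[symmetric] del: ennreal_plus)
    also have "\<dots> \<le> ennreal (C * (T + 1 - fst x) + Q y)"
      using step[of y] by (intro ennreal_leI) (simp add: r_def f_def y_def algebra_simps)
    finally show ?thesis using True by (simp add: V_def y_def)
  next
    case False
    then show ?thesis by (simp add: \<phi>_def I_def)
  qed
  have ind: "(\<integral>\<^sup>+\<omega>. V (X (Suc k) \<omega>) \<partial>M) + (\<integral>\<^sup>+\<omega>. ennreal c * I (X k \<omega>) \<partial>M) \<le> (\<integral>\<^sup>+\<omega>. V (X k \<omega>) \<partial>M)" for k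
  proof -
    have "(\<integral>\<^sup>+\<omega>. V (X (Suc k) \<omega>) \<partial>M)
        \<le> (\<integral>\<^sup>+\<omega>. ennreal (\<phi> (X k \<omega>) (B (fst (X k \<omega>) + h (snd (X k \<omega>))) \<omega> - B (fst (X k \<omega>)) \<omega>)) \<partial>M)"
    proof (rule nn_integral_mono)
      fix \<omega>
      show "V (X (Suc k) \<omega>) \<le> ennreal (\<phi> (X k \<omega>) (B (fst (X k \<omega>) + h (snd (X k \<omega>))) \<omega> - B (fst (X k \<omega>)) \<omega>))"
        using X0[of k \<omega>] h01(1)[of "snd (X k \<omega>)"] by (simp add: V_def XS \<phi>_def)
    qed
    also have "\<dots> = (\<integral>\<^sup>+\<omega>. (\<integral>\<^sup>+z. ennreal (\<phi> (X k \<omega>) (sqrt (h (snd (X k \<omega>))) *\<^sub>R z)) \<partial>std_gauss) \<partial>M)"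
      by (rule strong_markov[OF st h h01(1) \<phi>m \<phi>b \<phi>c])
    finally have "(\<integral>\<^sup>+\<omega>. V (X (Suc k) \<omega>) \<partial>M) + (\<integral>\<^sup>+\<omega>. ennreal c * I (X k \<omega>) \<partial>M)
        \<le> (\<integral>\<^sup>+\<omega>. (\<integral>\<^sup>+z. ennreal (\<phi> (X k \<omega>) (sqrt (h (snd (X k \<omega>))) *\<^sub>R z)) \<partial>std_gauss) \<partial>M) + (\<integral>\<^sup>+\<omega>. ennreal c * I (X k \<omega>) \<partial>M)"
      by (rule add_right_mono)
    also have "\<dots> = (\<integral>\<^sup>+\<omega>. (\<integral>\<^sup>+z. ennreal (\<phi> (X k \<omega>) (sqrt (h (snd (X k \<omega>))) *\<^sub>R z)) \<partial>std_gauss) + ennreal c * I (X k \<omega>) \<partial>M)"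
      by (intro nn_integral_add[symmetric]; measurable)
    also have "\<dots> \<le> (\<integral>\<^sup>+\<omega>. V (X k \<omega>) \<partial>M)"
      using one X0 by (intro nn_integral_mono) blast
    finally show ?thesis .
  qed
  have sum_V: "(\<Sum>k<n. \<integral>\<^sup>+\<omega>. ennreal c * I (X k \<omega>) \<partial>M) + (\<integral>\<^sup>+\<omega>. V (X n \<omega>) \<partial>M) \<le> (\<integral>\<^sup>+\<omega>. V (X 0 \<omega>) \<partial>M)" for n
  proof (induction n)
    case (Suc n)
    have "(\<Sum>k<Suc n. \<integral>\<^sup>+\<omega>. ennreal c * I (X k \<omega>) \<partial>M) + (\<integral>\<^sup>+\<omega>. V (X (Suc n) \<omega>) \<partial>M)
        = (\<Sum>k<n. \<integral>\<^sup>+\<omega>. ennreal c * I (X k \<omega>) \<partial>M) + ((\<integral>\<^sup>+\<omega>. V (X (Suc n) \<omega>) \<partial>M) + (\<integral>\<^sup>+\<omega>. ennreal c * I (X n \<omega>) \<partial>M))"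
      by (simp add: ac_simps)
    also have "\<dots> \<le> (\<Sum>k<n. \<integral>\<^sup>+\<omega>. ennreal c * I (X k \<omega>) \<partial>M) + (\<integral>\<^sup>+\<omega>. V (X n \<omega>) \<partial>M)"
      by (intro add_left_mono ind)
    finally show ?case using Suc by (rule order_trans)
  qed simp
  have part: "(\<Sum>k<n. \<integral>\<^sup>+\<omega>. ennreal c * I (X k \<omega>) \<partial>M) \<le> (\<integral>\<^sup>+\<omega>. V (X 0 \<omega>) \<partial>M)" for n
    by (rule order_trans[OF _ sum_V[of n]]) simp
  have "V (X 0 \<omega>) \<le> ennreal (C * (T + 1) + q)" for \<omega>
    using Q(3)[of x] by (auto simp: V_def X_def intro: ennreal_leI)
  then have V0: "(\<integral>\<^sup>+\<omega>. V (X 0 \<omega>) \<partial>M) \<le> ennreal (C * (T + 1) + q)"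
    using nn_integral_mono[of M "\<lambda>\<omega>. V (X 0 \<omega>)" "\<lambda>_. ennreal (C * (T + 1) + q)"] emeasure_space_1 by simp
  have "(\<Sum>k. \<integral>\<^sup>+\<omega>. ennreal c * I (X k \<omega>) \<partial>M) \<le> ennreal (C * (T + 1) + q)"
    using order_trans[OF part V0] by (intro suminf_le_const) auto
  also have "(\<Sum>k. \<integral>\<^sup>+\<omega>. ennreal c * I (X k \<omega>) \<partial>M) = (\<integral>\<^sup>+\<omega>. (\<Sum>k. ennreal c * I (X k \<omega>)) \<partial>M)"
    by (intro nn_integral_suminf[symmetric]) measurable
  also have "\<dots> = ennreal c * (\<integral>\<^sup>+\<omega>. (\<Sum>k. I (X k \<omega>)) \<partial>M)"
    by (simp add: ennreal_suminf_cmult nn_integral_cmult)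
  finally have "ennreal c * (\<integral>\<^sup>+\<omega>. (\<Sum>k. I (X k \<omega>)) \<partial>M) \<le> ennreal (C * (T + 1) + q)" .
  then have "ennreal (1 / c) * (ennreal c * (\<integral>\<^sup>+\<omega>. (\<Sum>k. I (X k \<omega>)) \<partial>M)) \<le> ennreal (1 / c) * ennreal (C * (T + 1) + q)"
    by (rule mult_left_mono) simp
  then have fin: "(\<integral>\<^sup>+\<omega>. (\<Sum>k. I (X k \<omega>)) \<partial>M) \<le> ennreal ((C * (T + 1) + q) / c)"
    using c by (simp add: mult.assoc[symmetric] ennreal_mult'[symmetric])
  have "(\<integral>\<^sup>+\<omega>. num_steps \<mu> \<sigma> h x T (\<lambda>t. W t \<omega>) \<partial>M) \<le> (\<integral>\<^sup>+\<omega>. (\<Sum>k. I (X k \<omega>)) \<partial>M)"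
  proof (rule nn_integral_mono_AE, use BW in eventually_elim)
    fix \<omega> assume BW': "\<forall>t\<ge>0. B t \<omega> = W t \<omega>"
    have "adaptive_EM \<mu> \<sigma> h x (\<lambda>t. W t \<omega>) k = X k \<omega>" for k
      unfolding X_def using BW' by (intro adaptive_EM_cong h01) auto
    then show "num_steps \<mu> \<sigma> h x T (\<lambda>t. W t \<omega>) \<le> (\<Sum>k. I (X k \<omega>))"
      using num_steps_le_suminf[of \<mu> \<sigma> h x T "\<lambda>t. W t \<omega>"] by (simp add: I_def)
  qed
  then show ?thesis using fin by (rule order_trans)
qed

end

section \<open>Linear growth and regularity of the coefficients\<close>

lemma path_length_linepath_le:
  fixes x y :: "'a::real_normed_vector"
  shows "path_length (linepath x y) \<le> ennreal (dist x y)"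
  unfolding path_length_def
proof (rule SUP_least, clarify)
  fix m :: nat and t :: "nat \<Rightarrow> real"
  assume t: "t ` {..m} \<subseteq> {0..1}" "mono_on {..m} t"
  have d: "dist (linepath x y a) (linepath x y b) = \<bar>a - b\<bar> * dist x y" for a b
  proof -
    have "linepath x y a - linepath x y b = (b - a) *\<^sub>R (x - y)"
      by (simp add: linepath_def algebra_simps)
    then show ?thesis by (simp add: dist_norm abs_minus_commute)
  qed
  have "(\<Sum>i<m. dist (linepath x y (t i)) (linepath x y (t (Suc i)))) = (\<Sum>i<m. (t (Suc i) - t i) * dist x y)"
    using t(2) by (intro sum.cong) (auto simp: d mono_on_def)
  also have "\<dots> = (t m - t 0) * dist x y"
    by (simp add: sum_distrib_right[symmetric] sum_lessThan_telescope)
  also have "\<dots> \<le> 1 * dist x y"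
  proof (rule mult_right_mono)
    have "t m \<in> {0..1}" "t 0 \<in> {0..1}" using t(1) by auto
    then show "t m - t 0 \<le> 1" by simp
  qed simp
  finally show "(\<Sum>i<m. ennreal (dist (linepath x y (t i)) (linepath x y (t (Suc i))))) \<le> ennreal (dist x y)"
    by (simp add: sum_ennreal ennreal_leI)
qed

text \<open>A segment that misses \<Theta> is an admissible curve, so the intrinsic distance of its
  ends is at most the Euclidean one.\<close>

lemma exceptional_set_segment_lipschitz:
  assumes "exceptional_set f \<Theta>"
  obtains L where "0 < L" "\<And>x y. closed_segment x y \<inter> \<Theta> = {} \<Longrightarrow> norm (f x - f y) \<le> L * dist x y"
proof -
  obtain L where L: "0 < L" "\<forall>x\<in>-\<Theta>. \<forall>y\<in>-\<Theta>.
      ennreal (norm (f x - f y)) \<le> ennreal L * intrinsic_metric (-\<Theta>) x y"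
    using assms by (auto simp: exceptional_set_def)
  have "norm (f x - f y) \<le> L * dist x y" if xy: "closed_segment x y \<inter> \<Theta> = {}" for x y
  proof -
    have "intrinsic_metric (-\<Theta>) x y \<le> path_length (linepath x y)"
      unfolding intrinsic_metric_def using xy by (intro INF_lower) auto
    also have "\<dots> \<le> ennreal (dist x y)" by (rule path_length_linepath_le)
    finally have "ennreal L * intrinsic_metric (-\<Theta>) x y \<le> ennreal L * ennreal (dist x y)"
      by (rule mult_left_mono) simp
    moreover have "x \<in> -\<Theta>" "y \<in> -\<Theta>" using xy ends_in_segment[of x y] by blast+
    ultimately have "ennreal (norm (f x - f y)) \<le> ennreal L * ennreal (dist x y)"
      using L(2)[rule_format, of x y] by (elim order_trans[rotated]) auto
    then have "ennreal (norm (f x - f y)) \<le> ennreal (L * dist x y)"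
      using L(1) by (simp add: ennreal_mult)
    then show ?thesis using L(1) by (simp add: ennreal_le_iff)
  qed
  then show ?thesis using that L(1) by blast
qed

text \<open>From a point outside the tube one walks straight towards a nearest point
  \<open>p\<close> and stops inside the tube before reaching \<open>p\<close>. All points passed are
  strictly closer to \<open>y\<close> than \<Theta> is, so this segment misses \<Theta>.\<close>

lemma linear_growth_off_tube:
  fixes \<Theta> :: "'a::euclidean_space set" and f :: "'a \<Rightarrow> real"
  assumes \<Theta>: "closed \<Theta>" "\<Theta> \<noteq> {}" and e: "0 < e" and BL: "0 \<le> B" "0 \<le> L"
    and B: "\<And>y. infdist y \<Theta> < e \<Longrightarrow> f y \<le> B"
    and L: "\<And>x y. closed_segment x y \<inter> \<Theta> = {} \<Longrightarrow> f y \<le> f x + L * dist x y"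
  shows "f y \<le> (B + L) * (1 + infdist y \<Theta>)"
proof -
  define d where "d = infdist y \<Theta>"
  have d0: "0 \<le> d" by (simp add: d_def infdist_nonneg)
  have "f y \<le> B + L * d"
  proof (cases "d < e")
    case True
    then have "f y \<le> B" using B by (simp add: d_def)
    moreover have "0 \<le> L * d" using BL d0 by simp
    ultimately show ?thesis by linarith
  next
    case False
    then have d: "0 < d" "e \<le> d" using e by auto
    obtain p where p: "p \<in> \<Theta>" "infdist y \<Theta> = dist y p"
      using infdist_attains_inf[OF \<Theta>] by blast
    have np: "norm (y - p) = d" using p by (simp add: d_def dist_norm)
    \<comment> \<open>Places \<open>x\<close> at distance \<open>e / 2\<close> from
      \<open>p\<close>.\<close>
    define s0 where "s0 = e / 2 / d"
    have s0: "0 < s0" "s0 \<le> 1" "s0 * d = e / 2" using d e by (auto simp: s0_def field_simps)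
    define x where "x = p + s0 *\<^sub>R (y - p)"
    have "infdist x \<Theta> \<le> dist x p" by (rule infdist_le[OF p(1)])
    also have "\<dots> < e" using s0 np e by (simp add: x_def dist_norm)
    finally have fx: "f x \<le> B" by (rule B)
    have "w \<notin> \<Theta>" if w: "w \<in> closed_segment x y" for w
    proof
      assume "w \<in> \<Theta>"
      obtain u where u: "0 \<le> u" "u \<le> 1" "w = (1 - u) *\<^sub>R x + u *\<^sub>R y"
        using w by (auto simp: in_segment)
      define s where "s = (1 - u) * s0 + u"
      have "0 < s"
      proof (cases "u = 1")
        case False
        then have "0 < (1 - u) * s0" using u s0 by simp
        then show ?thesis using u by (simp add: s_def)
      qed (simp add: s_def)
      have "(1 - u) * s0 \<le> (1 - u) * 1" using u s0 by (intro mult_left_mono) auto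
      then have "s \<le> 1" by (simp add: s_def)
      have "y - w = (1 - s) *\<^sub>R (y - p)" by (simp add: u(3) x_def s_def algebra_simps)
      then have "dist y w = (1 - s) * d" using \<open>s \<le> 1\<close> np by (simp add: dist_norm)
      also have "\<dots> < d" using \<open>0 < s\<close> d by (simp add: algebra_simps)
      finally show False using infdist_le[OF \<open>w \<in> \<Theta>\<close>, of y] by (simp add: d_def)
    qed
    then have "f y \<le> f x + L * dist x y" by (intro L) auto
    moreover have "dist x y = (1 - s0) * d"
    proof -
      have "y - x = (1 - s0) *\<^sub>R (y - p)" by (simp add: x_def algebra_simps)
      then show ?thesis using s0 np by (simp add: dist_norm norm_minus_commute[of x y])
    qed
    moreover have "L * ((1 - s0) * d) \<le> L * d" using BL s0 d by (intro mult_left_mono) (auto simp: mult_le_cancel_right1)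
    ultimately show ?thesis using fx by simp
  qed
  also have "\<dots> \<le> (B + L) * (1 + d)" using BL d0 by (simp add: algebra_simps)
  finally show ?thesis by (simp add: d_def)
qed

lemma reach_pos_imp_closed:
  assumes "ennreal r < reach \<Theta>"
  shows "closed \<Theta>"
  using assms unique_closest_point_imp_closed by (auto simp: reach_def less_SUP_iff)

lemma compatible_matrix_normD:
  assumes "compatible_matrix_norm nm"
  shows "0 \<le> nm A" "norm (A *v v) \<le> nm A * norm v" "nm A \<le> nm B + nm (A - B)"
proof -
  show "0 \<le> nm A" "norm (A *v v) \<le> nm A * norm v" using assms by (auto simp: compatible_matrix_norm_def)
  have "nm (B + (A - B)) \<le> nm B + nm (A - B)" using assms unfolding compatible_matrix_norm_def by blast
  then show "nm A \<le> nm B + nm (A - B)" by simp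
qed

text \<open>The hypothesis controls the action on vectors; on the unit vector
  \<open>axis j 1\<close> it bounds the entries of column \<open>j\<close>.\<close>

lemma matrix_lipschitz_continuous:
  fixes \<sigma> :: "real^'n \<Rightarrow> real^'n^'n"
  assumes L: "\<And>y z v. norm ((\<sigma> y - \<sigma> z) *v v) \<le> L * norm (y - z) * norm v"
  shows "continuous_on UNIV \<sigma>"
proof -
  have "(\<sigma> \<longlongrightarrow> \<sigma> y) (at y)" for y
  proof (intro vec_tendstoI)
    fix i j
    have "\<bar>\<sigma> z $ i $ j - \<sigma> y $ i $ j\<bar> \<le> L * norm (z - y)" for z
    proof -
      have "((\<sigma> z - \<sigma> y) *v axis j 1) $ i = \<sigma> z $ i $ j - \<sigma> y $ i $ j"
        by (simp add: matrix_vector_mul_component inner_axis)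
      then show ?thesis using component_le_norm_cart[of "(\<sigma> z - \<sigma> y) *v axis j 1" i] L[of z y "axis j 1"]
        by simp
    qed
    then have bound: "\<forall>z. norm (\<sigma> z $ i $ j - \<sigma> y $ i $ j) \<le> L * norm (z - y)" by simp
    have "((\<lambda>z. L * norm (z - y)) \<longlongrightarrow> L * norm (y - y)) (at y)"
      by (intro tendsto_intros)
    then have "((\<lambda>z. L * norm (z - y)) \<longlongrightarrow> 0) (at y)" by simp
    then have "((\<lambda>z. \<sigma> z $ i $ j - \<sigma> y $ i $ j) \<longlongrightarrow> 0) (at y)"
      by (rule Lim_null_comparison[OF always_eventually[OF bound]])
    then show "((\<lambda>z. \<sigma> z $ i $ j) \<longlongrightarrow> \<sigma> y $ i $ j) (at y)" by (rule LIM_zero_cancel)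
  qed
  then show ?thesis by (simp add: continuous_on_def)
qed

section \<open>A deterministic bound on the number of steps\<close>

lemma adaptive_EM_time_ge:
  assumes "\<And>y. \<eta> \<le> h y"
  shows "real k * \<eta> \<le> fst (adaptive_EM \<mu> \<sigma> h x w k)"
proof (induction k)
  case (Suc k)
  then show ?case
    using assms[of "snd (adaptive_EM \<mu> \<sigma> h x w k)"] by (simp add: case_prod_unfold Let_def distrib_right)
qed simp

text \<open>This crude bound suffices when \<Theta> is empty and when \<delta> stays away from
  0.\<close>

lemma num_steps_le:
  assumes \<eta>: "0 < \<eta>" "\<And>y. \<eta> \<le> h y" and T: "0 \<le> T"
  shows "num_steps \<mu> \<sigma> h x T w \<le> ennreal (T / \<eta> + 1)"
proof -
  define k where "k = nat \<lceil>T / \<eta>\<rceil>"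
  have k: "T / \<eta> \<le> real k" "real k \<le> T / \<eta> + 1"
    using \<eta> T by (auto simp: k_def) 
  then have "T \<le> real k * \<eta>" using \<eta> by (simp add: field_simps)
  then have "T \<le> fst (adaptive_EM \<mu> \<sigma> h x w k)"
    using adaptive_EM_time_ge[where h = h, OF \<eta>(2)] order_trans by blast
  then have "num_steps \<mu> \<sigma> h x T w \<le> of_nat k"
    unfolding num_steps_def by (intro INF_lower) simp
  also have "\<dots> \<le> ennreal (T / \<eta> + 1)"
    using k(2) by (simp add: ennreal_of_nat_eq_real_of_nat ennreal_leI)
  finally show ?thesis .
qed

lemma (in prob_space) nn_integral_num_steps_le:
  assumes \<eta>: "0 < \<eta>" "\<And>y. \<eta> \<le> h y" and T: "0 \<le> T"
  shows "(\<integral>\<^sup>+\<omega>. num_steps \<mu> \<sigma> h x T (w \<omega>) \<partial>M) \<le> ennreal (T / \<eta> + 1)"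
proof -
  have "(\<integral>\<^sup>+\<omega>. num_steps \<mu> \<sigma> h x T (w \<omega>) \<partial>M) \<le> (\<integral>\<^sup>+\<omega>. ennreal (T / \<eta> + 1) \<partial>M)"
    by (intro nn_integral_mono num_steps_le[OF \<eta> T])
  then show ?thesis by (simp add: emeasure_space_1)
qed

lemma step_size_measurable [measurable]: "step_size S \<Theta> \<delta> \<in> borel_measurable borel"
  unfolding step_size_def[abs_def] tube_def by measurable

theorem theorem5p1:
  fixes M :: "'w measure" and F :: "real \<Rightarrow> 'w measure" and W :: "real \<Rightarrow> 'w \<Rightarrow> real ^ 'n"
    and nm :: "real ^ 'n ^ 'n \<Rightarrow> real"
    and x :: "real ^ 'n" and T \<epsilon>\<^sub>0 c\<^sub>0 :: real
    and \<mu> :: "real ^ 'n \<Rightarrow> real ^ 'n" and \<sigma> :: "real ^ 'n \<Rightarrow> real ^ 'n ^ 'n"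
    and \<Theta> :: "(real ^ 'n) set" and n \<alpha> :: "real ^ 'n \<Rightarrow> real ^ 'n"
  assumes "prob_space M" and "normal_filtration M F" and "brownian_motion M F W"
    and "compatible_matrix_norm nm"
    and "0 < T" and "0 < \<epsilon>\<^sub>0"
    and mu_measurable: "\<mu> \<in> borel_measurable borel"
    and a: "\<exists>L. \<forall>y z. nm (\<sigma> y - \<sigma> z) \<le> L * norm (y - z)"
    and b1: "exceptional_set \<mu> \<Theta>"
    and b2: "hypersurface 4 \<Theta>"
    and b3: "ennreal \<epsilon>\<^sub>0 < reach \<Theta>"
    and b4: "\<And>V m. unit_normal_vector \<Theta> V m \<Longrightarrow>
               bounded (tangential_derivative2 \<Theta> m ` V) \<and> bounded (tangential_derivative3 \<Theta> m ` V)"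
    and c: "bdd_above ((\<lambda>y. norm (\<mu> y) + nm (\<sigma> y)) ` tube \<Theta> \<epsilon>\<^sub>0)"
    and n: "\<And>\<xi>. \<xi> \<in> \<Theta> \<Longrightarrow> unit_normal_at \<Theta> \<xi> (n \<xi>)"
    and d: "0 < c\<^sub>0" "\<And>\<xi>. \<xi> \<in> \<Theta> \<Longrightarrow> c\<^sub>0 \<le> norm (transpose (\<sigma> \<xi>) *v n \<xi>)"
    and e1: "\<And>\<xi>. \<xi> \<in> \<Theta> \<Longrightarrow>
               ((\<lambda>h. (1 / (2 * (norm (transpose (\<sigma> \<xi>) *v n \<xi>))\<^sup>2)) *\<^sub>R
                      (\<mu> (\<xi> - h *\<^sub>R n \<xi>) - \<mu> (\<xi> + h *\<^sub>R n \<xi>))) \<longlongrightarrow> \<alpha> \<xi>) (at_right 0)"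
    and e2: "bounded (\<alpha> ` \<Theta>)" "C3b_along \<Theta> \<alpha> \<Theta>"
  shows "\<exists>C>0. \<forall>\<delta>. 0 < \<delta> \<and> \<delta> < 1 \<and> eps1 (sup_sigma nm \<sigma> \<Theta> \<epsilon>\<^sub>0) \<delta> < \<epsilon>\<^sub>0 / 4 \<longrightarrow>
           (\<integral>\<^sup>+ \<omega>. num_steps \<mu> \<sigma> (step_size (sup_sigma nm \<sigma> \<Theta> \<epsilon>\<^sub>0) \<Theta> \<delta>) x T (\<lambda>t. W t \<omega>) \<partial>M)
             \<le> ennreal (C * (1 + ln (1 / \<delta>)) / \<delta>)"
proof -
  interpret prob_space M by fact
  define S where "S = sup_sigma nm \<sigma> \<Theta> \<epsilon>\<^sub>0"
  define EN where "EN \<delta> = (\<integral>\<^sup>+ \<omega>. num_steps \<mu> \<sigma> (step_size S \<Theta> \<delta>) x T (\<lambda>t. W t \<omega>) \<partial>M)" for \<delta>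
  have T: "0 \<le> T" using \<open>0 < T\<close> by simp
  have logp: "1 \<le> 1 + ln (1 / \<delta>)" if "0 < \<delta>" "\<delta> < 1" for \<delta> :: real using that by simp
  have "\<exists>C>0. \<forall>\<delta>. 0 < \<delta> \<and> \<delta> < 1 \<longrightarrow> EN \<delta> \<le> ennreal (C * (1 + ln (1 / \<delta>)) / \<delta>)"
  proof (cases "\<Theta> = {}")
    case True
    \<comment> \<open>Both tubes are empty, so every step has length \<delta>.\<close>
    have "EN \<delta> \<le> ennreal ((T + 1) * (1 + ln (1 / \<delta>)) / \<delta>)" if \<delta>: "0 < \<delta>" "\<delta> < 1" for \<delta>
    proof -
      have "EN \<delta> \<le> ennreal (T / \<delta> + 1)"
        unfolding EN_def using True \<delta> T by (intro nn_integral_num_steps_le) (auto simp: step_size_def tube_def)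
      also have "T / \<delta> + 1 \<le> (T + 1) * 1 / \<delta>" using \<delta> by (simp add: field_simps)
      also have "(T + 1) * 1 / \<delta> \<le> (T + 1) * (1 + ln (1 / \<delta>)) / \<delta>"
        using \<delta> T logp[OF \<delta>] by (intro divide_right_mono mult_left_mono) auto
      finally show ?thesis by (simp add: ennreal_leI)
    qed
    then show ?thesis using \<open>0 < T\<close> by (intro exI[of _ "T + 1"]) auto
  next
    case False
    note nmD = compatible_matrix_normD[OF \<open>compatible_matrix_norm nm\<close>]
    have closed: "closed \<Theta>" using b3 by (rule reach_pos_imp_closed)
    obtain L where L: "\<And>y z. nm (\<sigma> y - \<sigma> z) \<le> L * norm (y - z)" using a by blast
    have Lv: "norm ((\<sigma> y - \<sigma> z) *v v) \<le> L * norm (y - z) * norm v" for y z v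
      using nmD(2)[of "\<sigma> y - \<sigma> z" v] mult_right_mono[OF L[of y z] norm_ge_zero[of v]] by linarith
    have \<sigma>c: "continuous_on UNIV \<sigma>" by (rule matrix_lipschitz_continuous[OF Lv])
    obtain B where B: "\<And>y. y \<in> tube \<Theta> \<epsilon>\<^sub>0 \<Longrightarrow> norm (\<mu> y) + nm (\<sigma> y) \<le> B"
      using c unfolding bdd_above_def by auto
    have tube: "y \<in> tube \<Theta> \<epsilon>\<^sub>0 \<longleftrightarrow> infdist y \<Theta> < \<epsilon>\<^sub>0" for y using False by (simp add: tube_def)
    have B\<mu>: "norm (\<mu> y) \<le> B" and B\<sigma>: "nm (\<sigma> y) \<le> B" if "infdist y \<Theta> < \<epsilon>\<^sub>0" for y
      using B[of y] that nmD(1)[of "\<sigma> y"] norm_ge_zero[of "\<mu> y"] unfolding tube by linarith+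
    obtain \<xi>\<^sub>0 where \<xi>\<^sub>0: "\<xi>\<^sub>0 \<in> \<Theta>" using False by blast
    then have in0: "infdist \<xi>\<^sub>0 \<Theta> < \<epsilon>\<^sub>0" using \<open>0 < \<epsilon>\<^sub>0\<close> by simp
    have B0: "0 \<le> B" using B\<mu>[OF in0] norm_ge_zero order_trans by blast
    have S: "nm (\<sigma> y) \<le> S" if "infdist y \<Theta> < \<epsilon>\<^sub>0" for y
      unfolding S_def sup_sigma_def
    proof (rule cSup_upper)
      show "nm (\<sigma> y) \<in> insert 0 ((\<lambda>y. nm (\<sigma> y)) ` tube \<Theta> \<epsilon>\<^sub>0)" using that tube by blast
      show "bdd_above (insert 0 ((\<lambda>y. nm (\<sigma> y)) ` tube \<Theta> \<epsilon>\<^sub>0))"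
        using B\<sigma> B0 tube by (intro bdd_aboveI[of _ B]) auto
    qed
    have Sv: "norm (\<sigma> y *v v) \<le> S * norm v" if "infdist y \<Theta> < \<epsilon>\<^sub>0" for y v
      using nmD(2)[of "\<sigma> y" v] mult_right_mono[OF S[OF that] norm_ge_zero[of v]] by linarith
    \<comment> \<open>A vanishing \<sigma> would contradict the nondegeneracy at
      \<open>\<xi>\<^sub>0\<close>. Positivity of \<open>S\<close> matters because it occurs in
      denominators, in the step size as well as in the constants.\<close>
    have S0: "0 < S"
    proof -
      have "c\<^sub>0 \<le> S * norm (n \<xi>\<^sub>0)"
        using d(2)[OF \<xi>\<^sub>0] transpose_bound[OF Sv[OF in0], of "n \<xi>\<^sub>0"] by linarith
      then show ?thesis using n[OF \<xi>\<^sub>0] d(1) by (simp add: unit_normal_at_def)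
    qed
    obtain L\<mu> where L\<mu>: "0 < L\<mu>" "\<And>x y. closed_segment x y \<inter> \<Theta> = {} \<Longrightarrow> norm (\<mu> x - \<mu> y) \<le> L\<mu> * dist x y"
      using exceptional_set_segment_lipschitz[OF b1] by blast
    have g\<mu>: "norm (\<mu> y) \<le> (B + L\<mu>) * (1 + infdist y \<Theta>)" for y
    proof (rule linear_growth_off_tube[OF closed False \<open>0 < \<epsilon>\<^sub>0\<close> B0 _ B\<mu>])
      show "0 \<le> L\<mu>" using L\<mu>(1) by simp
      show "norm (\<mu> y) \<le> norm (\<mu> x) + L\<mu> * dist x y" if "closed_segment x y \<inter> \<Theta> = {}" for x y
        using L\<mu>(2)[OF that] norm_triangle_sub[of "\<mu> y" "\<mu> x"] by (simp add: norm_minus_commute)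
    qed
    have g\<sigma>: "nm (\<sigma> y) \<le> (B + \<bar>L\<bar>) * (1 + infdist y \<Theta>)" for y
    proof (rule linear_growth_off_tube[OF closed False \<open>0 < \<epsilon>\<^sub>0\<close> B0 _ B\<sigma>])
      show "nm (\<sigma> y) \<le> nm (\<sigma> x) + \<bar>L\<bar> * dist x y" for x y
      proof -
        have "L * norm (y - x) \<le> \<bar>L\<bar> * norm (y - x)" by (intro mult_right_mono) auto
        then show ?thesis
          using nmD(3)[of "\<sigma> y" "\<sigma> x"] L[of y x] by (simp add: dist_norm norm_minus_commute)
      qed
    qed simp
    define G where "G = B + L\<mu> + \<bar>L\<bar>"
    have G0: "0 \<le> G" using B0 L\<mu>(1) by (simp add: G_def)
    have G\<mu>: "norm (\<mu> y) \<le> G * (1 + infdist y \<Theta>)" for y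
      by (rule order_trans[OF g\<mu> mult_right_mono]) (simp_all add: G_def infdist_nonneg)
    have G\<sigma>: "norm (\<sigma> y *v v) \<le> G * (1 + infdist y \<Theta>) * norm v" for y v
    proof -
      have "nm (\<sigma> y) \<le> G * (1 + infdist y \<Theta>)"
        using L\<mu>(1) by (intro order_trans[OF g\<sigma> mult_right_mono]) (simp_all add: G_def infdist_nonneg)
      from mult_right_mono[OF this norm_ge_zero[of v]] show ?thesis
        using nmD(2)[of "\<sigma> y" v] by linarith
    qed
    have b2': "hypersurface (Suc 3) \<Theta>" using b2 by (simp add: eval_nat_numeral)
    obtain a C c \<delta>\<^sub>0 where aC: "0 < a" "0 \<le> C" "0 < c" "0 < \<delta>\<^sub>0" "\<delta>\<^sub>0 < 1"
      and step: "\<And>\<delta> y. 0 < \<delta> \<and> \<delta> < \<delta>\<^sub>0 \<Longrightarrow>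
        (\<integral>z. potential a (eps2 S \<delta>) (infdist (y + step_size S \<Theta> \<delta> y *\<^sub>R \<mu> y + sqrt (step_size S \<Theta> \<delta> y) *\<^sub>R (\<sigma> y *v z)) \<Theta>) \<partial>std_gauss)
          \<le> potential a (eps2 S \<delta>) (infdist y \<Theta>) + C * step_size S \<Theta> \<delta> y - c * \<delta> / ln (1 / \<delta>)"
      using one_step[OF False \<open>0 < \<epsilon>\<^sub>0\<close> d(1) S0 G0
          reach_normal[OF b3 \<open>0 < \<epsilon>\<^sub>0\<close> False b2' n \<sigma>c d(2)] Sv G\<sigma> G\<mu> Lv] by blast
    obtain W' where W': "\<And>t. 0 \<le> t \<Longrightarrow> W' t \<in> borel_measurable (F t)"
      "\<And>\<omega>. continuous_on UNIV (\<lambda>t. W' t \<omega>)" "AE \<omega> in M. \<forall>t\<ge>0. W' t \<omega> = W t \<omega>"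
      by (rule brownian_continuous_modification[OF \<open>normal_filtration M F\<close> \<open>brownian_motion M F W\<close>]) (rule that)
    interpret continuous_brownian M F W' W
      using normal_filtrationD[OF \<open>normal_filtration M F\<close>] W' \<open>brownian_motion M F W\<close> by unfold_locales auto
    have [measurable]: "\<sigma> \<in> borel_measurable borel" using \<sigma>c by (rule borel_measurable_continuous_onI)
    define K where "K = (C * (T + 1) + a\<^sup>2) / c"
    have K: "0 \<le> K" using aC T by (simp add: K_def)
    \<comment> \<open>\<open>K\<close> comes from the drift inequality for
      \<open>\<delta> < \<delta>\<^sub>0\<close>, and \<open>T / \<delta>\<^sub>0 + 1\<close> from
      the crude bound for the other \<delta>; the sum serves both ranges.\<close>
    have "EN \<delta> \<le> ennreal ((K + T / \<delta>\<^sub>0 + 1) * (1 + ln (1 / \<delta>)) / \<delta>)" if \<delta>: "0 < \<delta>" "\<delta> < 1" for \<delta>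
    proof (cases "\<delta> < \<delta>\<^sub>0")
      case True
      note sc = step_size_cases[OF False S0 \<delta>]
      have l: "0 < ln (1 / \<delta>)" using \<delta> by simp
      have \<epsilon>: "0 < eps2 S \<delta>" by (rule eps2_pos[OF S0 \<delta>])
      have "EN \<delta> \<le> ennreal ((C * (T + 1) + a\<^sup>2) / (c * \<delta> / ln (1 / \<delta>)))"
        unfolding EN_def
      proof (rule expected_num_steps_le[where Q = "\<lambda>y. potential a (eps2 S \<delta>) (infdist y \<Theta>)"])
        show "continuous_on UNIV (\<lambda>y. potential a (eps2 S \<delta>) (infdist y \<Theta>))"
          by (rule continuous_on_compose2[OF continuous_on_potential[OF \<epsilon>, of UNIV]]) (auto intro!: continuous_intros)
        show "step_size S \<Theta> \<delta> y \<le> 1" for y using sc(2)[of y] \<delta> by simp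
        show "0 \<le> step_size S \<Theta> \<delta> y" for y using sc(1)[of y] by simp
        show "0 < c * \<delta> / ln (1 / \<delta>)" using aC \<delta> l by simp
      qed (use mu_measurable aC T \<delta> True step potential_bounds[OF \<epsilon>] in auto)
      also have "(C * (T + 1) + a\<^sup>2) / (c * \<delta> / ln (1 / \<delta>)) = K * ln (1 / \<delta>) / \<delta>"
        using aC \<delta> l by (simp add: K_def)
      also have "\<dots> \<le> (K + T / \<delta>\<^sub>0 + 1) * (1 + ln (1 / \<delta>)) / \<delta>"
        using K aC T \<delta> l by (intro divide_right_mono mult_mono) auto
      finally show ?thesis by (simp add: ennreal_leI)
    next
      case big: False
      \<comment> \<open>No step is shorter than \<open>\<delta>\<^sup>2\<close>, and
        \<open>1 / \<delta>\<^sup>2 \<le> 1 / (\<delta>\<^sub>0 * \<delta>)\<close> in this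
        range.\<close>
      have "EN \<delta> \<le> ennreal (T / \<delta>\<^sup>2 + 1)"
        unfolding EN_def using step_size_cases(3)[OF False S0 \<delta>] \<delta> T by (intro nn_integral_num_steps_le) auto
      also have "T / \<delta>\<^sup>2 + 1 \<le> (T / \<delta>\<^sub>0 + 1) / \<delta>"
      proof -
        have "T / \<delta> \<le> T / \<delta>\<^sub>0" using big aC T \<delta> by (intro divide_left_mono) auto
        then have "T / \<delta> / \<delta> \<le> T / \<delta>\<^sub>0 / \<delta>" using \<delta> by (intro divide_right_mono) auto
        moreover have "1 \<le> 1 / \<delta>" using \<delta> by simp
        ultimately show ?thesis by (simp add: power2_eq_square add_divide_distrib)
      qed
      also have "\<dots> = (T / \<delta>\<^sub>0 + 1) * 1 / \<delta>" by simp
      also have "\<dots> \<le> (K + T / \<delta>\<^sub>0 + 1) * (1 + ln (1 / \<delta>)) / \<delta>"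
        using K aC T \<delta> logp[OF \<delta>] by (intro divide_right_mono mult_mono) auto
      finally show ?thesis by (simp add: ennreal_leI)
    qed
    moreover have "0 < K + T / \<delta>\<^sub>0 + 1" using K aC T by (simp add: add_nonneg_pos)
    ultimately show ?thesis by blast
  qed
  then show ?thesis unfolding EN_def S_def by blast
qed

end
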